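(* Fix an integer $d\ge 2$, $\kappa_*>0$ and $\Lambda\ge 1$. There exist constants $C=C(d,\kappa_*,\Lambda)\ge 1$ and $c=c(d,\kappa_* )>0$ such that for every $N\ge 2$, every $0<\kappa\le\kappa_*$, every bounded probability density $\rho$ on $\mathbb R^d$ with $\|\rho\|_{L^\infty}\le\Lambda$, every configuration $X_N\in(\mathbb R^d)^N$ of pairwise distinct points, and every globally Lipschitz vector field $u:\mathbb R^d\to\mathbb R^d$, one has $$\mathcal F_N^{\kappa,\sharp}(X_N,\rho)+C\,a_{N,d}\ \ge\ c\,a_{N,d}>0$$ and $$|\mathcal H_N^{g_{\kappa,d}}(X_N,\rho;u)|\le C\,\|\nabla u\|_{L^\infty}\Bigl(\mathcal F_N^{\kappa,\sharp}(X_N,\rho)+C\,a_{N,d}\Bigr).$$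
   Context: Rate: $a_{N,2}=\frac{1+\log N}{N}$ and $a_{N,d}=N^{-2/d}$ for $d\ge3$. Yukawa kernel: for $\kappa>0$, $g_{\kappa,d}(x)=(2\pi)^{-d/2}\left(\frac{\kappa}{|x|}\right)^{\nu_d}K_{\nu_d}(\kappa|x|)$, $\nu_d=\frac d2-1$, where $K_\nu$ is the modified Bessel function of the second kind; $(-\Delta+\kappa^2)g_{\kappa,d}=\delta_0$. For a collision-free configuration $X_N=(x_1,\dots,x_N)$ put $\mu_{X_N}=\frac1N\sum_{i=1}^N\delta_{x_i}$ and $$\mathcal F_N^{g_{\kappa,d}}(X_N,\rho)=\iint_{x\ne y}g_{\kappa,d}(x-y)\,d(\mu_{X_N}-\rho)(x)\,d(\mu_{X_N}-\rho)(y),$$ $$\mathcal H_N^{g_{\kappa,d}}(X_N,\rho;u)=\iint_{x\ne y}(u(x)-u(y))\cdot\nabla g_{\kappa,d}(x-y)\,d(\mu_{X_N}-\rho)(x)\,d(\mu_{X_N}-\rho)(y).$$ Normalization: $c_{\kappa,d}=0$ for $d\ge3$ and $c_{\kappa,2}=\frac{\log\kappa}{2\pi}$; $\mathcal F_N^{\kappa,\sharp}(X_N,\rho)=\mathcal F_N^{g_{\kappa,d}}(X_N,\rho)-\frac{c_{\kappa,d}}{N}$. For a globally Lipschitz field, $\|\nabla u\|_{L^\infty}$ denotes its Lipschitz seminorm. *)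

theory Defs
  imports "HOL-Probability.Probability"
begin

(* Modified Bessel function of the second kind, through its integral representation
     K_nu(r) = int_0^infinity exp (- r cosh t) cosh (nu t) dt,   r > 0   (DLMF 10.32.9),
   valid for every real order nu, integer or not.  Only r > 0 is meaningful here. *)
definition bessel_K :: "real \<Rightarrow> real \<Rightarrow> real" where
  "bessel_K \<nu> r = (LINT t:{0..}|lborel. exp (- r * cosh t) * cosh (\<nu> * t))"

(* The value at the origin is junk; the kernel is only ever integrated off the diagonal. *)
definition yukawa :: "real \<Rightarrow> real ^ 'd::finite \<Rightarrow> real" where
  "yukawa \<kappa> x =
     (let d = real CARD('d); \<nu> = d / 2 - 1
      in (2 * pi) powr (- d / 2) * (\<kappa> / norm x) powr \<nu> * bessel_K \<nu> (\<kappa> * norm x))"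

definition gradient :: "('a::real_inner \<Rightarrow> real) \<Rightarrow> 'a \<Rightarrow> 'a" where
  "gradient f x = (THE D. GDERIV f x :> D)"

(* (1/N) times the sum of the point masses at x 0, ..., x (N - 1), as the image of the uniform
   probability on the index set; see integral_empirical_measure. *)
definition empirical_measure :: "nat \<Rightarrow> (nat \<Rightarrow> 'a::topological_space) \<Rightarrow> 'a measure" where
  "empirical_measure N x = distr (uniform_count_measure {..<N}) borel x"

lemma integral_empirical_measure:
  fixes f :: "'a::topological_space \<Rightarrow> real"
  assumes [measurable]: "f \<in> borel_measurable borel"
  shows "integral\<^sup>L (empirical_measure N x) f = (\<Sum>i<N. f (x i)) / real N"
proof -
  have "x \<in> uniform_count_measure {..<N} \<rightarrow>\<^sub>M borel"
    by (auto simp: measurable_def sets_uniform_count_measure space_uniform_count_measure)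
  then show ?thesis
    unfolding empirical_measure_def
    by (simp add: integral_distr integral_uniform_count_measure)
qed

abbreviation density_measure :: "('a::euclidean_space \<Rightarrow> real) \<Rightarrow> 'a measure" where
  "density_measure \<rho> \<equiv> density lborel (\<lambda>x. ennreal (\<rho> x))"

definition probability_density :: "('a::euclidean_space \<Rightarrow> real) \<Rightarrow> bool" where
  "probability_density \<rho> \<longleftrightarrow>
     (AE x in lborel. 0 \<le> \<rho> x) \<and> has_bochner_integral lborel \<rho> 1"

definition Linf_norm :: "('a::euclidean_space \<Rightarrow> real) \<Rightarrow> ereal" where
  "Linf_norm \<rho> = esssup lborel (\<lambda>x. ereal \<bar>\<rho> x\<bar>)"

definition offdiag_integral ::
  "('a \<Rightarrow> 'a \<Rightarrow> real) \<Rightarrow> 'a measure \<Rightarrow> 'a measure \<Rightarrow> real" where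
  "offdiag_integral F M L = (LINT p:{p. fst p \<noteq> snd p}|(M \<Otimes>\<^sub>M L). F (fst p) (snd p))"

(* The integral of F over {x \<noteq> y} against the signed product measure (M - L) \<otimes> (M - L),
   which is (M \<otimes> M) - (M \<otimes> L) - (L \<otimes> M) + (L \<otimes> L). *)
definition offdiag_integral_diff ::
  "('a \<Rightarrow> 'a \<Rightarrow> real) \<Rightarrow> 'a measure \<Rightarrow> 'a measure \<Rightarrow> real" where
  "offdiag_integral_diff F M L =
     offdiag_integral F M M - offdiag_integral F M L
       - offdiag_integral F L M + offdiag_integral F L L"

definition modulated_energy ::
  "('a::euclidean_space \<Rightarrow> real) \<Rightarrow> nat \<Rightarrow> (nat \<Rightarrow> 'a) \<Rightarrow> ('a \<Rightarrow> real) \<Rightarrow> real" where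
  "modulated_energy g N X \<rho> =
     offdiag_integral_diff (\<lambda>x y. g (x - y)) (empirical_measure N X) (density_measure \<rho>)"

definition commutator_energy ::
  "('a::euclidean_space \<Rightarrow> real) \<Rightarrow> nat \<Rightarrow> (nat \<Rightarrow> 'a) \<Rightarrow> ('a \<Rightarrow> real) \<Rightarrow> ('a \<Rightarrow> 'a) \<Rightarrow> real" where
  "commutator_energy g N X \<rho> u =
     offdiag_integral_diff (\<lambda>x y. (u x - u y) \<bullet> gradient g (x - y))
       (empirical_measure N X) (density_measure \<rho>)"

(* The constants c_(kappa,d) and a_(N,d); only dimensions d \<ge> 2 are used. *)
definition norm_const :: "real \<Rightarrow> nat \<Rightarrow> real" where
  "norm_const \<kappa> d = (if d = 2 then ln \<kappa> / (2 * pi) else 0)"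

definition rate :: "nat \<Rightarrow> nat \<Rightarrow> real" where
  "rate N d = (if d = 2 then (1 + ln (real N)) / real N else real N powr (- 2 / real d))"

definition normalized_energy ::
  "real \<Rightarrow> nat \<Rightarrow> (nat \<Rightarrow> real ^ 'd::finite) \<Rightarrow> (real ^ 'd \<Rightarrow> real) \<Rightarrow> real" where
  "normalized_energy \<kappa> N X \<rho> =
     modulated_energy (yukawa \<kappa>) N X \<rho> - norm_const \<kappa> CARD('d) / real N"

definition globally_lipschitz :: "('a::metric_space \<Rightarrow> 'b::metric_space) \<Rightarrow> bool" where
  "globally_lipschitz u \<longleftrightarrow> (\<exists>L. L-lipschitz_on UNIV u)"

definition lipschitz_seminorm :: "('a::metric_space \<Rightarrow> 'b::metric_space) \<Rightarrow> real" where
  "lipschitz_seminorm u = Inf {L. L-lipschitz_on UNIV u}"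

end

theory Submission
  imports Defs
begin

text \<open>
  The Yukawa kernel is the superposition \<open>\<integral> exp (- \<kappa>\<^sup>2 t) p\<^sub>t dt\<close> of heat kernels \<open>p\<^sub>t\<close> over \<open>t > 0\<close>. Cut the time
  integral at a multiple of \<open>s = N^(-2/d)\<close>, the square of the typical distance between particles. The late part is a
  bounded positive definite kernel; its self-interaction per particle is of order \<open>a_{N,d}\<close> after normalization. The
  early part is nonnegative with integral \<open>O(s)\<close>. Hence the normalized energy, up to \<open>O(a_{N,d})\<close>, dominates both the
  late energy of \<open>\<mu> - \<rho>\<close> and the early interaction of distinct particles.

  For the commutator the early part is pointwise comparable to the early interaction on a doubled time window, as
  \<open>|x|\<^sup>2 p\<^sub>t / t\<close> is at most a multiple of \<open>p\<^sub>2\<^sub>t\<close>. For the late part let \<open>h\<close> be the potential of the measure smeared at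
  scale \<open>s\<close>. The stress tensor of \<open>h\<close> bounds the commutator of the smeared measure by the late energy. Replacing
  \<open>u(z)\<close> by \<open>u(x)\<close> under the smearing costs \<open>\<nabla>h\<close> in \<open>L\<^sup>2\<close> times the square root of \<open>s\<close> times the \<open>L\<^sup>2\<close> norm of
  the smeared measure \<open>\<mu> + \<rho>\<close>, and that norm is controlled by the early interaction.
\<close>

section \<open>The heat kernel\<close>

text \<open>The field \<open>u\<close> is only Lipschitz: it may be unbounded, and no derivative of
  it is used. Therefore integration by parts is done on single pairs of heat kernels, whose Gaussian
  decay tolerates linear growth, and with difference quotients of \<open>u\<close>. Averaging over
  pairs afterwards needs only bounds that are uniform in the pair. The heat equation makes \<Delta>
  - \<open>\<kappa>\<^sup>2\<close> of the late kernel an exact time derivative, so the late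
  potential solves an elliptic equation whose source is the measure smeared up to the cutting time
  \<open>s\<close>. Pairing potential and source adds \<open>s\<close> to every time, which is why
  the energy appears with cut \<open>2 * s\<close>. The energy bounds the late and early terms for
  every cut \<open>c * s\<close> with \<open>c \<ge> 1\<close>, at a cost proportional to
  \<open>c\<close>. The commutator estimates may therefore lose bounded factors in time; the windows
  \<open>2 * s\<close>, \<open>4 * s\<close> and \<open>8 * s\<close> are all compared with one and
  the same energy at the end. In dimension two the bound for the late self-interaction contains - ln
  \<kappa> / (2 \<pi>), which blows up as \<kappa> tends to 0. The normalizing constant cancels
  exactly this term, so that the final constants involve only the upper bound on \<kappa>.\<close>

definition heat :: "real \<Rightarrow> 'a::euclidean_space \<Rightarrow> real" where
  "heat t y = (4 * pi * t) powr (- real DIM('a) / 2) * exp (- (norm y)\<^sup>2 / (4 * t))"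

text \<open>Closed form of the partial derivative of the heat kernel along a basis vector
  \<open>i\<close>; \<open>ddheat\<close> below is the second derivative along \<open>i\<close> and
  \<open>j\<close>. That they are derivatives is checked along lines in
  \<open>has_derivative_heat_line\<close> and \<open>has_derivative_dheat_line\<close>.\<close>

definition dheat :: "'a::euclidean_space \<Rightarrow> real \<Rightarrow> 'a \<Rightarrow> real" where
  "dheat i t y = - (y \<bullet> i) / (2 * t) * heat t y"

definition ddheat :: "'a::euclidean_space \<Rightarrow> 'a \<Rightarrow> real \<Rightarrow> 'a \<Rightarrow> real" where
  "ddheat i j t y = ((y \<bullet> i) * (y \<bullet> j) / (4 * t\<^sup>2) - (i \<bullet> j) / (2 * t)) * heat t y"

lemma heat_nonneg [simp]: "0 \<le> heat t y"
  by (simp add: heat_def)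

lemma heat_pos: "0 < t \<Longrightarrow> 0 < heat t y"
  by (simp add: heat_def)

lemma heat_minus_commute: "heat t (x - y) = heat t (y - x)"
  by (simp add: heat_def norm_minus_commute)

lemma heat_le_zero: "0 < t \<Longrightarrow> heat t (y :: 'a::euclidean_space) \<le> heat t (0 :: 'a)"
  by (simp add: heat_def mult_left_le)

lemma heat_le_heat_zero:
  assumes "0 < s" "s \<le> t"
  shows "heat t (y :: 'a::euclidean_space) \<le> heat s (0 :: 'a)"
proof -
  have "heat t y \<le> heat t (0 :: 'a)" using assms by (intro heat_le_zero) simp
  also have "\<dots> \<le> heat s (0 :: 'a)" using assms by (simp add: heat_def powr_mono2')
  finally show ?thesis .
qed

lemma heat_measurable [measurable]:
  assumes [measurable]: "f \<in> borel_measurable M" "g \<in> borel_measurable M"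
  shows "(\<lambda>x. heat (f x) (g x)) \<in> borel_measurable M"
  unfolding heat_def by measurable

lemma dheat_measurable [measurable]:
  assumes [measurable]: "f \<in> borel_measurable M" "g \<in> borel_measurable M"
  shows "(\<lambda>x. dheat i (f x) (g x)) \<in> borel_measurable M"
  unfolding dheat_def by measurable

lemma ddheat_measurable [measurable]:
  assumes [measurable]: "f \<in> borel_measurable M" "g \<in> borel_measurable M"
  shows "(\<lambda>x. ddheat i j (f x) (g x)) \<in> borel_measurable M"
  unfolding ddheat_def by measurable

lemma nn_integral_heat_centered:
  fixes t :: real
  assumes t: "0 < t"
  shows "(\<integral>\<^sup>+z. ennreal (heat t (z :: 'a::euclidean_space)) \<partial>lborel) = 1"
proof -
  \<comment> \<open>The heat kernel for \<Delta> (not half of it) has variance \<open>2 * t\<close>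
    in each coordinate and factorizes into one-dimensional normal densities.\<close>
  define \<phi> where "\<phi> = (\<lambda>x::real. normal_density 0 (sqrt (2 * t)) x)"
  have \<phi>: "\<phi> x = (4 * pi * t) powr (- 1 / 2) * exp (- x\<^sup>2 / (4 * t))" for x
    using t by (simp add: \<phi>_def normal_density_def powr_minus_divide powr_half_sqrt field_simps)
  have prod: "heat t z = (\<Prod>b\<in>Basis. \<phi> (z \<bullet> b))" for z :: 'a
  proof -
    have "(\<Prod>b\<in>(Basis::'a set). \<phi> (z \<bullet> b))
        = ((4 * pi * t) powr (- 1 / 2)) ^ DIM('a) * exp (\<Sum>b\<in>Basis. - (z \<bullet> b)\<^sup>2 / (4 * t))"
      by (simp add: \<phi> prod.distrib exp_sum)
    also have "(\<Sum>b\<in>Basis. - (z \<bullet> b)\<^sup>2 / (4 * t)) = - (norm z)\<^sup>2 / (4 * t)"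
      by (simp add: norm_eq_sqrt_inner euclidean_inner[of z z] power2_eq_square sum_nonneg
          sum_divide_distrib sum_negf)
    also have "((4 * pi * t) powr (- 1 / 2)) ^ DIM('a) = (4 * pi * t) powr (- real DIM('a) / 2)"
      using t by (simp add: powr_realpow[symmetric] powr_powr)
    finally show ?thesis by (simp add: heat_def)
  qed
  have one: "(\<integral>\<^sup>+x. ennreal (\<phi> x) \<partial>lborel) = 1"
    using t by (subst nn_integral_eq_integral) (auto simp: \<phi>_def)
  have "(\<integral>\<^sup>+z. ennreal (heat t (z :: 'a)) \<partial>lborel)
      = (\<integral>\<^sup>+z. (\<Prod>b\<in>Basis. ennreal (\<phi> (z \<bullet> b))) \<partial>(lborel :: 'a measure))"
    by (simp add: prod prod_ennreal \<phi>)
  also have "\<dots> = (\<Prod>b\<in>(Basis :: 'a set). \<integral>\<^sup>+x. ennreal (\<phi> x) \<partial>lborel)"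
    by (rule nn_integral_lborel_prod) (auto simp: \<phi>_def)
  finally show ?thesis by (simp add: one)
qed

lemma lborel_distr_minus: "distr lborel borel (\<lambda>z. z - x) = (lborel :: 'a::euclidean_space measure)"
  using lborel_distr_plus[of "- x"] by (simp add: add.commute[of "- x"] cong: distr_cong)

lemma nn_integral_heat:
  fixes x :: "'a::euclidean_space"
  assumes t: "0 < t"
  shows "(\<integral>\<^sup>+z. ennreal (heat t (z - x)) \<partial>lborel) = 1"
proof -
  have "(\<integral>\<^sup>+z. ennreal (heat t z) \<partial>distr lborel borel (\<lambda>z. z - x))
      = (\<integral>\<^sup>+z. ennreal (heat t (z - x)) \<partial>lborel)"
    by (rule nn_integral_distr) measurable
  then show ?thesis using nn_integral_heat_centered[OF t, where 'a='a] by (simp add: lborel_distr_minus)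
qed

lemma has_bochner_integral_heat:
  fixes x :: "'a::euclidean_space"
  assumes t: "0 < t"
  shows "has_bochner_integral lborel (\<lambda>z. heat t (z - x)) 1"
  by (rule has_bochner_integral_nn_integral) (use nn_integral_heat[OF t, of x] in auto)

lemma integrable_heat: "0 < t \<Longrightarrow> integrable lborel (\<lambda>z. heat t (z - (x::'a::euclidean_space)))"
  using has_bochner_integral_heat by (auto simp: has_bochner_integral_iff)

lemma integral_heat: "0 < t \<Longrightarrow> (\<integral>z. heat t (z - (x::'a::euclidean_space)) \<partial>lborel) = 1"
  using has_bochner_integral_heat by (auto simp: has_bochner_integral_iff)

section \<open>Products and convolutions of heat kernels\<close>

lemma mult_mult_swap: "(a * b) * (c * d) = (a * c) * (b * d)" for a b c d :: real
  by simp

text \<open>Completing the square: \<open>m\<close> is the mean of the centres weighted by inverse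
  times, and the times combine harmonically in the remaining Gaussian. Once \<open>z\<close> is
  separated off in this way, convolutions and first moments reduce to those of one centred heat
  kernel.\<close>

lemma heat_mult:
  fixes x y z :: "'a::euclidean_space"
  assumes t: "0 < t" and s: "0 < s"
  defines "m \<equiv> (s / (s + t)) *\<^sub>R x + (t / (s + t)) *\<^sub>R y"
  shows "heat t (z - x) * heat s (z - y) = heat (t + s) (x - y) * heat (t * s / (t + s)) (z - m)"
proof -
  have ts: "t + s > 0" using t s by simp
  have id: "z - m = (s / (s + t)) *\<^sub>R (z - x) + (t / (s + t)) *\<^sub>R (z - y)"
  proof -
    have "s / (s + t) + t / (s + t) = 1" using t s by (simp add: add_divide_distrib[symmetric])
    then have "z = (s / (s + t)) *\<^sub>R z + (t / (s + t)) *\<^sub>R z"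
      by (metis scaleR_add_left scaleR_one)
    then show ?thesis unfolding m_def by (simp add: algebra_simps)
  qed
  define a where "a = z - x"
  define b where "b = z - y"
  have xy: "x - y = b - a" by (simp add: a_def b_def)
  have e: "- (norm a)\<^sup>2 / (4 * t) + - (norm b)\<^sup>2 / (4 * s)
      = - (norm (b - a))\<^sup>2 / (4 * (t + s))
        + - (norm ((s / (s + t)) *\<^sub>R a + (t / (s + t)) *\<^sub>R b))\<^sup>2 / (4 * (t * s / (t + s)))"
  proof -
    have *: "(norm ((s / (s + t)) *\<^sub>R a + (t / (s + t)) *\<^sub>R b))\<^sup>2
       = (s\<^sup>2 * (a \<bullet> a) + 2 * s * t * (a \<bullet> b) + t\<^sup>2 * (b \<bullet> b)) / (s + t)\<^sup>2"
      unfolding power2_norm_eq_inner using ts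
      by (simp add: inner_add_left inner_add_right inner_commute[of b a] divide_simps)
        (simp add: power2_eq_square algebra_simps)
    moreover have "(norm (b - a))\<^sup>2 = a \<bullet> a - 2 * (a \<bullet> b) + b \<bullet> b"
      by (simp add: power2_norm_eq_inner inner_diff_left inner_diff_right inner_commute)
    moreover have "- p / (4 * t) + - r / (4 * s)
        = - (p - 2 * q + r) / (4 * (t + s))
          + - ((s\<^sup>2 * p + 2 * s * t * q + t\<^sup>2 * r) / (s + t)\<^sup>2) / (4 * (t * s / (t + s)))" for p q r :: real
    proof -
      have "- ((s\<^sup>2 * p + 2 * s * t * q + t\<^sup>2 * r) / (s + t)\<^sup>2) / (4 * (t * s / (t + s)))
        = - (s\<^sup>2 * p + 2 * s * t * q + t\<^sup>2 * r) / (4 * t * s * (t + s))"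
      proof -
        have "- (X / (s + t)\<^sup>2) / (4 * (t * s / (t + s))) = - X / (4 * t * s * (t + s))" for X
          using t s ts by (simp add: add.commute[of s t] divide_simps power2_eq_square)
        then show ?thesis .
      qed
      moreover have "- p / (4 * t) + - r / (4 * s) = - (p * s + r * t) * (t + s) / (4 * t * s * (t + s))"
        using t s ts by (simp add: divide_simps)
      moreover have "- (p - 2 * q + r) / (4 * (t + s)) = - (p - 2 * q + r) * t * s / (4 * t * s * (t + s))"
        using t s ts by (simp add: divide_simps)
      moreover have "- (p * s + r * t) * (t + s) = - (p - 2 * q + r) * t * s + - (s\<^sup>2 * p + 2 * s * t * q + t\<^sup>2 * r)"
        by (simp add: algebra_simps power2_eq_square)
      ultimately show ?thesis by (simp only: add_divide_distrib[symmetric])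
    qed
    ultimately show ?thesis by (simp only: * power2_norm_eq_inner[of a] power2_norm_eq_inner[of b])
  qed
  have c: "(4 * pi * t) powr k * (4 * pi * s) powr k
      = (4 * pi * (t + s)) powr k * (4 * pi * (t * s / (t + s))) powr k" for k
  proof -
    have "(4 * pi * t) * (4 * pi * s) = (4 * pi * (t + s)) * (4 * pi * (t * s / (t + s)))"
      using t s ts by simp
    moreover have "(4 * pi * t) powr k * (4 * pi * s) powr k = ((4 * pi * t) * (4 * pi * s)) powr k"
      by (rule powr_mult[symmetric])
    moreover have "(4 * pi * (t + s)) powr k * (4 * pi * (t * s / (t + s))) powr k
        = ((4 * pi * (t + s)) * (4 * pi * (t * s / (t + s)))) powr k"
      by (rule powr_mult[symmetric])
    ultimately show ?thesis by (simp only:)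
  qed
  have *: "heat r y = (4 * pi * r) powr (- real DIM('a) / 2) * exp (- (norm y)\<^sup>2 / (4 * r))" for r and y :: 'a
    by (simp add: heat_def)
  have "heat t a * heat s b = ((4 * pi * t) powr (- real DIM('a) / 2) * (4 * pi * s) powr (- real DIM('a) / 2))
      * exp (- (norm a)\<^sup>2 / (4 * t) + - (norm b)\<^sup>2 / (4 * s))"
    unfolding * exp_add by (rule mult_mult_swap)
  also have "\<dots> = heat (t + s) (b - a)
      * heat (t * s / (t + s)) ((s / (s + t)) *\<^sub>R a + (t / (s + t)) *\<^sub>R b)"
    unfolding e c * exp_add by (rule mult_mult_swap)
  finally show ?thesis unfolding id xy a_def[symmetric] b_def[symmetric] .
qed

text \<open>Doubling the time gives up only half of the Gaussian exponent. The exponential set free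
  here absorbs powers of \<open>norm y\<close>; each factor of the norm then costs a factor
  \<open>sqrt t\<close>.\<close>

lemma heat_double:
  assumes "0 < t"
  shows "heat t y = 2 powr (real DIM('a) / 2) * exp (- (norm y)\<^sup>2 / (8 * t)) * heat (2 * t) (y :: 'a::euclidean_space)"
proof -
  have "(4 * pi * t) powr (- real DIM('a) / 2)
      = 2 powr (real DIM('a) / 2) * (4 * pi * (2 * t)) powr (- real DIM('a) / 2)"
  proof -
    have "(4 * pi * (2 * t)) powr k = 2 powr k * (4 * pi * t) powr k" for k
      using assms by (subst powr_mult[symmetric]) (auto simp: mult_ac)
    moreover have "2 powr (real DIM('a) / 2) * 2 powr (- real DIM('a) / 2) = (1 :: real)"
      by (simp flip: powr_add)
    ultimately show ?thesis by simp
  qed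
  moreover have "exp (- (norm y)\<^sup>2 / (4 * t)) = exp (- (norm y)\<^sup>2 / (8 * t)) * exp (- (norm y)\<^sup>2 / (4 * (2 * t)))"
    using assms by (simp add: exp_add[symmetric] field_simps)
  ultimately show ?thesis by (simp add: heat_def)
qed

lemma norm_power2_heat_le:
  assumes t: "0 < t"
  shows "(norm y)\<^sup>2 * heat t y \<le> 8 * t * 2 powr (real DIM('a) / 2) * heat (2 * t) (y :: 'a::euclidean_space)"
proof -
  define q where "q = (norm y)\<^sup>2 / (8 * t)"
  have "q * exp (- q) \<le> 1"
  proof -
    have "q \<le> exp q" using exp_ge_add_one_self[of q] by linarith
    then show ?thesis by (simp add: exp_minus field_simps)
  qed
  then have "8 * t * (q * exp (- q)) * (2 powr (real DIM('a) / 2) * heat (2 * t) y)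
      \<le> 8 * t * 1 * (2 powr (real DIM('a) / 2) * heat (2 * t) y)"
    using t by (intro mult_right_mono mult_left_mono) auto
  moreover have y: "(norm y)\<^sup>2 = 8 * t * q" using t by (simp add: q_def)
  moreover have "- (norm y)\<^sup>2 / (8 * t) = - q" by (simp add: q_def)
  ultimately show ?thesis
    by (simp only: heat_double[OF t, of y]) (simp add: mult_ac)
qed

lemma norm_heat_le:
  assumes t: "0 < t"
  shows "norm y * heat t y \<le> 3 * sqrt t * 2 powr (real DIM('a) / 2) * heat (2 * t) (y :: 'a::euclidean_space)"
proof -
  define q where "q = (norm y)\<^sup>2 / (8 * t)"
  have q0: "q \<ge> 0" using t by (simp add: q_def)
  have "q \<le> exp q" using exp_ge_add_one_self[of q] by linarith
  also have "\<dots> \<le> exp (2 * q)" using q0 by simp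
  finally have q: "q * exp (- 2 * q) \<le> 1" by (simp add: exp_minus field_simps)
  have "(norm y * exp (- q))\<^sup>2 = 8 * t * (q * exp (- 2 * q))"
  proof -
    have "(exp (- q))\<^sup>2 = exp (- 2 * q)" by (simp add: power2_eq_square flip: exp_add)
    then show ?thesis using t by (simp add: q_def power_mult_distrib)
  qed
  also have "\<dots> \<le> 8 * t * 1" using t q by (intro mult_left_mono) auto
  also have "\<dots> \<le> (3 * sqrt t)\<^sup>2" using t by (simp add: power_mult_distrib)
  finally have "norm y * exp (- q) \<le> 3 * sqrt t"
    by (rule power2_le_imp_le) (use t in auto)
  then have "(norm y * exp (- q)) * (2 powr (real DIM('a) / 2) * heat (2 * t) y)
      \<le> 3 * sqrt t * (2 powr (real DIM('a) / 2) * heat (2 * t) y)"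
    by (intro mult_right_mono) auto
  then show ?thesis
    by (subst heat_double[OF t]) (simp add: q_def mult_ac)
qed

lemma integrable_norm_heat:
  assumes t: "0 < t"
  shows "integrable lborel (\<lambda>z. norm (z - x) * heat t (z - (x :: 'a::euclidean_space)))"
proof (rule Bochner_Integration.integrable_bound)
  show "integrable lborel (\<lambda>z. 3 * sqrt t * 2 powr (real DIM('a) / 2) * heat (2 * t) (z - x))"
    using t by (intro integrable_mult_right integrable_heat) auto
  have "norm (norm (z - x) * heat t (z - x)) \<le> norm (3 * sqrt t * 2 powr (real DIM('a) / 2) * heat (2 * t) (z - x))" for z
    using norm_heat_le[OF t, of "z - x"] t by (simp add: abs_mult)
  then show "AE z in lborel. norm (norm (z - x) * heat t (z - x)) \<le> norm (3 * sqrt t * 2 powr (real DIM('a) / 2) * heat (2 * t) (z - x))"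
    by simp
qed measurable

lemma integral_lborel_minus:
  fixes f :: "'a::euclidean_space \<Rightarrow> real"
  assumes [measurable]: "f \<in> borel_measurable borel"
  shows "(\<integral>z. f (z - x) \<partial>lborel) = (\<integral>z. f z \<partial>lborel)"
proof -
  have "(\<integral>z. f z \<partial>distr lborel borel (\<lambda>z. z - x)) = (\<integral>z. f (z - x) \<partial>lborel)"
    by (rule integral_distr) measurable
  then show ?thesis by (simp add: lborel_distr_minus)
qed

lemma integral_lborel_uminus:
  fixes f :: "'a::euclidean_space \<Rightarrow> real"
  assumes [measurable]: "f \<in> borel_measurable borel"
  shows "(\<integral>z. f (- z) \<partial>lborel) = (\<integral>z. f z \<partial>lborel)"
proof -
  have "lborel = distr lborel borel (\<lambda>z. - z :: 'a)"
    using lborel_affine[of "-1" "0::'a"] by (simp add: density_1 one_ennreal_def[symmetric])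
  moreover have "(\<integral>z. f z \<partial>distr lborel borel (\<lambda>z. - z)) = (\<integral>z. f (- z) \<partial>lborel)"
    by (rule integral_distr) measurable
  ultimately show ?thesis by simp
qed

lemma integral_heat_mult:
  fixes x y :: "'a::euclidean_space"
  assumes t: "0 < t" and s: "0 < s"
  shows "(\<integral>z. heat t (z - x) * heat s (z - y) \<partial>lborel) = heat (t + s) (x - y)"
  using t s by (simp add: heat_mult integral_heat)

lemma integral_inner_heat:
  fixes x :: "'a::euclidean_space"
  assumes r: "0 < r"
  shows "(\<integral>z. (z - x) \<bullet> i * heat r (z - x) \<partial>lborel) = 0"
proof -
  have "(\<integral>z. (z - x) \<bullet> i * heat r (z - x) \<partial>lborel) = (\<integral>z. z \<bullet> i * heat r (z :: 'a) \<partial>lborel)"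
    by (rule integral_lborel_minus) measurable
  moreover have "(\<integral>z. z \<bullet> i * heat r (z :: 'a) \<partial>lborel) = (\<integral>z. (- z) \<bullet> i * heat r (- z :: 'a) \<partial>lborel)"
    by (rule integral_lborel_uminus[symmetric]) measurable
  moreover have "(\<integral>z. (- z) \<bullet> i * heat r (- z :: 'a) \<partial>lborel) = - (\<integral>z. z \<bullet> i * heat r (z :: 'a) \<partial>lborel)"
    by (simp add: heat_def)
  ultimately show ?thesis by linarith
qed

text \<open>Semigroup law with one derivative. After \<open>heat_mult\<close> the linear factor
  splits into \<open>z - m\<close>, which is odd about the centre and integrates to zero, and the
  constant \<open>m - x\<close>.\<close>

lemma integral_dheat_mult_heat:
  fixes x y :: "'a::euclidean_space"
  assumes t: "0 < t" and s: "0 < s" and i: "i \<in> Basis"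
  shows "(\<integral>z. dheat i t (z - x) * heat s (z - y) \<partial>lborel) = dheat i (t + s) (y - x)"
proof -
  define m where "m = (s / (s + t)) *\<^sub>R x + (t / (s + t)) *\<^sub>R y"
  define r where "r = t * s / (t + s)"
  have r: "r > 0" using t s by (simp add: r_def)
  have mx: "m - x = (t / (s + t)) *\<^sub>R (y - x)"
  proof -
    have "x = (s / (s + t)) *\<^sub>R x + (t / (s + t)) *\<^sub>R x"
      using t s by (metis add_divide_distrib add_pos_pos divide_self less_irrefl scaleR_add_left scaleR_one)
    then show ?thesis unfolding m_def by (simp add: algebra_simps)
  qed
  have eq: "dheat i t (z - x) * heat s (z - y)
      = - heat (t + s) (x - y) / (2 * t) * ((z - m) \<bullet> i * heat r (z - m))
        + - heat (t + s) (x - y) / (2 * t) * ((m - x) \<bullet> i) * heat r (z - m)" for z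
  proof -
    have "(z - x) \<bullet> i = (z - m) \<bullet> i + (m - x) \<bullet> i" by (simp add: inner_diff_left)
    moreover have "dheat i t (z - x) * heat s (z - y) = - ((z - x) \<bullet> i) / (2 * t) * (heat t (z - x) * heat s (z - y))"
      by (simp add: dheat_def)
    ultimately show ?thesis
      unfolding heat_mult[OF t s] m_def[symmetric] r_def[symmetric]
      by (simp add: algebra_simps add_divide_distrib diff_divide_distrib)
  qed
  have int1: "integrable lborel (\<lambda>z. (z - m) \<bullet> i * heat r (z - m))"
  proof (rule Bochner_Integration.integrable_bound[OF integrable_norm_heat[OF r, of m]])
    have "norm ((z - m) \<bullet> i * heat r (z - m)) \<le> norm (norm (z - m) * heat r (z - m))" for z
      using Basis_le_norm[OF i, of "z - m"] by (simp add: abs_mult mult_right_mono)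
    then show "AE z in lborel. norm ((z - m) \<bullet> i * heat r (z - m)) \<le> norm (norm (z - m) * heat r (z - m))"
      by simp
  qed measurable
  have "(\<integral>z. dheat i t (z - x) * heat s (z - y) \<partial>lborel)
      = - heat (t + s) (x - y) / (2 * t) * ((m - x) \<bullet> i)"
    unfolding eq
    by (subst Bochner_Integration.integral_add)
      (use int1 integrable_heat[OF r, of m] integral_inner_heat[OF r, of m i] integral_heat[OF r, of m] in auto)
  also have "\<dots> = dheat i (t + s) (y - x)"
    using t s by (simp add: mx dheat_def heat_minus_commute[of _ x y] divide_simps)
  finally show ?thesis .
qed

lemma heat_mono_scale:
  assumes "0 < t" "t \<le> t'"
  shows "heat t y \<le> (t' / t) powr (real DIM('a) / 2) * heat t' (y :: 'a::euclidean_space)"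
proof -
  have "(4 * pi * t) powr (- real DIM('a) / 2)
      = (t' / t) powr (real DIM('a) / 2) * (4 * pi * t') powr (- real DIM('a) / 2)"
    using assms by (simp add: powr_mult powr_divide powr_minus field_simps)
  moreover have "exp (- (norm y)\<^sup>2 / (4 * t)) \<le> exp (- (norm y)\<^sup>2 / (4 * t'))"
    using assms by (simp add: frac_le)
  ultimately show ?thesis
    unfolding heat_def by (simp add: mult_left_mono mult.assoc)
qed

text \<open>Moving the centre to the origin costs a doubled time and a constant depending on the
  shift, because the square of \<open>norm z\<close> is at most twice the sum of the squares of
  \<open>norm (z - x)\<close> and \<open>norm x\<close>.\<close>

lemma heat_shift_le:
  assumes t: "0 < t"
  shows "heat t (z - x) \<le> 2 powr (real DIM('a) / 2) * exp ((norm x)\<^sup>2 / (4 * t)) * heat (2 * t) (z :: 'a::euclidean_space)"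
proof -
  have "norm z \<le> norm (z - x) + norm x" by (metis diff_add_cancel norm_triangle_ineq)
  then have "(norm z)\<^sup>2 \<le> (norm (z - x) + norm x)\<^sup>2" by (intro power_mono) auto
  also have "\<dots> \<le> 2 * (norm (z - x))\<^sup>2 + 2 * (norm x)\<^sup>2"
    using zero_le_power2[of "norm (z - x) - norm x"] by (simp add: power2_sum power2_diff)
  finally have le: "- (norm (z - x))\<^sup>2 / (4 * t) \<le> (norm x)\<^sup>2 / (4 * t) + - (norm z)\<^sup>2 / (4 * (2 * t))"
    using t by (simp add: field_simps)
  have c: "(4 * pi * t) powr (- real DIM('a) / 2)
      = 2 powr (real DIM('a) / 2) * (4 * pi * (2 * t)) powr (- real DIM('a) / 2)"
    using heat_double[OF t, of "0::'a"] by (simp add: heat_def)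
  have "heat t (z - x) \<le> (4 * pi * t) powr (- real DIM('a) / 2) * exp ((norm x)\<^sup>2 / (4 * t) + - (norm z)\<^sup>2 / (4 * (2 * t)))"
    unfolding heat_def using le by (intro mult_left_mono) auto
  also have "\<dots> = 2 powr (real DIM('a) / 2) * exp ((norm x)\<^sup>2 / (4 * t)) * heat (2 * t) z"
    unfolding heat_def exp_add c by (simp only: mult_ac)
  finally show ?thesis .
qed

lemma dheat_le:
  assumes t: "0 < t" and i: "i \<in> Basis"
  shows "\<bar>dheat i t y\<bar> \<le> 2 / sqrt t * 2 powr (real DIM('a) / 2) * heat (2 * t) (y :: 'a::euclidean_space)"
proof -
  have "\<bar>dheat i t y\<bar> = \<bar>y \<bullet> i\<bar> * heat t y / (2 * t)" using t by (simp add: dheat_def abs_mult)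
  also have "\<dots> \<le> norm y * heat t y / (2 * t)"
    using t Basis_le_norm[OF i, of y] by (intro divide_right_mono mult_right_mono) auto
  also have "\<dots> \<le> 3 * sqrt t * 2 powr (real DIM('a) / 2) * heat (2 * t) y / (2 * t)"
    using t norm_heat_le[OF t, of y] by (intro divide_right_mono) auto
  also have "\<dots> = (3 / 2) / sqrt t * 2 powr (real DIM('a) / 2) * heat (2 * t) y"
  proof -
    have "3 * sqrt t / (2 * t) = (3 / 2) / sqrt t" using t by (simp add: field_simps)
    moreover have "3 * sqrt t * 2 powr (real DIM('a) / 2) * heat (2 * t) y / (2 * t)
        = 3 * sqrt t / (2 * t) * 2 powr (real DIM('a) / 2) * heat (2 * t) y" by simp
    ultimately show ?thesis by simp
  qed
  also have "\<dots> \<le> 2 / sqrt t * 2 powr (real DIM('a) / 2) * heat (2 * t) y"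
    using t by (intro mult_right_mono divide_right_mono) auto
  finally show ?thesis .
qed

lemma ddheat_le:
  assumes t: "0 < t" and i: "i \<in> Basis" and j: "j \<in> Basis"
  shows "\<bar>ddheat i j t y\<bar> \<le> 3 / t * 2 powr (real DIM('a) / 2) * heat (2 * t) (y :: 'a::euclidean_space)"
proof -
  have ij: "\<bar>i \<bullet> j\<bar> \<le> 1" using i j by (simp add: inner_Basis)
  have "\<bar>(y \<bullet> i) * (y \<bullet> j)\<bar> \<le> norm y * norm y"
    unfolding abs_mult using i j by (intro mult_mono) (auto simp: Basis_le_norm)
  then have "\<bar>(y \<bullet> i) * (y \<bullet> j) / (4 * t\<^sup>2) - (i \<bullet> j) / (2 * t)\<bar> \<le> (norm y)\<^sup>2 / (4 * t\<^sup>2) + 1 / (2 * t)"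
    using t ij by (intro order.trans[OF abs_triangle_ineq4] add_mono)
      (auto simp: abs_mult power2_eq_square divide_right_mono)
  then have "\<bar>ddheat i j t y\<bar> \<le> ((norm y)\<^sup>2 / (4 * t\<^sup>2) + 1 / (2 * t)) * heat t y"
    unfolding ddheat_def abs_mult using heat_nonneg[of t y] by (intro mult_mono) auto
  also have "\<dots> = (norm y)\<^sup>2 * heat t y / (4 * t\<^sup>2) + heat t y / (2 * t)"
    by (simp add: distrib_right)
  also have "\<dots> \<le> 8 * t * 2 powr (real DIM('a) / 2) * heat (2 * t) y / (4 * t\<^sup>2)
      + (2 * t / t) powr (real DIM('a) / 2) * heat (2 * t) y / (2 * t)"
    using t norm_power2_heat_le[OF t, of y] heat_mono_scale[OF t, of "2 * t" y]
    by (intro add_mono divide_right_mono) auto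
  also have "\<dots> = 5 / 2 / t * 2 powr (real DIM('a) / 2) * heat (2 * t) y"
    using t by (simp add: power2_eq_square field_simps)
  also have "\<dots> \<le> 3 / t * 2 powr (real DIM('a) / 2) * heat (2 * t) y"
    using t by (intro mult_right_mono divide_right_mono) auto
  finally show ?thesis .
qed

section \<open>Integration by parts against Lipschitz functions\<close>

text \<open>The time is existential so that each estimate may enlarge it. Centring at the origin
  loses nothing by \<open>heat_shift_le\<close>, and the class is closed under the sums and products
  from which the stress tensor is built.\<close>

definition gaussian_decay :: "('a::euclidean_space \<Rightarrow> real) \<Rightarrow> bool" where
  "gaussian_decay F \<longleftrightarrow> (\<exists>C t. 0 \<le> C \<and> 0 < t \<and> (\<forall>z. \<bar>F z\<bar> \<le> C * heat t z))"

lemma gaussian_decayI: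
  fixes x :: "'a::euclidean_space"
  assumes "0 \<le> C" "0 < t" and le: "\<And>z. \<bar>F z\<bar> \<le> C * heat t (z - x)"
  shows "gaussian_decay F"
  unfolding gaussian_decay_def
proof (intro exI conjI allI)
  let ?K = "2 powr (real DIM('a) / 2) * exp ((norm x)\<^sup>2 / (4 * t))"
  show "\<bar>F z\<bar> \<le> C * ?K * heat (2 * t) z" for z
    using le[of z] mult_left_mono[OF heat_shift_le[OF \<open>0 < t\<close>, of z x] \<open>0 \<le> C\<close>] by (simp add: mult_ac)
qed (use assms in auto)

lemma gaussian_decay_add:
  assumes "gaussian_decay F" "gaussian_decay G"
  shows "gaussian_decay (\<lambda>z. F z + G z :: real)"
proof -
  obtain C t where C: "0 \<le> C" "0 < t" "\<And>z. \<bar>F z\<bar> \<le> C * heat t z"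
    using assms(1) by (auto simp: gaussian_decay_def)
  obtain D r where D: "0 \<le> D" "0 < r" "\<And>z. \<bar>G z\<bar> \<le> D * heat r z"
    using assms(2) by (auto simp: gaussian_decay_def)
  define T where "T = max t r"
  have T: "t \<le> T" "r \<le> T" "0 < T" using C(2) by (auto simp: T_def)
  let ?d = "real DIM('a) / 2"
  have "\<bar>F z + G z\<bar> \<le> (C * (T / t) powr ?d + D * (T / r) powr ?d) * heat T (z - 0)" for z
    using C(3)[of z] D(3)[of z] mult_left_mono[OF heat_mono_scale[OF C(2) T(1), of z] C(1)]
      mult_left_mono[OF heat_mono_scale[OF D(2) T(2), of z] D(1)]
    by (simp add: algebra_simps)
  then show ?thesis
    by (rule gaussian_decayI[rotated 2]) (use C D T in auto)
qed

lemma gaussian_decay_mult_bounded: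
  assumes "gaussian_decay F" "\<And>z. \<bar>G z\<bar> \<le> B"
  shows "gaussian_decay (\<lambda>z. G z * F z :: real)" "gaussian_decay (\<lambda>z. F z * G z)"
proof -
  obtain C t where C: "0 \<le> C" "0 < t" "\<And>z. \<bar>F z\<bar> \<le> C * heat t z"
    using assms(1) by (auto simp: gaussian_decay_def)
  have B: "0 \<le> B" using assms(2)[of undefined] by simp
  have "\<bar>G z * F z\<bar> \<le> (B * C) * heat t (z - 0)" for z
    using mult_mono[OF assms(2)[of z] C(3)[of z]] B by (simp add: abs_mult mult_ac)
  then show "gaussian_decay (\<lambda>z. G z * F z)"
    by (rule gaussian_decayI[rotated 2]) (use B C in auto)
  then show "gaussian_decay (\<lambda>z. F z * G z)" by (simp add: mult.commute)
qed

lemma gaussian_decay_bounded: "gaussian_decay F \<Longrightarrow> \<exists>B. \<forall>z. \<bar>F z\<bar> \<le> B"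
  unfolding gaussian_decay_def by (meson heat_le_zero mult_left_mono order_trans)

lemma gaussian_decay_mult:
  assumes "gaussian_decay F" "gaussian_decay G"
  shows "gaussian_decay (\<lambda>z. F z * G z :: real)"
  using gaussian_decay_bounded[OF assms(1)] gaussian_decay_mult_bounded(1)[OF assms(2)] by blast

lemma gaussian_decay_cmult: "gaussian_decay F \<Longrightarrow> gaussian_decay (\<lambda>z. c * F z :: real)"
  using gaussian_decay_mult_bounded(1)[of F "\<lambda>_. c" "\<bar>c\<bar>"] by simp

lemma gaussian_decay_zero: "gaussian_decay (\<lambda>z. 0)"
  by (auto simp: gaussian_decay_def intro!: exI[of _ 0] exI[of _ 1])

lemma gaussian_decay_heat: "0 < t \<Longrightarrow> gaussian_decay (\<lambda>z. heat t (z - x))"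
  by (rule gaussian_decayI[of 1 t _ x]) auto

lemma gaussian_decay_dheat:
  assumes "0 < t" "i \<in> Basis" shows "gaussian_decay (\<lambda>z. dheat i t (z - x))"
  by (rule gaussian_decayI[OF _ _ dheat_le]) (use assms in auto)

lemma gaussian_decay_ddheat:
  assumes "0 < t" "i \<in> Basis" "j \<in> Basis" shows "gaussian_decay (\<lambda>z. ddheat i j t (z - x))"
  by (rule gaussian_decayI[OF _ _ ddheat_le]) (use assms in auto)

text \<open>A Lipschitz function grows at most linearly, and Gaussians have finite first
  moment.\<close>

lemma integrable_lipschitz_mult_gaussian_decay:
  fixes v F :: "'a::euclidean_space \<Rightarrow> real"
  assumes v: "K-lipschitz_on UNIV v" and F: "gaussian_decay F" and [measurable]: "F \<in> borel_measurable borel"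
  shows "integrable lborel (\<lambda>z. v z * F z)"
proof -
  obtain C t where C: "0 \<le> C" "0 < t" "\<And>z. \<bar>F z\<bar> \<le> C * heat t z"
    using F by (auto simp: gaussian_decay_def)
  have K: "K \<ge> 0" using v by (rule lipschitz_on_nonneg)
  have [measurable]: "v \<in> borel_measurable borel"
    using lipschitz_on_continuous_on[OF v] by (rule borel_measurable_continuous_onI)
  show ?thesis
  proof (rule Bochner_Integration.integrable_bound)
    show "integrable lborel (\<lambda>z. \<bar>v 0\<bar> * C * heat t (z - 0) + K * C * (norm (z - 0) * heat t (z - 0)))"
      using C(2) by (intro Bochner_Integration.integrable_add integrable_mult_right integrable_heat integrable_norm_heat)
    have "\<bar>v z\<bar> \<le> \<bar>v 0\<bar> + K * norm z" for z
      using lipschitz_onD[OF v, of z 0] by (auto simp: dist_norm)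
    then have "\<bar>v z * F z\<bar> \<le> (\<bar>v 0\<bar> + K * norm z) * (C * heat t z)" for z
      unfolding abs_mult using C(1) K by (intro mult_mono C(3)) auto
    then show "AE z in lborel. norm (v z * F z) \<le> norm (\<bar>v 0\<bar> * C * heat t (z - 0) + K * C * (norm (z - 0) * heat t (z - 0)))"
      by (intro AE_I2) (simp add: algebra_simps order.trans[OF _ abs_ge_self])
  qed measurable
qed

lemma integrable_gaussian_decay:
  fixes F :: "'a::euclidean_space \<Rightarrow> real"
  assumes "gaussian_decay F" "F \<in> borel_measurable borel"
  shows "integrable lborel F"
  using integrable_lipschitz_mult_gaussian_decay[of 0 "\<lambda>_. 1" F] assms by (simp add: lipschitz_on_def)

text \<open>Differentiability along the single direction \<open>e\<close>, with decay of both
  function and derivative, is what integration by parts against a function of linear growth uses. As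
  a relation it can be assembled by sum and product rules.\<close>

definition decaying_deriv :: "'a::euclidean_space \<Rightarrow> ('a \<Rightarrow> real) \<Rightarrow> ('a \<Rightarrow> real) \<Rightarrow> bool" where
  "decaying_deriv e F F' \<longleftrightarrow> F \<in> borel_measurable borel \<and> F' \<in> borel_measurable borel
     \<and> gaussian_decay F \<and> gaussian_decay F'
     \<and> (\<forall>z. ((\<lambda>\<tau>. F (z + \<tau> *\<^sub>R e)) has_real_derivative F' z) (at 0))"

lemma decaying_deriv_add:
  "decaying_deriv e F F' \<Longrightarrow> decaying_deriv e G G' \<Longrightarrow> decaying_deriv e (\<lambda>z. F z + G z) (\<lambda>z. F' z + G' z)"
  unfolding decaying_deriv_def by (auto intro!: gaussian_decay_add derivative_intros)

lemma decaying_deriv_cmult: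
  "decaying_deriv e F F' \<Longrightarrow> decaying_deriv e (\<lambda>z. c * F z) (\<lambda>z. c * F' z)"
  unfolding decaying_deriv_def by (auto intro!: gaussian_decay_cmult DERIV_cmult)

lemma decaying_deriv_zero: "decaying_deriv e (\<lambda>z. 0) (\<lambda>z. 0)"
  unfolding decaying_deriv_def by (auto simp: gaussian_decay_zero)

lemma decaying_deriv_sum:
  "finite I \<Longrightarrow> (\<And>k. k \<in> I \<Longrightarrow> decaying_deriv e (F k) (F' k))
    \<Longrightarrow> decaying_deriv e (\<lambda>z. \<Sum>k\<in>I. F k z) (\<lambda>z. \<Sum>k\<in>I. F' k z)"
  by (induction I rule: finite_induct) (auto simp: decaying_deriv_zero intro!: decaying_deriv_add)

lemma decaying_deriv_mult:
  assumes "decaying_deriv e F F'" "decaying_deriv e G G'"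
  shows "decaying_deriv e (\<lambda>z. F z * G z) (\<lambda>z. F' z * G z + F z * G' z)"
proof -
  have "((\<lambda>\<tau>. F (z + \<tau> *\<^sub>R e) * G (z + \<tau> *\<^sub>R e)) has_real_derivative F' z * G z + F z * G' z) (at 0)" for z
  proof -
    have "((\<lambda>\<tau>. F (z + \<tau> *\<^sub>R e)) has_real_derivative F' z) (at 0)"
      "((\<lambda>\<tau>. G (z + \<tau> *\<^sub>R e)) has_real_derivative G' z) (at 0)"
      using assms by (auto simp: decaying_deriv_def)
    from DERIV_mult[OF this] show ?thesis by (simp add: algebra_simps)
  qed
  then show ?thesis
    using assms unfolding decaying_deriv_def by (auto intro!: gaussian_decay_mult gaussian_decay_add)
qed

lemma has_derivative_heat_line:
  assumes t: "0 < t"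
  shows "((\<lambda>\<tau>. heat t (z + \<tau> *\<^sub>R e - x)) has_real_derivative dheat e t (z - x)) (at 0)"
proof -
  have eq: "heat t (z + \<tau> *\<^sub>R e - x) = (4 * pi * t) powr (- real DIM('a) / 2)
      * exp (- (((z - x) \<bullet> (z - x)) + 2 * \<tau> * ((z - x) \<bullet> e) + \<tau>\<^sup>2 * (e \<bullet> e)) / (4 * t))" for \<tau> and z x e :: 'a
  proof -
    have "(norm (z + \<tau> *\<^sub>R e - x))\<^sup>2 = ((z - x) \<bullet> (z - x)) + 2 * \<tau> * ((z - x) \<bullet> e) + \<tau>\<^sup>2 * (e \<bullet> e)"
      unfolding power2_norm_eq_inner by (simp add: power2_eq_square inner_commute algebra_simps)
    then show ?thesis by (simp add: heat_def)
  qed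
  define A where "A = (z - x) \<bullet> (z - x)"
  define B where "B = (z - x) \<bullet> e"
  have "((\<lambda>\<tau>. (4 * pi * t) powr (- real DIM('a) / 2) * exp (- (A + 2 * \<tau> * B + \<tau>\<^sup>2 * (e \<bullet> e)) / (4 * t)))
     has_real_derivative - B / (2 * t) * ((4 * pi * t) powr (- real DIM('a) / 2) * exp (- A / (4 * t)))) (at 0)"
    using t by (auto intro!: derivative_eq_intros)
  then show ?thesis
    by (simp only: eq dheat_def heat_def[of t "z - x"] power2_norm_eq_inner[of "z - x"] A_def[symmetric] B_def[symmetric])
qed

lemma has_derivative_dheat_line:
  assumes t: "0 < t"
  shows "((\<lambda>\<tau>. dheat i t (z + \<tau> *\<^sub>R e - x)) has_real_derivative ddheat i e t (z - x)) (at 0)"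
proof -
  have eq: "dheat i t (z + \<tau> *\<^sub>R e - x)
      = (- ((z - x) \<bullet> i) / (2 * t) - \<tau> * ((e \<bullet> i) / (2 * t))) * heat t (z + \<tau> *\<^sub>R e - x)" for \<tau>
    using t by (simp add: dheat_def inner_add_left inner_diff_left add_divide_distrib diff_divide_distrib algebra_simps)
  have "((\<lambda>\<tau>. (- ((z - x) \<bullet> i) / (2 * t) - \<tau> * ((e \<bullet> i) / (2 * t)))) has_real_derivative - ((e \<bullet> i) / (2 * t))) (at 0)"
    using t by (auto intro!: derivative_eq_intros)
  from DERIV_mult[OF this has_derivative_heat_line[OF t, of z e x]]
  show ?thesis
    unfolding eq using t
    by (simp add: ddheat_def dheat_def inner_commute[of i e] field_simps power2_eq_square)
qed

lemma decaying_deriv_heat: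
  "0 < t \<Longrightarrow> e \<in> Basis \<Longrightarrow> decaying_deriv e (\<lambda>z. heat t (z - x)) (\<lambda>z. dheat e t (z - x))"
  unfolding decaying_deriv_def
  by (auto intro: gaussian_decay_heat gaussian_decay_dheat has_derivative_heat_line)

lemma decaying_deriv_dheat:
  "0 < t \<Longrightarrow> e \<in> Basis \<Longrightarrow> i \<in> Basis \<Longrightarrow> decaying_deriv e (\<lambda>z. dheat i t (z - x)) (\<lambda>z. ddheat i e t (z - x))"
  unfolding decaying_deriv_def
  by (auto intro: gaussian_decay_ddheat gaussian_decay_dheat has_derivative_dheat_line)

text \<open>Moving the difference quotient onto the Lipschitz factor avoids Rademacher's theorem: the quotients are
  bounded by the Lipschitz constant, although they need not converge.\<close>

lemma integration_by_parts_difference_quotient: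
  fixes v F F' :: "'a::euclidean_space \<Rightarrow> real" and h :: "nat \<Rightarrow> real"
  assumes v: "K-lipschitz_on UNIV v" and F: "decaying_deriv e F F'" and e: "norm e = 1"
    and h: "h \<longlonglongrightarrow> 0" "\<And>n. h n \<noteq> 0" "\<And>n. \<bar>h n\<bar> \<le> 1"
  shows "(\<lambda>n. \<integral>z. (v (z - h n *\<^sub>R e) - v z) / h n * F z \<partial>lborel) \<longlonglongrightarrow> (\<integral>z. v z * F' z \<partial>lborel)"
proof -
  have [measurable]: "F \<in> borel_measurable borel" "F' \<in> borel_measurable borel"
    and dF: "gaussian_decay F" and dF': "gaussian_decay F'"
    and der0: "\<And>z. ((\<lambda>\<tau>. F (z + \<tau> *\<^sub>R e)) has_real_derivative F' z) (at 0)"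
    using F by (auto simp: decaying_deriv_def)
  have [measurable]: "v \<in> borel_measurable borel"
    using lipschitz_on_continuous_on[OF v] by (rule borel_measurable_continuous_onI)
  have K: "K \<ge> 0" using v by (rule lipschitz_on_nonneg)
  obtain C t where C: "0 \<le> C" "0 < t" "\<And>z. \<bar>F' z\<bar> \<le> C * heat t z"
    using dF' by (auto simp: gaussian_decay_def)
  have der: "((\<lambda>\<tau>. F (z + \<tau> *\<^sub>R e)) has_real_derivative F' (z + \<tau> *\<^sub>R e)) (at \<tau>)" for z \<tau>
  proof -
    have "((\<lambda>\<sigma>. F ((z + \<tau> *\<^sub>R e) + \<sigma> *\<^sub>R e)) has_real_derivative F' (z + \<tau> *\<^sub>R e)) (at 0)" by (rule der0)
    then have "((\<lambda>\<sigma>. F (z + (\<sigma> + \<tau>) *\<^sub>R e)) has_real_derivative F' (z + \<tau> *\<^sub>R e)) (at 0)"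
      by (simp add: algebra_simps)
    then show ?thesis using DERIV_shift[of "\<lambda>\<sigma>. F (z + \<sigma> *\<^sub>R e)" "F' (z + \<tau> *\<^sub>R e)" 0 \<tau>] by (simp add: add.commute)
  qed
  \<comment> \<open>Recentring constant for a shift of norm at most 1. It dominates
    \<open>F'\<close> on the whole segment reached by the mean value theorem, since the steps
    satisfy \<open>\<bar>h n\<bar> \<le> 1\<close>.\<close>
  define D where "D = C * (2 powr (real DIM('a) / 2) * exp (1 / (4 * t)))"
  have F'_near: "\<bar>F' (z + \<tau> *\<^sub>R e)\<bar> \<le> D * heat (2 * t) z" if "\<bar>\<tau>\<bar> \<le> 1" for z \<tau>
  proof -
    have "heat t (z - (- \<tau>) *\<^sub>R e) \<le> 2 powr (real DIM('a) / 2) * exp ((norm ((- \<tau>) *\<^sub>R e))\<^sup>2 / (4 * t)) * heat (2 * t) z"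
      by (rule heat_shift_le[OF C(2)])
    also have "\<dots> \<le> 2 powr (real DIM('a) / 2) * exp (1 / (4 * t)) * heat (2 * t) z"
      using e that C(2) by (intro mult_right_mono mult_left_mono) (auto simp: divide_right_mono abs_square_le_1)
    finally show ?thesis
      using C(3)[of "z + \<tau> *\<^sub>R e"] mult_left_mono[OF _ C(1)] unfolding D_def by (fastforce simp: mult_ac)
  qed
  have quot: "\<bar>(F (z + h n *\<^sub>R e) - F z) / h n\<bar> \<le> D * heat (2 * t) z" for z n
  proof -
    let ?\<phi> = "\<lambda>\<tau>. F (z + \<tau> *\<^sub>R e)"
    have "\<exists>\<xi>. \<bar>\<xi>\<bar> \<le> 1 \<and> (?\<phi> (h n) - ?\<phi> 0) / h n = F' (z + \<xi> *\<^sub>R e)"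
    proof (cases "h n > 0")
      case True
      from MVT2[OF True, of ?\<phi> "\<lambda>\<tau>. F' (z + \<tau> *\<^sub>R e)"] der
      obtain \<xi> where "0 < \<xi>" "\<xi> < h n" "?\<phi> (h n) - ?\<phi> 0 = (h n - 0) * F' (z + \<xi> *\<^sub>R e)" by blast
      then show ?thesis using h(3)[of n] True by (intro exI[of _ \<xi>]) auto
    next
      case False
      then have neg: "h n < 0" using h(2)[of n] by linarith
      from MVT2[OF neg, of ?\<phi> "\<lambda>\<tau>. F' (z + \<tau> *\<^sub>R e)"] der
      obtain \<xi> where "h n < \<xi>" "\<xi> < 0" "?\<phi> 0 - ?\<phi> (h n) = (0 - h n) * F' (z + \<xi> *\<^sub>R e)" by blast
      then show ?thesis using h(3)[of n] neg by (intro exI[of _ \<xi>]) (auto simp: field_simps)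
    qed
    then obtain \<xi> where "\<bar>\<xi>\<bar> \<le> 1" "(?\<phi> (h n) - ?\<phi> 0) / h n = F' (z + \<xi> *\<^sub>R e)" by blast
    then show ?thesis using F'_near[of \<xi> z] by simp
  qed
  have int_vF: "integrable lborel (\<lambda>z. v z * F z)"
    by (rule integrable_lipschitz_mult_gaussian_decay[OF v dF]) measurable
  have shift: "integrable lborel (\<lambda>z. f (z + w)) \<and> (\<integral>z. f (z + w) \<partial>lborel) = (\<integral>z. f z \<partial>lborel)"
    if "integrable lborel f" for f :: "'a \<Rightarrow> real" and w
  proof -
    have [measurable]: "f \<in> borel_measurable borel" using that by simp
    have eq: "distr lborel borel (\<lambda>z. z + w) = lborel"
      using lborel_distr_minus[of "- w"] by simp
    have "integrable (distr lborel borel (\<lambda>z. z + w)) f" using that by (simp add: eq)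
    then have "integrable lborel (\<lambda>z. f (z + w))" by (subst (asm) integrable_distr_eq) auto
    moreover have "(\<integral>z. f z \<partial>distr lborel borel (\<lambda>z. z + w)) = (\<integral>z. f (z + w) \<partial>lborel)"
      by (rule integral_distr) measurable
    ultimately show ?thesis by (simp add: eq)
  qed
  have lim: "(\<lambda>n. \<integral>z. v z * ((F (z + h n *\<^sub>R e) - F z) / h n) \<partial>lborel) \<longlonglongrightarrow> (\<integral>z. v z * F' z \<partial>lborel)"
  proof (rule integral_dominated_convergence)
    show "integrable lborel (\<lambda>z. \<bar>v z * (D * heat (2 * t) z)\<bar>)"
    proof (intro integrable_abs integrable_lipschitz_mult_gaussian_decay[OF v])
      have "D \<ge> 0" using C by (simp add: D_def)
      then show "gaussian_decay (\<lambda>z. D * heat (2 * t) z)"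
        by (intro gaussian_decayI[of D "2 * t" _ 0]) (use C in auto)
    qed measurable
    show "AE z in lborel. (\<lambda>n. v z * ((F (z + h n *\<^sub>R e) - F z) / h n)) \<longlonglongrightarrow> v z * F' z"
    proof (intro AE_I2 tendsto_mult tendsto_const)
      fix z
      have "((\<lambda>\<tau>. (F (z + \<tau> *\<^sub>R e) - F z) / \<tau>) \<longlongrightarrow> F' z) (at 0)"
        using der0[of z] by (simp add: DERIV_def)
      moreover have "filterlim h (at 0) sequentially"
        using h by (auto simp: filterlim_at)
      ultimately show "(\<lambda>n. (F (z + h n *\<^sub>R e) - F z) / h n) \<longlonglongrightarrow> F' z"
        by (rule filterlim_compose)
    qed
    show "AE z in lborel. norm (v z * ((F (z + h n *\<^sub>R e) - F z) / h n)) \<le> \<bar>v z * (D * heat (2 * t) z)\<bar>" for n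
    proof (intro AE_I2)
      fix z
      have "\<bar>v z\<bar> * \<bar>(F (z + h n *\<^sub>R e) - F z) / h n\<bar> \<le> \<bar>v z\<bar> * \<bar>D * heat (2 * t) z\<bar>"
        using quot[of z n] by (intro mult_left_mono) auto
      then show "norm (v z * ((F (z + h n *\<^sub>R e) - F z) / h n)) \<le> \<bar>v z * (D * heat (2 * t) z)\<bar>"
        by (simp only: real_norm_def abs_mult)
    qed
  qed measurable
  have eq: "(\<integral>z. v z * ((F (z + h n *\<^sub>R e) - F z) / h n) \<partial>lborel)
      = (\<integral>z. (v (z - h n *\<^sub>R e) - v z) / h n * F z \<partial>lborel)" for n
  proof -
    let ?w = "h n *\<^sub>R e"
    have "K-lipschitz_on UNIV (\<lambda>z. v (z - ?w))"
      using v by (auto simp: lipschitz_on_def dist_norm) (metis diff_diff_eq2 diff_add_cancel)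
    then have i1: "integrable lborel (\<lambda>z. v (z - ?w) * F z)"
      by (rule integrable_lipschitz_mult_gaussian_decay[OF _ dF]) measurable
    from shift[OF i1, of ?w]
    have i2: "integrable lborel (\<lambda>z. v z * F (z + ?w))"
      and e2: "(\<integral>z. v z * F (z + ?w) \<partial>lborel) = (\<integral>z. v (z - ?w) * F z \<partial>lborel)" by simp_all
    have "(\<integral>z. v z * ((F (z + ?w) - F z) / h n) \<partial>lborel)
        = ((\<integral>z. v z * F (z + ?w) \<partial>lborel) - (\<integral>z. v z * F z \<partial>lborel)) / h n"
      using i2 int_vF by (simp add: right_diff_distrib flip: Bochner_Integration.integral_diff)
    also have "\<dots> = (\<integral>z. (v (z - ?w) - v z) / h n * F z \<partial>lborel)"
      unfolding e2 using i1 int_vF by (simp add: left_diff_distrib flip: Bochner_Integration.integral_diff)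
    finally show ?thesis .
  qed
  show ?thesis using lim unfolding eq .
qed

text \<open>Integration by parts against the constant 1, whose difference quotients are all
  zero.\<close>

lemma integral_decaying_deriv:
  fixes F F' :: "'a::euclidean_space \<Rightarrow> real"
  assumes "decaying_deriv e F F'" "norm e = 1"
  shows "(\<integral>z. F' z \<partial>lborel) = 0"
proof -
  have "(\<lambda>n. \<integral>z. ((\<lambda>_. 1) (z - (1 / Suc n) *\<^sub>R e) - (\<lambda>_. 1 :: real) z) / (1 / Suc n) * F z \<partial>lborel)
      \<longlonglongrightarrow> (\<integral>z. (\<lambda>_. 1) z * F' z \<partial>lborel)"
    by (rule integration_by_parts_difference_quotient[OF _ assms, of 0])
      (use LIMSEQ_inverse_real_of_nat in \<open>auto simp: lipschitz_on_def inverse_eq_divide add.commute\<close>)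
  then show ?thesis by (simp add: LIMSEQ_const_iff)
qed

section \<open>Fubini for products of kernels\<close>

text \<open>A family of functions of a space variable, indexed by the points of \<open>Q\<close>.
  The bound is uniform over all indices, so finiteness of \<open>Q\<close> gives integrability in
  the index.\<close>

definition bounded_kernel :: "'w measure \<Rightarrow> ('w \<Rightarrow> 'a::euclidean_space \<Rightarrow> real) \<Rightarrow> bool" where
  "bounded_kernel Q g \<longleftrightarrow> (\<lambda>p. g (fst p) (snd p)) \<in> borel_measurable (Q \<Otimes>\<^sub>M borel)
     \<and> (\<forall>\<omega>. g \<omega> \<in> borel_measurable borel) \<and> (\<exists>B. \<forall>\<omega> z. \<bar>g \<omega> z\<bar> \<le> B)"

text \<open>In a product of two kernels one factor must be integrable in space, uniformly in the
  index, while the other need only be bounded. The distinction matters for \<open>kUB\<close>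
  below.\<close>

definition L1_kernel :: "'w measure \<Rightarrow> ('w \<Rightarrow> 'a::euclidean_space \<Rightarrow> real) \<Rightarrow> bool" where
  "L1_kernel Q g \<longleftrightarrow> bounded_kernel Q g \<and> (\<exists>B. \<forall>\<omega>. (\<integral>\<^sup>+z. ennreal \<bar>g \<omega> z\<bar> \<partial>lborel) \<le> ennreal B)"

text \<open>One Gaussian majorant yields both bounds: the supremum through the value of the heat
  kernel at the origin at the earliest time \<open>s\<close>, and the mass because every heat kernel
  has integral one.\<close>

lemma L1_kernel_heatI:
  fixes g :: "'w \<Rightarrow> 'a::euclidean_space \<Rightarrow> real"
  assumes meas: "(\<lambda>p. g (fst p) (snd p)) \<in> borel_measurable (Q \<Otimes>\<^sub>M borel)"
    and meas': "\<And>\<omega>. g \<omega> \<in> borel_measurable borel"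
    and s: "0 < s" and r: "\<And>\<omega>. s \<le> r \<omega>"
    and le: "\<And>\<omega> z. \<bar>g \<omega> z\<bar> \<le> c * heat (r \<omega>) (z - x \<omega>)"
  shows "L1_kernel Q g"
proof -
  have c: "c \<ge> 0"
  proof -
    fix \<omega> z
    have "0 \<le> c * heat (r \<omega>) (z - x \<omega>)" using le[of \<omega> z] by linarith
    moreover have "heat (r \<omega>) (z - x \<omega>) > 0" using s r[of \<omega>] by (intro heat_pos) simp
    ultimately show ?thesis by (simp add: zero_le_mult_iff)
  qed
  have "\<bar>g \<omega> z\<bar> \<le> c * heat s (0::'a)" for \<omega> z
    using order.trans[OF le mult_left_mono[OF heat_le_heat_zero[OF s r] c]] .
  moreover have "(\<integral>\<^sup>+z. ennreal \<bar>g \<omega> z\<bar> \<partial>lborel) \<le> ennreal c" for \<omega>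
  proof -
    have "(\<integral>\<^sup>+z. ennreal \<bar>g \<omega> z\<bar> \<partial>lborel) \<le> (\<integral>\<^sup>+z. ennreal c * ennreal (heat (r \<omega>) (z - x \<omega>)) \<partial>lborel)"
      using le c by (intro nn_integral_mono) (simp flip: ennreal_mult)
    also have "\<dots> = ennreal c"
      using s r[of \<omega>] by (subst nn_integral_cmult) (auto simp: nn_integral_heat)
    finally show ?thesis .
  qed
  ultimately show ?thesis using meas meas' unfolding L1_kernel_def bounded_kernel_def by blast
qed

context
  fixes Q1 :: "'w measure" and Q2 :: "'v measure" and \<alpha> :: "'w \<Rightarrow> 'a::euclidean_space \<Rightarrow> real"
    and \<beta> :: "'v \<Rightarrow> 'a \<Rightarrow> real"
  assumes fin: "finite_measure Q1" "finite_measure Q2"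
    and \<alpha>: "L1_kernel Q1 \<alpha>" and \<beta>: "bounded_kernel Q2 \<beta>"
begin

lemma kernel_pair_bound:
  "\<exists>C\<ge>0. \<forall>(v :: 'a \<Rightarrow> real) V p. v \<in> borel_measurable borel \<longrightarrow> (\<forall>z. \<bar>v z\<bar> \<le> V) \<longrightarrow>
     (\<integral>\<^sup>+z. ennreal \<bar>v z * (\<alpha> (fst p) z * \<beta> (snd p) z)\<bar> \<partial>lborel) \<le> ennreal (V * C)"
proof -
  obtain A' where A': "\<And>\<omega>. (\<integral>\<^sup>+z. ennreal \<bar>\<alpha> \<omega> z\<bar> \<partial>lborel) \<le> ennreal A'"
    using \<alpha> by (auto simp: L1_kernel_def)
  define A where "A = max 0 A'"
  have A: "(\<integral>\<^sup>+z. ennreal \<bar>\<alpha> \<omega> z\<bar> \<partial>lborel) \<le> ennreal A" for \<omega>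
    using order.trans[OF A'] by (simp add: A_def ennreal_leI)
  have A0: "A \<ge> 0" by (simp add: A_def)
  obtain B where B: "\<And>\<omega> z. \<bar>\<beta> \<omega> z\<bar> \<le> B" using \<beta> by (auto simp: bounded_kernel_def)
  have B0: "B \<ge> 0" using B[of undefined undefined] by linarith
  show ?thesis
  proof (intro exI[of _ "B * A"] conjI allI impI)
    fix v :: "'a \<Rightarrow> real" and V :: real and p :: "'w \<times> 'v"
    assume v: "v \<in> borel_measurable borel" "\<forall>z. \<bar>v z\<bar> \<le> V"
    have V: "V \<ge> 0" using v(2)[rule_format, of 0] by linarith
    have "(\<integral>\<^sup>+z. ennreal \<bar>v z * (\<alpha> (fst p) z * \<beta> (snd p) z)\<bar> \<partial>lborel)
        \<le> (\<integral>\<^sup>+z. ennreal (V * B) * ennreal \<bar>\<alpha> (fst p) z\<bar> \<partial>lborel)"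
    proof (rule nn_integral_mono)
      fix z
      have "\<bar>v z\<bar> * (\<bar>\<alpha> (fst p) z\<bar> * \<bar>\<beta> (snd p) z\<bar>) \<le> V * (\<bar>\<alpha> (fst p) z\<bar> * B)"
        using v(2) B V by (intro mult_mono) auto
      then show "ennreal \<bar>v z * (\<alpha> (fst p) z * \<beta> (snd p) z)\<bar> \<le> ennreal (V * B) * ennreal \<bar>\<alpha> (fst p) z\<bar>"
        using V B0 by (simp add: abs_mult ennreal_leI mult_ac flip: ennreal_mult)
    qed
    also have "\<dots> = ennreal (V * B) * (\<integral>\<^sup>+z. ennreal \<bar>\<alpha> (fst p) z\<bar> \<partial>lborel)"
    proof (rule nn_integral_cmult)
      have [measurable]: "\<alpha> (fst p) \<in> borel_measurable borel"
        using \<alpha> by (auto simp: L1_kernel_def bounded_kernel_def)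
      show "(\<lambda>z. ennreal \<bar>\<alpha> (fst p) z\<bar>) \<in> borel_measurable lborel" by measurable
    qed
    also have "\<dots> \<le> ennreal (V * B) * ennreal A"
      by (intro mult_left_mono A) auto
    finally show "(\<integral>\<^sup>+z. ennreal \<bar>v z * (\<alpha> (fst p) z * \<beta> (snd p) z)\<bar> \<partial>lborel) \<le> ennreal (V * (B * A))"
      using V B0 A0 by (simp add: mult.assoc flip: ennreal_mult)
  qed (use B0 A0 in auto)
qed

text \<open>Turns the integral of a product of two superpositions into an average, over pairs of
  indices, of integrals of products of single kernels. There the explicit Gaussian formulas and the
  integration by parts are available.\<close>

lemma kernel_pair_Fubini:
  assumes v: "v \<in> borel_measurable borel" "\<And>z. \<bar>v z\<bar> \<le> V"
  shows "integrable lborel (\<lambda>z. v z * ((\<integral>\<omega>. \<alpha> \<omega> z \<partial>Q1) * (\<integral>\<omega>. \<beta> \<omega> z \<partial>Q2)))"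
    and "has_bochner_integral (Q1 \<Otimes>\<^sub>M Q2) (\<lambda>p. \<integral>z. v z * (\<alpha> (fst p) z * \<beta> (snd p) z) \<partial>lborel)
           (\<integral>z. v z * ((\<integral>\<omega>. \<alpha> \<omega> z \<partial>Q1) * (\<integral>\<omega>. \<beta> \<omega> z \<partial>Q2)) \<partial>lborel)"
proof -
  interpret Q1: finite_measure Q1 by (rule fin)
  interpret Q2: finite_measure Q2 by (rule fin)
  interpret P: pair_sigma_finite Q1 Q2 ..
  interpret Q12: finite_measure "Q1 \<Otimes>\<^sub>M Q2" by (rule finite_measure_pair_measure[OF fin(2) fin(1)])
  interpret T: pair_sigma_finite "Q1 \<Otimes>\<^sub>M Q2" "lborel :: 'a measure" ..
  note [measurable] = v(1)
  have [measurable]: "(\<lambda>p. \<alpha> (fst p) (snd p)) \<in> borel_measurable (Q1 \<Otimes>\<^sub>M borel)"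
    using \<alpha> by (auto simp: L1_kernel_def bounded_kernel_def)
  have [measurable]: "(\<lambda>p. \<beta> (fst p) (snd p)) \<in> borel_measurable (Q2 \<Otimes>\<^sub>M borel)"
    using \<beta> by (auto simp: bounded_kernel_def)
  have ma: "(\<lambda>q. \<alpha> (fst (fst q)) (snd q)) \<in> borel_measurable ((Q1 \<Otimes>\<^sub>M Q2) \<Otimes>\<^sub>M borel)"
    using measurable_compose[of "\<lambda>q. (fst (fst q), snd q)" "(Q1 \<Otimes>\<^sub>M Q2) \<Otimes>\<^sub>M borel" "Q1 \<Otimes>\<^sub>M borel" "\<lambda>p. \<alpha> (fst p) (snd p)"]
    by simp
  have mb: "(\<lambda>q. \<beta> (snd (fst q)) (snd q)) \<in> borel_measurable ((Q1 \<Otimes>\<^sub>M Q2) \<Otimes>\<^sub>M borel)"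
    using measurable_compose[of "\<lambda>q. (snd (fst q), snd q)" "(Q1 \<Otimes>\<^sub>M Q2) \<Otimes>\<^sub>M borel" "Q2 \<Otimes>\<^sub>M borel" "\<lambda>p. \<beta> (fst p) (snd p)"]
    by simp
  note [measurable] = ma mb
  define f where "f = (\<lambda>p z. v z * (\<alpha> (fst p) z * \<beta> (snd p) z))"
  have fm: "(\<lambda>(p, z). f p z) \<in> borel_measurable ((Q1 \<Otimes>\<^sub>M Q2) \<Otimes>\<^sub>M borel)"
    unfolding f_def split_beta' by measurable
  obtain C where C: "C \<ge> 0" "\<And>p. (\<integral>\<^sup>+z. ennreal \<bar>f p z\<bar> \<partial>lborel) \<le> ennreal (V * C)"
    using kernel_pair_bound v unfolding f_def by meson
  have int: "integrable ((Q1 \<Otimes>\<^sub>M Q2) \<Otimes>\<^sub>M lborel) (\<lambda>(p, z). f p z)"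
  proof (rule integrableI_bounded)
    have "(\<integral>\<^sup>+q. ennreal (norm (case q of (p, z) \<Rightarrow> f p z)) \<partial>((Q1 \<Otimes>\<^sub>M Q2) \<Otimes>\<^sub>M lborel))
        = (\<integral>\<^sup>+p. \<integral>\<^sup>+z. ennreal \<bar>f p z\<bar> \<partial>lborel \<partial>(Q1 \<Otimes>\<^sub>M Q2))"
      using fm by (subst lborel.nn_integral_fst[symmetric]) (auto cong: measurable_cong_sets)
    also have "\<dots> \<le> (\<integral>\<^sup>+p. ennreal (V * C) \<partial>(Q1 \<Otimes>\<^sub>M Q2))"
      by (intro nn_integral_mono C)
    also have "\<dots> < \<infinity>" using Q12.emeasure_finite[of "space (Q1 \<Otimes>\<^sub>M Q2)"] by (simp add: less_top[symmetric] ennreal_mult_eq_top_iff del: Q12.emeasure_finite)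
    finally show "(\<integral>\<^sup>+q. ennreal (norm (case q of (p, z) \<Rightarrow> f p z)) \<partial>((Q1 \<Otimes>\<^sub>M Q2) \<Otimes>\<^sub>M lborel)) < \<infinity>" .
  qed (use fm in \<open>simp cong: measurable_cong_sets\<close>)
  have prod: "(\<integral>p. f p z \<partial>(Q1 \<Otimes>\<^sub>M Q2)) = v z * ((\<integral>\<omega>. \<alpha> \<omega> z \<partial>Q1) * (\<integral>\<omega>. \<beta> \<omega> z \<partial>Q2))" for z
  proof -
    have az[measurable]: "(\<lambda>\<omega>. \<alpha> \<omega> z) \<in> borel_measurable Q1"
      using measurable_compose[of "\<lambda>w. (w, z)" Q1 "Q1 \<Otimes>\<^sub>M borel" "\<lambda>p. \<alpha> (fst p) (snd p)"] by simp
    have bz[measurable]: "(\<lambda>\<omega>. \<beta> \<omega> z) \<in> borel_measurable Q2"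
      using measurable_compose[of "\<lambda>w. (w, z)" Q2 "Q2 \<Otimes>\<^sub>M borel" "\<lambda>p. \<beta> (fst p) (snd p)"] by simp
    obtain A where A: "\<And>\<omega> z. \<bar>\<alpha> \<omega> z\<bar> \<le> A" using \<alpha> by (auto simp: L1_kernel_def bounded_kernel_def)
    obtain B where B: "\<And>\<omega> z. \<bar>\<beta> \<omega> z\<bar> \<le> B" using \<beta> by (auto simp: bounded_kernel_def)
    have "integrable (Q1 \<Otimes>\<^sub>M Q2) (\<lambda>p. \<alpha> (fst p) z * \<beta> (snd p) z)"
    proof (rule Q12.integrable_const_bound)
      show "AE p in Q1 \<Otimes>\<^sub>M Q2. norm (\<alpha> (fst p) z * \<beta> (snd p) z) \<le> A * B"
        using A B order.trans[OF abs_ge_zero A] by (intro AE_I2) (auto simp: abs_mult intro!: mult_mono)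
    qed measurable
    then have "(\<integral>p. \<alpha> (fst p) z * \<beta> (snd p) z \<partial>(Q1 \<Otimes>\<^sub>M Q2)) = (\<integral>\<omega>. \<integral>\<omega>'. \<alpha> \<omega> z * \<beta> \<omega>' z \<partial>Q2 \<partial>Q1)"
      using P.integral_fst'[of "\<lambda>p. \<alpha> (fst p) z * \<beta> (snd p) z"] by simp
    then show ?thesis by (simp add: f_def)
  qed
  from T.integrable_snd[OF int]
  show "integrable lborel (\<lambda>z. v z * ((\<integral>\<omega>. \<alpha> \<omega> z \<partial>Q1) * (\<integral>\<omega>. \<beta> \<omega> z \<partial>Q2)))" by (simp add: prod)
  have "(\<integral>z. (\<integral>p. f p z \<partial>(Q1 \<Otimes>\<^sub>M Q2)) \<partial>lborel) = (\<integral>p. (\<integral>z. f p z \<partial>lborel) \<partial>(Q1 \<Otimes>\<^sub>M Q2))"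
    by (rule T.Fubini_integral[OF int])
  moreover have "integrable (Q1 \<Otimes>\<^sub>M Q2) (\<lambda>p. \<integral>z. f p z \<partial>lborel)"
    by (rule T.integrable_fst[OF int])
  ultimately show "has_bochner_integral (Q1 \<Otimes>\<^sub>M Q2) (\<lambda>p. \<integral>z. v z * (\<alpha> (fst p) z * \<beta> (snd p) z) \<partial>lborel)
           (\<integral>z. v z * ((\<integral>\<omega>. \<alpha> \<omega> z \<partial>Q1) * (\<integral>\<omega>. \<beta> \<omega> z \<partial>Q2)) \<partial>lborel)"
    unfolding has_bochner_integral_iff prod by (simp add: f_def)
qed

end

section \<open>Exponentially damped time\<close>

text \<open>Time weighted by the killing factor of the resolvent of the Laplacian. For positive
  \<kappa> it is a finite measure even on an infinite set of times, so bounded functions of time are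
  integrable.\<close>

definition damped :: "real \<Rightarrow> real set \<Rightarrow> real measure" where
  "damped \<kappa> A = density lborel (\<lambda>t. ennreal (indicator A t * exp (- \<kappa>\<^sup>2 * t)))"

lemma space_damped [simp]: "space (damped \<kappa> A) = UNIV"
  by (simp add: damped_def)

lemma sets_damped [simp, measurable_cong]: "sets (damped \<kappa> A) = sets borel"
  by (simp add: damped_def)

lemma integrable_exp_atLeast0:
  assumes "0 < (\<kappa>::real)"
  shows "integrable lborel (\<lambda>t. indicator {0..} t * exp (- \<kappa>\<^sup>2 * t))"
proof -
  interpret prob_space "density lborel (exponential_density (\<kappa>\<^sup>2))"
    by (rule prob_space_exponential_density) (use assms in simp)
  have "integrable (density lborel (exponential_density (\<kappa>\<^sup>2))) (\<lambda>_. 1 :: real)" by simp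
  then have "integrable lborel (\<lambda>t. exponential_density (\<kappa>\<^sup>2) t / \<kappa>\<^sup>2)"
    by (subst (asm) integrable_density) (auto simp: exponential_density_def)
  moreover have "exponential_density (\<kappa>\<^sup>2) t / \<kappa>\<^sup>2 = indicator {0..} t * exp (- \<kappa>\<^sup>2 * t)" for t
    using assms by (simp add: exponential_density_def indicator_def mult.commute)
  ultimately show ?thesis by simp
qed

lemma finite_damped:
  assumes "0 < \<kappa>" "A \<subseteq> {0..}" and [measurable]: "A \<in> sets borel"
  shows "finite_measure (damped \<kappa> A)"
proof (rule finite_measureI)
  have "integrable lborel (\<lambda>t. indicator A t * exp (- \<kappa>\<^sup>2 * t))"
    by (rule Bochner_Integration.integrable_bound[OF integrable_exp_atLeast0[OF assms(1)]])
      (use assms(2) in \<open>auto simp: indicator_def\<close>)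
  then show "emeasure (damped \<kappa> A) (space (damped \<kappa> A)) \<noteq> \<infinity>"
    unfolding damped_def by (simp add: emeasure_density integrable_iff_bounded less_top[symmetric])
qed

lemma integral_damped:
  assumes [measurable]: "f \<in> borel_measurable borel" "A \<in> sets borel"
  shows "(\<integral>t. f t \<partial>damped \<kappa> A) = (\<integral>t. indicator A t * exp (- \<kappa>\<^sup>2 * t) * f t \<partial>lborel :: real)"
  unfolding damped_def by (subst integral_density) auto

lemma integrable_damped_iff:
  fixes f :: "real \<Rightarrow> real"
  assumes [measurable]: "f \<in> borel_measurable borel" "A \<in> sets borel"
  shows "integrable (damped \<kappa> A) f \<longleftrightarrow> integrable lborel (\<lambda>t. indicator A t * exp (- \<kappa>\<^sup>2 * t) * f t)"
  unfolding damped_def by (subst integrable_density) auto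

lemma nn_integral_damped:
  assumes [measurable]: "f \<in> borel_measurable borel" "A \<in> sets borel"
  shows "(\<integral>\<^sup>+t. f t \<partial>damped \<kappa> A) = (\<integral>\<^sup>+t. ennreal (indicator A t * exp (- \<kappa>\<^sup>2 * t)) * f t \<partial>lborel)"
  unfolding damped_def by (subst nn_integral_density) auto

lemma AE_damped:
  assumes [measurable]: "A \<in> sets borel"
  shows "AE t in damped \<kappa> A. t \<in> A"
  unfolding damped_def by (subst AE_density) (auto simp: indicator_def)

lemma integrable_damped_bounded:
  fixes f :: "real \<Rightarrow> real"
  assumes "0 < \<kappa>" "A \<subseteq> {0..}" "A \<in> sets borel"
    and f: "f \<in> borel_measurable borel" "\<And>t. t \<in> A \<Longrightarrow> \<bar>f t\<bar> \<le> B"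
  shows "integrable (damped \<kappa> A) f"
proof -
  interpret finite_measure "damped \<kappa> A" by (rule finite_damped[OF assms(1-3)])
  show ?thesis
  proof (rule integrable_const_bound[of _ B])
    show "AE t in damped \<kappa> A. norm (f t) \<le> B"
      using AE_damped[OF assms(3), of \<kappa>] by eventually_elim (simp add: f(2))
    show "f \<in> borel_measurable (damped \<kappa> A)" using f(1) by simp
  qed
qed

section \<open>The heat equation and its integral over late times\<close>

definition heat_laplacian :: "real \<Rightarrow> 'a::euclidean_space \<Rightarrow> real" where
  "heat_laplacian t y = (\<Sum>j\<in>Basis. ddheat j j t y)"

lemma heat_laplacian_measurable [measurable]:
  assumes [measurable]: "f \<in> borel_measurable M" "g \<in> borel_measurable M"
  shows "(\<lambda>x. heat_laplacian (f x) (g x)) \<in> borel_measurable M"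
  unfolding heat_laplacian_def by measurable

lemma heat_laplacian_eq:
  "heat_laplacian t y = ((norm y)\<^sup>2 / (4 * t\<^sup>2) - real DIM('a) / (2 * t)) * heat t (y :: 'a::euclidean_space)"
proof -
  have "(\<Sum>j\<in>(Basis::'a set). (y \<bullet> j) * (y \<bullet> j)) = (norm y)\<^sup>2"
    by (simp add: power2_norm_eq_inner euclidean_inner[of y y])
  then show ?thesis
    unfolding heat_laplacian_def ddheat_def
    by (simp add: sum_distrib_right[symmetric] sum_subtractf sum_divide_distrib[symmetric])
qed

lemma heat_laplacian_le:
  assumes t: "0 < t"
  shows "\<bar>heat_laplacian t y\<bar> \<le> real DIM('a) * (3 / t * 2 powr (real DIM('a) / 2)) * heat (2 * t) (y :: 'a::euclidean_space)"
proof -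
  have "\<bar>heat_laplacian t y\<bar> \<le> (\<Sum>j\<in>(Basis::'a set). 3 / t * 2 powr (real DIM('a) / 2) * heat (2 * t) y)"
    unfolding heat_laplacian_def
    by (intro order.trans[OF sum_abs] sum_mono ddheat_le t)
  then show ?thesis by simp
qed

text \<open>The heat equation with damping: the time derivative of the weighted kernel is \<Delta> -
  \<open>\<kappa>\<^sup>2\<close> applied to it. It holds because \<open>heat_laplacian_eq\<close>
  has the same two terms as the logarithmic derivative in \<open>t\<close>.\<close>

lemma has_derivative_heat_time:
  assumes t: "0 < t"
  shows "((\<lambda>t. exp (- \<kappa>\<^sup>2 * t) * heat t y) has_real_derivative
           exp (- \<kappa>\<^sup>2 * t) * (heat_laplacian t y - \<kappa>\<^sup>2 * heat t (y :: 'a::euclidean_space))) (at t)"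
proof -
  let ?d = "- real DIM('a) / 2"
  have 1: "((\<lambda>t. (4 * pi * t) powr ?d) has_real_derivative (?d / t) * (4 * pi * t) powr ?d) (at t)"
  proof -
    have "((\<lambda>t. (4 * pi * t) powr ?d) has_real_derivative ?d * (4 * pi * t) powr (?d - of_nat 1) * (4 * pi)) (at t)"
      by (rule DERIV_fun_powr) (use t in \<open>auto intro!: derivative_eq_intros\<close>)
    moreover have "(4 * pi * t) powr (?d - of_nat 1) = (4 * pi * t) powr ?d / (4 * pi * t)"
      using t by (simp add: powr_diff del: powr_minus)
    moreover have "?d * (P / (4 * pi * t)) * (4 * pi) = ?d / t * P" for P
      using t by (simp add: field_simps)
    ultimately show ?thesis by (simp only:)
  qed
  have 2: "((\<lambda>t. exp (- (norm y)\<^sup>2 / (4 * t))) has_real_derivative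
      ((norm y)\<^sup>2 / (4 * t\<^sup>2)) * exp (- (norm y)\<^sup>2 / (4 * t))) (at t)"
    using t by (auto intro!: derivative_eq_intros simp: power2_eq_square field_simps)
  have 3: "((\<lambda>t. heat t y) has_real_derivative heat_laplacian t y) (at t)"
    using DERIV_mult[OF 1 2] unfolding heat_laplacian_eq heat_def by (simp add: algebra_simps)
  have 4: "((\<lambda>t. exp (- \<kappa>\<^sup>2 * t)) has_real_derivative - \<kappa>\<^sup>2 * exp (- \<kappa>\<^sup>2 * t)) (at t)"
    by (auto intro!: derivative_eq_intros)
  show ?thesis using DERIV_mult[OF 4 3] by (simp add: algebra_simps)
qed

text \<open>The integrand times the damping is an exact time derivative, so only the boundary value
  at \<open>s\<close> survives; at infinity the damping wins. Consequently \<Delta> -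
  \<open>\<kappa>\<^sup>2\<close> maps the late potential of a point to minus the damped heat kernel
  at time \<open>s\<close>: the cut in time acts as a smearing of the source.\<close>

lemma integral_damped_heat_generator:
  fixes y :: "'a::euclidean_space"
  assumes \<kappa>: "0 < \<kappa>" and s: "0 < s"
  shows "(\<integral>t. heat_laplacian (max s t) y - \<kappa>\<^sup>2 * heat (max s t) y \<partial>damped \<kappa> {s..})
      = - (exp (- \<kappa>\<^sup>2 * s) * heat s y)"
proof -
  define f where "f = (\<lambda>t. heat_laplacian t y - \<kappa>\<^sup>2 * heat t y)"
  define F where "F = (\<lambda>t. exp (- \<kappa>\<^sup>2 * t) * heat t y)"
  have f_bdd: "\<bar>f (max s t)\<bar> \<le> real DIM('a) * (3 / s * 2 powr (real DIM('a) / 2)) * heat s (0::'a) + \<kappa>\<^sup>2 * heat s (0::'a)" for t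
  proof -
    have "\<bar>heat_laplacian (max s t) y\<bar> \<le> real DIM('a) * (3 / max s t * 2 powr (real DIM('a) / 2)) * heat (2 * max s t) y"
      by (rule heat_laplacian_le) (use s in auto)
    also have "\<dots> \<le> real DIM('a) * (3 / s * 2 powr (real DIM('a) / 2)) * heat s (0::'a)"
      using s by (intro mult_mono heat_le_heat_zero) (auto intro!: frac_le mult_right_mono mult_left_mono)
    finally have "\<bar>heat_laplacian (max s t) y\<bar> \<le> real DIM('a) * (3 / s * 2 powr (real DIM('a) / 2)) * heat s (0::'a)" .
    moreover have "\<kappa>\<^sup>2 * heat (max s t) y \<le> \<kappa>\<^sup>2 * heat s (0::'a)"
      by (intro mult_left_mono heat_le_heat_zero s) auto
    ultimately show ?thesis unfolding f_def by (smt (verit) heat_nonneg zero_le_power2 mult_nonneg_nonneg)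
  qed
  have [measurable]: "(\<lambda>t. f (max s t)) \<in> borel_measurable borel" unfolding f_def by measurable
  have "integrable (damped \<kappa> {s..}) (\<lambda>t. f (max s t))"
  proof (rule integrable_damped_bounded[OF \<kappa>])
    show "\<bar>f (max s t)\<bar> \<le> real DIM('a) * (3 / s * 2 powr (real DIM('a) / 2)) * heat s (0::'a) + \<kappa>\<^sup>2 * heat s (0::'a)" for t
      by (rule f_bdd)
  qed (use s in auto)
  then have int: "integrable lborel (\<lambda>t. indicator {s..} t * exp (- \<kappa>\<^sup>2 * t) * f (max s t))"
    by (subst (asm) integrable_damped_iff) auto
  have AE: "AE t in lborel. indicator {s..} t * exp (- \<kappa>\<^sup>2 * t) * f (max s t)
      = indicator (einterval (ereal s) \<infinity>) t *\<^sub>R (exp (- \<kappa>\<^sup>2 * t) * f t)"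
    using AE_lborel_singleton[of s] by eventually_elim (auto simp: indicator_def einterval_def)
  have set_int: "set_integrable lborel (einterval (ereal s) \<infinity>) (\<lambda>t. exp (- \<kappa>\<^sup>2 * t) * f t)"
    unfolding set_integrable_def
    by (rule iffD1[OF integrable_cong_AE int]) (use AE in \<open>auto simp: f_def\<close>)
  have "(LBINT t=ereal s..\<infinity>. exp (- \<kappa>\<^sup>2 * t) * f t) = 0 - F s"
  proof (rule interval_integral_FTC_integrable)
    show "(F has_vector_derivative exp (- \<kappa>\<^sup>2 * t) * f t) (at t)" if "ereal s < ereal t" for t
      unfolding F_def f_def has_real_derivative_iff_has_vector_derivative[symmetric]
      by (rule has_derivative_heat_time) (use that s in auto)
    show "isCont (\<lambda>t. exp (- \<kappa>\<^sup>2 * t) * f t) t" if "ereal s < ereal t" for t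
      unfolding f_def heat_laplacian_eq heat_def using that s by (auto intro!: continuous_intros)
    have "isCont F s" unfolding F_def heat_def using s by (auto intro!: continuous_intros)
    then show "((F \<circ> real_of_ereal) \<longlongrightarrow> F s) (at_right (ereal s))"
      by (simp only: ereal_tendsto_simps1 isCont_def filterlim_at_split)
    have "((\<lambda>t. exp (- \<kappa>\<^sup>2 * t) * heat s (0::'a)) \<longlongrightarrow> 0) at_top"
    proof (rule tendsto_mult_left_zero)
      have "filterlim (\<lambda>t. - (\<kappa>\<^sup>2 * t)) at_bot at_top"
        unfolding filterlim_uminus_at_top[symmetric]
        by (rule filterlim_tendsto_pos_mult_at_top[OF tendsto_const _ filterlim_ident]) (use \<kappa> in simp)
      then show "((\<lambda>t. exp (- \<kappa>\<^sup>2 * t)) \<longlongrightarrow> 0) at_top"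
        by (intro filterlim_compose[OF exp_at_bot]) simp
    qed
    moreover have "\<forall>\<^sub>F t in at_top. norm (F t) \<le> exp (- \<kappa>\<^sup>2 * t) * heat s (0::'a)"
      using eventually_ge_at_top[of s]
      by eventually_elim (use s in \<open>auto simp: F_def intro!: heat_le_heat_zero\<close>)
    ultimately have "(F \<longlongrightarrow> 0) at_top" by (rule Lim_null_comparison[rotated])
    then show "((F \<circ> real_of_ereal) \<longlongrightarrow> 0) (at_left \<infinity>)" by (simp add: ereal_tendsto_simps)
  qed (use set_int in auto)
  also have "(LBINT t=ereal s..\<infinity>. exp (- \<kappa>\<^sup>2 * t) * f t)
      = (\<integral>t. indicator {s..} t * exp (- \<kappa>\<^sup>2 * t) * f (max s t) \<partial>lborel)"
    unfolding interval_lebesgue_integral_def set_lebesgue_integral_def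
    by (simp, rule integral_cong_AE) (use AE in \<open>auto simp: f_def\<close>)
  finally show ?thesis
    by (subst integral_damped) (auto simp: f_def F_def)
qed

text \<open>The Yukawa kernel is the integral of the heat kernel over \<open>damped \<kappa> {0<..}\<close>; here it is restricted to the times
  from \<open>\<tau>\<close> on. The gradient of \<open>far\<close> at \<open>y\<close> is \<open>- far_slope y\<close> times \<open>y\<close>, and likewise for \<open>near\<close> below.\<close>

definition far :: "real \<Rightarrow> real \<Rightarrow> 'a::euclidean_space \<Rightarrow> real" where
  "far \<kappa> \<tau> y = (\<integral>t. heat t y \<partial>damped \<kappa> {\<tau>..})"

definition far_slope :: "real \<Rightarrow> real \<Rightarrow> 'a::euclidean_space \<Rightarrow> real" where
  "far_slope \<kappa> \<tau> y = (\<integral>t. heat t y / (2 * t) \<partial>damped \<kappa> {\<tau>..})"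

text \<open>Convolving the kernel at time \<open>s\<close> with late kernels adds \<open>s\<close>
  to their times. The damping factor from the boundary term in
  \<open>integral_damped_heat_generator\<close> is the one needed to read the result as damped time
  from \<open>2 * s\<close> on.\<close>

lemma damped_translate:
  fixes f :: "real \<Rightarrow> real"
  assumes [measurable]: "f \<in> borel_measurable borel"
  shows "exp (- \<kappa>\<^sup>2 * s) * (\<integral>t. f (t + s) \<partial>damped \<kappa> {s..}) = (\<integral>t. f t \<partial>damped \<kappa> {2 * s..})"
proof -
  have "(\<integral>t. f t \<partial>damped \<kappa> {2 * s..}) = (\<integral>t. indicator {2 * s..} t * exp (- \<kappa>\<^sup>2 * t) * f t \<partial>lborel)"
    by (rule integral_damped) auto
  also have "\<dots> = (\<integral>t. indicator {2 * s..} (t - (- s)) * exp (- \<kappa>\<^sup>2 * (t - (- s))) * f (t - (- s)) \<partial>lborel)"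
    by (rule integral_lborel_minus[symmetric]) measurable
  also have "\<dots> = (\<integral>t. exp (- \<kappa>\<^sup>2 * s) * (indicator {s..} t * exp (- \<kappa>\<^sup>2 * t) * f (t + s)) \<partial>lborel)"
    by (intro Bochner_Integration.integral_cong refl)
      (auto simp: indicator_def algebra_simps simp flip: exp_add)
  finally show ?thesis by (subst integral_damped) auto
qed

text \<open>The bound is uniform in the parameter and linear in the sup norm of the test function. This gives dominated
  convergence for a sequence of test functions that is bounded but does not converge.\<close>

definition fubini_bound ::
  "'p measure \<Rightarrow> ('p \<Rightarrow> 'a::euclidean_space \<Rightarrow> real) \<Rightarrow> ('a \<Rightarrow> real) \<Rightarrow> real \<Rightarrow> bool" where
  "fubini_bound R T H C \<longleftrightarrow> (\<forall>v V. v \<in> borel_measurable borel \<longrightarrow> (\<forall>z. \<bar>v z\<bar> \<le> V) \<longrightarrow>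
     integrable lborel (\<lambda>z. v z * H z) \<and>
     has_bochner_integral R (\<lambda>p. \<integral>z. v z * T p z \<partial>lborel) (\<integral>z. v z * H z \<partial>lborel) \<and>
     (\<forall>p. integrable lborel (\<lambda>z. v z * T p z) \<and> \<bar>\<integral>z. v z * T p z \<partial>lborel\<bar> \<le> V * C))"

definition fubini_pair :: "'p measure \<Rightarrow> ('p \<Rightarrow> 'a::euclidean_space \<Rightarrow> real) \<Rightarrow> ('a \<Rightarrow> real) \<Rightarrow> bool" where
  "fubini_pair R T H \<longleftrightarrow> (\<exists>C\<ge>0. fubini_bound R T H C)"

lemma fubini_boundD:
  fixes v :: "'a::euclidean_space \<Rightarrow> real"
  assumes "fubini_bound R T H C" "v \<in> borel_measurable borel" "\<And>z. \<bar>v z\<bar> \<le> V"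
  shows "integrable lborel (\<lambda>z. v z * H z)"
    and "has_bochner_integral R (\<lambda>p. \<integral>z. v z * T p z \<partial>lborel) (\<integral>z. v z * H z \<partial>lborel)"
    and "\<And>p. integrable lborel (\<lambda>z. v z * T p z)"
    and "\<And>p. \<bar>\<integral>z. v z * T p z \<partial>lborel\<bar> \<le> V * C"
  using assms unfolding fubini_bound_def by blast+

lemma fubini_pair_kernel:
  assumes fin: "finite_measure Q1" "finite_measure Q2" and \<alpha>: "L1_kernel Q1 \<alpha>" and \<beta>: "bounded_kernel Q2 \<beta>"
  shows "fubini_pair (Q1 \<Otimes>\<^sub>M Q2) (\<lambda>p z. \<alpha> (fst p) z * \<beta> (snd p) z)
           (\<lambda>z. (\<integral>\<omega>. \<alpha> \<omega> z \<partial>Q1) * (\<integral>\<omega>. \<beta> \<omega> z \<partial>Q2))"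
proof -
  from kernel_pair_bound[OF assms] obtain C where C: "C \<ge> 0"
    "\<And>v V p. v \<in> borel_measurable borel \<Longrightarrow> (\<forall>z. \<bar>v z\<bar> \<le> V) \<Longrightarrow>
     (\<integral>\<^sup>+z. ennreal \<bar>v z * (\<alpha> (fst p) z * \<beta> (snd p) z)\<bar> \<partial>lborel) \<le> ennreal (V * C)" by metis
  have "integrable lborel (\<lambda>z. v z * (\<alpha> (fst p) z * \<beta> (snd p) z)) \<and>
      \<bar>\<integral>z. v z * (\<alpha> (fst p) z * \<beta> (snd p) z) \<partial>lborel\<bar> \<le> V * C"
    if v[measurable]: "v \<in> borel_measurable borel" and V: "\<forall>z. \<bar>v z\<bar> \<le> V" for v V p
  proof
    have [measurable]: "\<alpha> (fst p) \<in> borel_measurable borel" "\<beta> (snd p) \<in> borel_measurable borel"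
      using \<alpha> \<beta> by (auto simp: L1_kernel_def bounded_kernel_def)
    have V0: "V \<ge> 0" using V[rule_format, of 0] by linarith
    note le = C(2)[OF v V, of p]
    show int: "integrable lborel (\<lambda>z. v z * (\<alpha> (fst p) z * \<beta> (snd p) z))"
      by (rule integrableI_bounded) (use le in \<open>auto simp: less_top[symmetric] top_unique\<close>)
    have "\<bar>\<integral>z. v z * (\<alpha> (fst p) z * \<beta> (snd p) z) \<partial>lborel\<bar> \<le> (\<integral>z. \<bar>v z * (\<alpha> (fst p) z * \<beta> (snd p) z)\<bar> \<partial>lborel)"
      by (rule integral_abs_bound)
    also have "\<dots> \<le> V * C"
    proof -
      have "ennreal (\<integral>z. \<bar>v z * (\<alpha> (fst p) z * \<beta> (snd p) z)\<bar> \<partial>lborel) \<le> ennreal (V * C)"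
        using le int by (subst nn_integral_eq_integral[symmetric]) auto
      then show ?thesis using V0 C(1) by (simp add: ennreal_le_iff)
    qed
    finally show "\<bar>\<integral>z. v z * (\<alpha> (fst p) z * \<beta> (snd p) z) \<partial>lborel\<bar> \<le> V * C" .
  qed
  then show ?thesis
    unfolding fubini_pair_def fubini_bound_def
    using kernel_pair_Fubini(1)[OF assms] kernel_pair_Fubini(2)[OF assms] C(1) by (intro exI[of _ C]) blast
qed

lemma fubini_pair_add:
  fixes H :: "'a::euclidean_space \<Rightarrow> real"
  assumes "fubini_pair R T H" "fubini_pair R T' H'"
  shows "fubini_pair R (\<lambda>p z. T p z + T' p z) (\<lambda>z. H z + H' z)"
proof -
  obtain C where C: "C \<ge> 0" "fubini_bound R T H C"
    using assms(1) unfolding fubini_pair_def by blast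
  obtain C' where C': "C' \<ge> 0" "fubini_bound R T' H' C'"
    using assms(2) unfolding fubini_pair_def by blast
  have "fubini_bound R (\<lambda>p z. T p z + T' p z) (\<lambda>z. H z + H' z) (C + C')"
    unfolding fubini_bound_def
  proof (intro conjI allI impI)
    fix v :: "'a \<Rightarrow> real" and V :: real
    assume v: "v \<in> borel_measurable borel" "\<forall>z. \<bar>v z\<bar> \<le> V"
    note T = fubini_boundD[OF C(2) v(1) v(2)[rule_format]]
    note T' = fubini_boundD[OF C'(2) v(1) v(2)[rule_format]]
    show "integrable lborel (\<lambda>z. v z * (H z + H' z))"
      "integrable lborel (\<lambda>z. v z * (T p z + T' p z))" for p
      using T T' by (simp_all add: distrib_left)
    show "has_bochner_integral R (\<lambda>p. \<integral>z. v z * (T p z + T' p z) \<partial>lborel) (\<integral>z. v z * (H z + H' z) \<partial>lborel)"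
      using has_bochner_integral_add[OF T(2) T'(2)] T T' by (simp add: distrib_left)
    show "\<bar>\<integral>z. v z * (T p z + T' p z) \<partial>lborel\<bar> \<le> V * (C + C')" for p
    proof -
      have "(\<integral>z. v z * (T p z + T' p z) \<partial>lborel) = (\<integral>z. v z * T p z \<partial>lborel) + (\<integral>z. v z * T' p z \<partial>lborel)"
        using T T' by (simp add: distrib_left)
      then show ?thesis using T(4)[of p] T'(4)[of p] by (simp add: distrib_left)
    qed
  qed
  then show ?thesis using C C' unfolding fubini_pair_def by (intro exI[of _ "C + C'"]) auto
qed

lemma fubini_pair_cmult:
  fixes H :: "'a::euclidean_space \<Rightarrow> real"
  assumes "fubini_pair R T H"
  shows "fubini_pair R (\<lambda>p z. c * T p z) (\<lambda>z. c * H z)"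
proof -
  obtain C where C: "C \<ge> 0" "fubini_bound R T H C"
    using assms(1) unfolding fubini_pair_def by blast
  have "fubini_bound R (\<lambda>p z. c * T p z) (\<lambda>z. c * H z) (\<bar>c\<bar> * C)"
    unfolding fubini_bound_def
  proof (intro conjI allI impI)
    fix v :: "'a \<Rightarrow> real" and V :: real
    assume v: "v \<in> borel_measurable borel" "\<forall>z. \<bar>v z\<bar> \<le> V"
    note T = fubini_boundD[OF C(2) v(1) v(2)[rule_format]]
    show "integrable lborel (\<lambda>z. v z * (c * H z))"
      "integrable lborel (\<lambda>z. v z * (c * T p z))" for p
      using T by (simp_all add: mult.left_commute[of _ c])
    show "has_bochner_integral R (\<lambda>p. \<integral>z. v z * (c * T p z) \<partial>lborel) (\<integral>z. v z * (c * H z) \<partial>lborel)"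
      using has_bochner_integral_mult_right[OF T(2), of c] by (simp add: mult.left_commute[of _ c])
    show "\<bar>\<integral>z. v z * (c * T p z) \<partial>lborel\<bar> \<le> V * (\<bar>c\<bar> * C)" for p
      using mult_left_mono[OF T(4)[of p], of "\<bar>c\<bar>"] by (simp add: mult.left_commute[of _ c] abs_mult mult.left_commute[of _ "\<bar>c\<bar>"])
  qed
  then show ?thesis using C unfolding fubini_pair_def by (intro exI[of _ "\<bar>c\<bar> * C"]) auto
qed

lemma fubini_pair_sum:
  assumes "finite I" "I \<noteq> {}" "\<And>k. k \<in> I \<Longrightarrow> fubini_pair R (T k) (H k)"
  shows "fubini_pair R (\<lambda>p z. \<Sum>k\<in>I. T k p z) (\<lambda>z. \<Sum>k\<in>I. H k z)"
  using assms
  by (induction I rule: finite_ne_induct) (auto intro!: fubini_pair_add)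

lemma fubini_pairD:
  assumes "fubini_pair R T H"
  shows "integrable lborel H" "has_bochner_integral R (\<lambda>p. \<integral>z. T p z \<partial>lborel) (\<integral>z. H z \<partial>lborel)"
    "\<And>p. integrable lborel (T p)"
proof -
  from assms obtain C where C: "C \<ge> 0" "fubini_bound R T H C"
    unfolding fubini_pair_def by blast
  from fubini_boundD[OF C(2), of "\<lambda>_. 1" 1]
  show "integrable lborel H" "has_bochner_integral R (\<lambda>p. \<integral>z. T p z \<partial>lborel) (\<integral>z. H z \<partial>lborel)"
    "\<And>p. integrable lborel (T p)"
    by auto
qed

section \<open>The stress tensor of a pair of heat kernels\<close>

text \<open>With \<^term>\<open>A\<close> and \<^term>\<open>A'\<close> the gradients of \<^term>\<open>a\<close> and \<^term>\<open>a'\<close>, the divergence of this tensor is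
  \<open>\<nabla>a (\<Delta> - \<kappa>\<^sup>2) a' + \<nabla>a' (\<Delta> - \<kappa>\<^sup>2) a\<close>.\<close>

definition stress :: "real \<Rightarrow> ('a::euclidean_space \<Rightarrow> 'a \<Rightarrow> real) \<Rightarrow> ('a \<Rightarrow> 'a \<Rightarrow> real)
    \<Rightarrow> ('a \<Rightarrow> real) \<Rightarrow> ('a \<Rightarrow> real) \<Rightarrow> 'a \<Rightarrow> 'a \<Rightarrow> 'a \<Rightarrow> real" where
  "stress \<kappa> A A' a a' i j z = (A i z * A' j z + A j z * A' i z)
     + (if i = j then -1 else 0) * ((\<Sum>k\<in>Basis. A k z * A' k z) + \<kappa>\<^sup>2 * (a z * a' z))"

lemma ddheat_commute: "ddheat i j t y = ddheat j i t y"
  by (simp add: ddheat_def inner_commute mult.commute)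

context
  fixes x y :: "'a::euclidean_space" and t r \<kappa> :: real
  assumes t: "0 < t" and r: "0 < r"
begin

abbreviation "pair_stress i j z \<equiv>
  stress \<kappa> (\<lambda>k z. dheat k t (z - x)) (\<lambda>k z. dheat k r (z - y)) (\<lambda>z. heat t (z - x)) (\<lambda>z. heat r (z - y)) i j z"

text \<open>The mixed second derivatives produced by the two symmetric products cancel against the
  derivative of the scalar product of the gradients. The Laplacians survive, and the zeroth order
  term of the tensor completes each of them to \<Delta> - \<open>\<kappa>\<^sup>2\<close>.\<close>

lemma stress_divergence:
  assumes i: "i \<in> (Basis :: 'a set)"
  shows "\<exists>T'. (\<forall>j\<in>Basis. decaying_deriv j (pair_stress i j) (T' j)) \<and>
    (\<forall>z. (\<Sum>j\<in>Basis. T' j z) =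
      dheat i t (z - x) * (heat_laplacian r (z - y) - \<kappa>\<^sup>2 * heat r (z - y))
      + dheat i r (z - y) * (heat_laplacian t (z - x) - \<kappa>\<^sup>2 * heat t (z - x)))"
proof -
  \<comment> \<open>The derivative along \<open>j\<close> of the scalar in the diagonal part of the
    tensor.\<close>
  define S' where "S' = (\<lambda>j z. (\<Sum>k\<in>Basis. ddheat k j t (z - x) * dheat k r (z - y) + dheat k t (z - x) * ddheat k j r (z - y))
      + \<kappa>\<^sup>2 * (dheat j t (z - x) * heat r (z - y) + heat t (z - x) * dheat j r (z - y)))"
  define T' where "T' = (\<lambda>j z. ((ddheat i j t (z - x) * dheat j r (z - y) + dheat i t (z - x) * ddheat j j r (z - y))
      + (ddheat j j t (z - x) * dheat i r (z - y) + dheat j t (z - x) * ddheat i j r (z - y)))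
      + (if i = j then -1 else 0) * S' j z)"
  show ?thesis
  proof (intro exI[of _ T'] conjI ballI allI)
    fix j assume j: "j \<in> (Basis :: 'a set)"
    show "decaying_deriv j (pair_stress i j) (T' j)"
      unfolding T'_def S'_def stress_def
      by (intro decaying_deriv_add decaying_deriv_cmult decaying_deriv_mult decaying_deriv_sum
          decaying_deriv_dheat decaying_deriv_heat t r i j finite_Basis)
  next
    fix z
    have "(\<Sum>j\<in>Basis. (if i = j then -1 else 0) * S' j z) = - S' i z"
      using i by (simp add: if_distrib[of "\<lambda>c. c * _"] sum.delta cong: if_cong)
    then show "(\<Sum>j\<in>Basis. T' j z) =
      dheat i t (z - x) * (heat_laplacian r (z - y) - \<kappa>\<^sup>2 * heat r (z - y))
      + dheat i r (z - y) * (heat_laplacian t (z - x) - \<kappa>\<^sup>2 * heat t (z - x))"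
      unfolding T'_def sum.distrib
      by (simp add: S'_def heat_laplacian_def sum.distrib sum_distrib_left[symmetric] sum_distrib_right[symmetric]
          ddheat_commute[of _ i] algebra_simps)
  qed
qed

text \<open>Weak form of the divergence identity. On the left \<open>v\<close> enters only through
  difference quotients, which the Lipschitz constant bounds; on the right \<open>v\<close> itself
  appears, and this is what becomes the commutator.\<close>

lemma stress_difference_quotient_limit:
  fixes v :: "'a \<Rightarrow> 'a \<Rightarrow> real" and h :: "nat \<Rightarrow> real"
  assumes v: "\<And>i. i \<in> Basis \<Longrightarrow> K-lipschitz_on UNIV (v i)"
    and h: "h \<longlonglongrightarrow> 0" "\<And>n. h n \<noteq> 0" "\<And>n. \<bar>h n\<bar> \<le> 1"
  shows "(\<lambda>n. \<Sum>i\<in>Basis. \<Sum>j\<in>Basis. \<integral>z. (v i (z - h n *\<^sub>R j) - v i z) / h n * pair_stress i j z \<partial>lborel)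
    \<longlonglongrightarrow> (\<Sum>i\<in>Basis. \<integral>z. v i z *
      (dheat i t (z - x) * (heat_laplacian r (z - y) - \<kappa>\<^sup>2 * heat r (z - y))
      + dheat i r (z - y) * (heat_laplacian t (z - x) - \<kappa>\<^sup>2 * heat t (z - x))) \<partial>lborel)"
proof (rule tendsto_sum)
  fix i assume i: "i \<in> (Basis :: 'a set)"
  from stress_divergence[OF i] obtain T' where
    T': "\<And>j. j \<in> Basis \<Longrightarrow> decaying_deriv j (pair_stress i j) (T' j)" and
    sum: "\<And>z. (\<Sum>j\<in>Basis. T' j z) =
      dheat i t (z - x) * (heat_laplacian r (z - y) - \<kappa>\<^sup>2 * heat r (z - y))
      + dheat i r (z - y) * (heat_laplacian t (z - x) - \<kappa>\<^sup>2 * heat t (z - x))" by blast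
  have "(\<lambda>n. \<Sum>j\<in>Basis. \<integral>z. (v i (z - h n *\<^sub>R j) - v i z) / h n * pair_stress i j z \<partial>lborel)
      \<longlonglongrightarrow> (\<Sum>j\<in>Basis. \<integral>z. v i z * T' j z \<partial>lborel)"
    by (intro tendsto_sum integration_by_parts_difference_quotient[OF v[OF i]] T' h) auto
  also have "(\<Sum>j\<in>Basis. \<integral>z. v i z * T' j z \<partial>lborel) = (\<integral>z. (\<Sum>j\<in>Basis. v i z * T' j z) \<partial>lborel)"
    by (rule Bochner_Integration.integral_sum[symmetric], rule integrable_lipschitz_mult_gaussian_decay[OF v[OF i]])
      (use T' in \<open>auto simp: decaying_deriv_def\<close>)
  also have "\<dots> = (\<integral>z. v i z * (\<Sum>j\<in>Basis. T' j z) \<partial>lborel)"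
    by (simp add: sum_distrib_left)
  finally show "(\<lambda>n. \<Sum>j\<in>Basis. \<integral>z. (v i (z - h n *\<^sub>R j) - v i z) / h n * pair_stress i j z \<partial>lborel)
      \<longlonglongrightarrow> (\<integral>z. v i z *
      (dheat i t (z - x) * (heat_laplacian r (z - y) - \<kappa>\<^sup>2 * heat r (z - y))
      + dheat i r (z - y) * (heat_laplacian t (z - x) - \<kappa>\<^sup>2 * heat t (z - x))) \<partial>lborel)"
    unfolding sum .
qed

text \<open>Green's first identity: the divergence of one kernel times the gradient of the other
  decays like a Gaussian and integrates to zero.\<close>

lemma integral_dheat_dheat:
  "(\<integral>z. (\<Sum>k\<in>Basis. dheat k t (z - x) * dheat k r (z - y)) + \<kappa>\<^sup>2 * (heat t (z - x) * heat r (z - y)) \<partial>lborel)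
    = - (\<integral>z. heat t (z - x) * (heat_laplacian r (z - y) - \<kappa>\<^sup>2 * heat r (z - y)) \<partial>lborel)"
proof -
  have dd: "decaying_deriv k (\<lambda>z. heat t (z - x) * dheat k r (z - y))
      (\<lambda>z. dheat k t (z - x) * dheat k r (z - y) + heat t (z - x) * ddheat k k r (z - y))" if "k \<in> Basis" for k
    by (intro decaying_deriv_mult decaying_deriv_heat decaying_deriv_dheat t r that)
  define g where "g = (\<lambda>k z. dheat k t (z - x) * dheat k r (z - y) + heat t (z - x) * ddheat k k r (z - y))"
  have int: "integrable lborel (g k)" if "k \<in> Basis" for k
    using dd[OF that] unfolding decaying_deriv_def g_def by (intro integrable_gaussian_decay) auto
  have "(\<integral>z. (\<Sum>k\<in>Basis. g k z) \<partial>lborel) = (\<Sum>k\<in>Basis. \<integral>z. g k z \<partial>lborel)"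
    by (rule Bochner_Integration.integral_sum) (rule int)
  also have "\<dots> = 0"
    unfolding g_def using integral_decaying_deriv[OF dd] by simp
  finally have zero: "(\<integral>z. (\<Sum>k\<in>Basis. g k z) \<partial>lborel) = 0" .
  have "gaussian_decay (\<lambda>z. heat t (z - x) * (heat_laplacian r (z - y) - \<kappa>\<^sup>2 * heat r (z - y)))"
  proof (rule gaussian_decay_mult_bounded(2)[OF gaussian_decay_heat[OF t]])
    fix z
    show "\<bar>heat_laplacian r (z - y) - \<kappa>\<^sup>2 * heat r (z - y)\<bar>
      \<le> real DIM('a) * (3 / r * 2 powr (real DIM('a) / 2)) * heat (2 * r) (0 :: 'a) + \<kappa>\<^sup>2 * heat r (0 :: 'a)"
    proof -
      have "\<bar>heat_laplacian r (z - y)\<bar> \<le> real DIM('a) * (3 / r * 2 powr (real DIM('a) / 2)) * heat (2 * r) (z - y)"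
        by (rule heat_laplacian_le[OF r])
      also have "\<dots> \<le> real DIM('a) * (3 / r * 2 powr (real DIM('a) / 2)) * heat (2 * r) (0 :: 'a)"
        using r by (intro mult_left_mono heat_le_zero) auto
      finally have 1: "\<bar>heat_laplacian r (z - y)\<bar> \<le> real DIM('a) * (3 / r * 2 powr (real DIM('a) / 2)) * heat (2 * r) (0 :: 'a)" .
      have 2: "\<kappa>\<^sup>2 * heat r (z - y) \<le> \<kappa>\<^sup>2 * heat r (0 :: 'a)"
        by (intro mult_left_mono heat_le_zero r) auto
      have 3: "0 \<le> \<kappa>\<^sup>2 * heat r (z - y)" by simp
      show ?thesis using 1 2 3 by linarith
    qed
  qed
  then have int2: "integrable lborel (\<lambda>z. heat t (z - x) * (heat_laplacian r (z - y) - \<kappa>\<^sup>2 * heat r (z - y)))"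
    by (rule integrable_gaussian_decay) measurable
  have "(\<integral>z. (\<Sum>k\<in>Basis. dheat k t (z - x) * dheat k r (z - y)) + \<kappa>\<^sup>2 * (heat t (z - x) * heat r (z - y)) \<partial>lborel)
      = (\<integral>z. (\<Sum>k\<in>Basis. g k z) - heat t (z - x) * (heat_laplacian r (z - y) - \<kappa>\<^sup>2 * heat r (z - y)) \<partial>lborel)"
    by (intro Bochner_Integration.integral_cong refl)
      (simp add: g_def heat_laplacian_def sum.distrib sum_distrib_left algebra_simps)
  also have "\<dots> = - (\<integral>z. heat t (z - x) * (heat_laplacian r (z - y) - \<kappa>\<^sup>2 * heat r (z - y)) \<partial>lborel)"
    using int int2 zero by simp
  finally show ?thesis .
qed

end

section \<open>The commutator estimate for a smeared signed measure\<close>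

text \<open>At the origin the left side is a constant times
  \<open>t powr (1 / 2 - real DIM('a) / 2)\<close>, which does not increase because the dimension is
  at least 1. It pays for the factor \<open>sqrt t\<close> that a Lipschitz difference costs at late
  times.\<close>

lemma sqrt_heat_le:
  assumes s: "0 < s" and t: "s \<le> t"
  shows "sqrt t * heat t (y :: 'a::euclidean_space) \<le> sqrt s * heat s (0 :: 'a)"
proof -
  have d: "1 \<le> real DIM('a)" using DIM_positive[where 'a='a] by linarith
  have *: "sqrt r * heat r (0 :: 'a) = (4 * pi) powr (- real DIM('a) / 2) * r powr (1 / 2 - real DIM('a) / 2)" if "0 < r" for r
    using that by (simp add: heat_def powr_mult powr_half_sqrt[symmetric] flip: powr_add)
  have "sqrt t * heat t y \<le> sqrt t * heat t (0 :: 'a)"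
    using s t by (intro mult_left_mono heat_le_zero) auto
  also have "\<dots> = (4 * pi) powr (- real DIM('a) / 2) * t powr (1 / 2 - real DIM('a) / 2)"
    using s t by (intro *) simp
  also have "\<dots> \<le> (4 * pi) powr (- real DIM('a) / 2) * s powr (1 / 2 - real DIM('a) / 2)"
    using s t d by (intro mult_left_mono powr_mono2') auto
  also have "\<dots> = sqrt s * heat s (0 :: 'a)" using s by (simp only: *)
  finally show ?thesis .
qed

text \<open>The signed measure under study is \<open>\<sigma>\<close> times the finite positive
  measure \<open>M\<close>. This encoding leaves every integral, and Fubini's theorem, within
  positive measures.\<close>

locale smeared_measure =
  fixes M :: "'a::euclidean_space measure" and \<sigma> :: "'a \<Rightarrow> real" and \<kappa> s L :: real and u :: "'a \<Rightarrow> 'a"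
  assumes finite_M: "finite_measure M" and sets_M [measurable_cong, simp]: "sets M = sets borel"
    and \<sigma>_meas [measurable]: "\<sigma> \<in> borel_measurable borel" and \<sigma>_le: "\<And>x. \<bar>\<sigma> x\<bar> \<le> 1"
    and \<kappa>: "0 < \<kappa>" and s: "0 < s" and u: "L-lipschitz_on UNIV u"
begin

lemma space_M [simp]: "space M = UNIV"
  using sets_eq_imp_space_eq[OF sets_M] by simp

lemma u_meas [measurable]: "u \<in> borel_measurable borel"
  using lipschitz_on_continuous_on[OF u] by (rule borel_measurable_continuous_onI)

lemma L_nonneg: "0 \<le> L"
  using u by (rule lipschitz_on_nonneg)

lemma u_diff_le: "norm (u x - u y) \<le> L * norm (x - y)"
  using lipschitz_onD[OF u, of x y] by (simp add: dist_norm)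

lemma u_comp_le: "i \<in> Basis \<Longrightarrow> \<bar>(u x - u y) \<bullet> i\<bar> \<le> L * norm (x - y)"
  using order.trans[OF Basis_le_norm u_diff_le] .

definition "\<Theta> = damped \<kappa> {s..}"

definition "Q = M \<Otimes>\<^sub>M \<Theta>"

lemma sets_\<Theta> [measurable_cong, simp]: "sets \<Theta> = sets borel"
  by (simp add: \<Theta>_def)

lemma space_\<Theta> [simp]: "space \<Theta> = UNIV"
  by (simp add: \<Theta>_def)

lemma finite_\<Theta>: "finite_measure \<Theta>"
  unfolding \<Theta>_def using \<kappa> s by (intro finite_damped) auto

lemma sets_Q [measurable_cong, simp]: "sets Q = sets (borel \<Otimes>\<^sub>M borel)"
  unfolding Q_def by (intro sets_pair_measure_cong) auto

lemma space_Q [simp]: "space Q = UNIV"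
  unfolding Q_def by (simp add: space_pair_measure)

lemma finite_Q: "finite_measure Q"
  unfolding Q_def by (rule finite_measure_pair_measure[OF finite_\<Theta> finite_M])

text \<open>Only times \<open>t \<ge> s\<close> carry mass; \<open>max s t\<close> makes the bounds hold for every \<open>t\<close>.\<close>

definition "ka \<omega> = (\<lambda>z. \<sigma> (fst \<omega>) * heat (max s (snd \<omega>)) (z - fst \<omega>))"
definition "kA i \<omega> = (\<lambda>z. \<sigma> (fst \<omega>) * dheat i (max s (snd \<omega>)) (z - fst \<omega>))"
definition "kB \<omega> = (\<lambda>z. \<sigma> (fst \<omega>) * (heat_laplacian (max s (snd \<omega>)) (z - fst \<omega>) - \<kappa>\<^sup>2 * heat (max s (snd \<omega>)) (z - fst \<omega>)))"
definition "kb x = (\<lambda>z. \<sigma> x * heat s (z - x))"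
text \<open>In \<open>kUA\<close>, \<open>kUB\<close> and \<open>kUb\<close> the field enters as its
  increment from the source point to the field point \<open>z\<close>, which is controlled by the
  distance although \<open>u\<close> is unbounded. Otherwise \<open>A\<close> stands for the
  gradient, \<open>B\<close> for \<Delta> - \<open>\<kappa>\<^sup>2\<close>, and \<open>b\<close>
  for the source smeared up to time \<open>s\<close>.\<close>

definition "kUA i \<omega> = (\<lambda>z. ((u z - u (fst \<omega>)) \<bullet> i) * kA i \<omega> z)"
definition "kUB i \<omega> = (\<lambda>z. ((u z - u (fst \<omega>)) \<bullet> i) * kB \<omega> z)"
definition "kUb i x = (\<lambda>z. ((u z - u x) \<bullet> i) * kb x z)"
text \<open>Unsigned majorant of \<open>kUb\<close> up to a constant: the doubled time absorbs the
  distance coming from the increment of \<open>u\<close>.\<close>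

definition "ky x = (\<lambda>z. heat (2 * s) (z - x))" for x :: 'a

lemma \<sigma>_mult_le: "\<bar>c\<bar> \<le> C \<Longrightarrow> \<bar>\<sigma> x * c\<bar> \<le> C"
  using mult_mono[OF \<sigma>_le[of x], of "\<bar>c\<bar>" C] by (simp add: abs_mult)

lemma L1_ka: "L1_kernel Q ka"
proof (rule L1_kernel_heatI[where s=s and r="\<lambda>\<omega>. max s (snd \<omega>)" and c=1 and x=fst])
  show "\<bar>ka \<omega> z\<bar> \<le> 1 * heat (max s (snd \<omega>)) (z - fst \<omega>)" for \<omega> z
    unfolding ka_def by (rule \<sigma>_mult_le) simp
qed (use s in \<open>auto simp: ka_def\<close>)

lemma L1_kb: "L1_kernel M kb"
proof (rule L1_kernel_heatI[where s=s and r="\<lambda>\<omega>. s" and c=1 and x="\<lambda>x. x"])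
  show "\<bar>kb x z\<bar> \<le> 1 * heat s (z - x)" for x z
    unfolding kb_def by (rule \<sigma>_mult_le) simp
qed (use s in \<open>auto simp: kb_def\<close>)

lemma L1_ky: "L1_kernel M ky"
  by (rule L1_kernel_heatI[where s=s and r="\<lambda>\<omega>. 2 * s" and c=1 and x="\<lambda>x. x"])
    (use s in \<open>auto simp: ky_def\<close>)

lemma L1_kA:
  assumes i: "i \<in> Basis"
  shows "L1_kernel Q (kA i)"
proof (rule L1_kernel_heatI[where s=s and r="\<lambda>\<omega>. 2 * max s (snd \<omega>)" and
      c="2 / sqrt s * 2 powr (real DIM('a) / 2)" and x=fst])
  show "\<bar>kA i \<omega> z\<bar> \<le> 2 / sqrt s * 2 powr (real DIM('a) / 2) * heat (2 * max s (snd \<omega>)) (z - fst \<omega>)" for \<omega> z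
    unfolding kA_def
  proof (rule \<sigma>_mult_le)
    have "\<bar>dheat i (max s (snd \<omega>)) (z - fst \<omega>)\<bar>
        \<le> 2 / sqrt (max s (snd \<omega>)) * 2 powr (real DIM('a) / 2) * heat (2 * max s (snd \<omega>)) (z - fst \<omega>)"
      using s by (intro dheat_le i) auto
    also have "\<dots> \<le> 2 / sqrt s * 2 powr (real DIM('a) / 2) * heat (2 * max s (snd \<omega>)) (z - fst \<omega>)"
      using s by (intro mult_right_mono frac_le) auto
    finally show "\<bar>dheat i (max s (snd \<omega>)) (z - fst \<omega>)\<bar>
        \<le> 2 / sqrt s * 2 powr (real DIM('a) / 2) * heat (2 * max s (snd \<omega>)) (z - fst \<omega>)" .
  qed
qed (use s in \<open>auto simp: kA_def\<close>)

definition "cB = real DIM('a) * (3 / s * 2 powr (real DIM('a) / 2)) + \<kappa>\<^sup>2 * 2 powr (real DIM('a) / 2)"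

lemma generator_le:
  "\<bar>heat_laplacian (max s t) y - \<kappa>\<^sup>2 * heat (max s t) y\<bar> \<le> cB * heat (2 * max s t) (y :: 'a)"
proof -
  have "\<bar>heat_laplacian (max s t) y\<bar> \<le> real DIM('a) * (3 / max s t * 2 powr (real DIM('a) / 2)) * heat (2 * max s t) y"
    using s by (intro heat_laplacian_le) auto
  also have "\<dots> \<le> real DIM('a) * (3 / s * 2 powr (real DIM('a) / 2)) * heat (2 * max s t) y"
    using s by (intro mult_left_mono mult_right_mono frac_le) auto
  finally have 1: "\<bar>heat_laplacian (max s t) y\<bar> \<le> real DIM('a) * (3 / s * 2 powr (real DIM('a) / 2)) * heat (2 * max s t) y" .
  have "heat (max s t) y \<le> (2 * max s t / max s t) powr (real DIM('a) / 2) * heat (2 * max s t) y"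
    using s by (intro heat_mono_scale) auto
  also have "2 * max s t / max s t = 2" using s by auto
  finally have 2: "\<kappa>\<^sup>2 * heat (max s t) y \<le> \<kappa>\<^sup>2 * (2 powr (real DIM('a) / 2) * heat (2 * max s t) y)"
    by (intro mult_left_mono) auto
  have 3: "0 \<le> \<kappa>\<^sup>2 * heat (max s t) y" by simp
  have "cB * heat (2 * max s t) y = real DIM('a) * (3 / s * 2 powr (real DIM('a) / 2)) * heat (2 * max s t) y
      + \<kappa>\<^sup>2 * (2 powr (real DIM('a) / 2) * heat (2 * max s t) y)"
    unfolding cB_def distrib_right by simp
  with 1 2 3 show ?thesis by linarith
qed

lemma cB_nonneg: "0 \<le> cB"
  unfolding cB_def using s by (intro add_nonneg_nonneg mult_nonneg_nonneg) auto

lemma L1_kB: "L1_kernel Q kB"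
proof (rule L1_kernel_heatI[where s=s and r="\<lambda>\<omega>. 2 * max s (snd \<omega>)" and c=cB and x=fst])
  show "\<bar>kB \<omega> z\<bar> \<le> cB * heat (2 * max s (snd \<omega>)) (z - fst \<omega>)" for \<omega> z
    unfolding kB_def by (rule \<sigma>_mult_le) (rule generator_le)
qed (use s in \<open>auto simp: kB_def\<close>)

text \<open>Here the increment of \<open>u\<close> is not offset by a gradient and costs the square
  root of the time. The decay in time of the supremum of the heat kernel compensates this, whereas
  its mass stays one; hence only a pointwise bound is claimed.\<close>

lemma bounded_kUB:
  assumes i: "i \<in> Basis"
  shows "bounded_kernel Q (kUB i)"
  unfolding bounded_kernel_def
proof (intro conjI exI allI)
  fix \<omega> :: "'a \<times> real" and z :: 'a
  let ?t = "max s (snd \<omega>)" and ?y = "z - fst \<omega>"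
  have "\<bar>kUB i \<omega> z\<bar> \<le> L * norm ?y * (cB * heat (2 * ?t) ?y)"
    unfolding kUB_def kB_def abs_mult[of "(u z - u (fst \<omega>)) \<bullet> i"]
    by (intro mult_mono u_comp_le i \<sigma>_mult_le generator_le) (auto simp: L_nonneg)
  also have "\<dots> = L * cB * (norm ?y * heat (2 * ?t) ?y)" by simp
  also have "\<dots> \<le> L * cB * (3 * sqrt (2 * ?t) * 2 powr (real DIM('a) / 2) * heat (2 * (2 * ?t)) ?y)"
    using s by (intro mult_left_mono norm_heat_le) (auto simp: L_nonneg cB_nonneg)
  also have "\<dots> = L * cB * (3 * 2 powr (real DIM('a) / 2)) * (sqrt (2 * ?t) * heat (2 * (2 * ?t)) ?y)" by simp
  \<comment> \<open>The time under the root is raised to that of the heat kernel, as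
    \<open>sqrt_heat_le\<close> involves a single time.\<close>
  also have "\<dots> \<le> L * cB * (3 * 2 powr (real DIM('a) / 2)) * (sqrt (2 * (2 * ?t)) * heat (2 * (2 * ?t)) ?y)"
    using s by (intro mult_left_mono mult_right_mono) (auto simp: L_nonneg cB_nonneg)
  also have "\<dots> \<le> L * cB * (3 * 2 powr (real DIM('a) / 2)) * (sqrt s * heat s (0 :: 'a))"
    using s by (intro mult_left_mono sqrt_heat_le) (auto simp: L_nonneg cB_nonneg)
  finally show "\<bar>kUB i \<omega> z\<bar> \<le> L * cB * (3 * 2 powr (real DIM('a) / 2)) * (sqrt s * heat s (0 :: 'a))" .
qed (auto simp: kUB_def kB_def)

text \<open>The gradient and the increment of \<open>u\<close> each contribute one distance and the
  gradient also a factor \<open>1 / t\<close>. The combination is invariant under scaling, so the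
  mass is bounded uniformly over late times.\<close>

lemma L1_kUA:
  assumes i: "i \<in> Basis"
  shows "L1_kernel Q (kUA i)"
proof (rule L1_kernel_heatI[where s=s and r="\<lambda>\<omega>. 2 * max s (snd \<omega>)" and
      c="L * (4 * 2 powr (real DIM('a) / 2))" and x=fst])
  fix \<omega> :: "'a \<times> real" and z :: 'a
  let ?t = "max s (snd \<omega>)" and ?y = "z - fst \<omega>"
  have t: "?t > 0" using s by auto
  have "\<bar>dheat i ?t ?y\<bar> \<le> norm ?y / (2 * ?t) * heat ?t ?y"
    using t Basis_le_norm[OF i, of ?y] by (simp add: dheat_def abs_mult divide_right_mono mult_right_mono)
  then have "\<bar>kUA i \<omega> z\<bar> \<le> L * norm ?y * (norm ?y / (2 * ?t) * heat ?t ?y)"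
    unfolding kUA_def kA_def abs_mult[of "(u z - u (fst \<omega>)) \<bullet> i"]
    by (intro mult_mono u_comp_le i \<sigma>_mult_le) (auto simp: L_nonneg)
  also have "\<dots> = L / (2 * ?t) * ((norm ?y)\<^sup>2 * heat ?t ?y)" by (simp add: power2_eq_square)
  also have "\<dots> \<le> L / (2 * ?t) * (8 * ?t * 2 powr (real DIM('a) / 2) * heat (2 * ?t) ?y)"
    using t by (intro mult_left_mono norm_power2_heat_le) (auto simp: L_nonneg)
  also have "\<dots> = L * (4 * 2 powr (real DIM('a) / 2)) * heat (2 * ?t) ?y"
    using t by (simp add: field_simps)
  finally show "\<bar>kUA i \<omega> z\<bar> \<le> L * (4 * 2 powr (real DIM('a) / 2)) * heat (2 * ?t) ?y" .
qed (use s in \<open>auto simp: kUA_def kA_def\<close>)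

lemma kUb_le:
  assumes i: "i \<in> Basis"
  shows "\<bar>kUb i x z\<bar> \<le> L * (3 * sqrt s * 2 powr (real DIM('a) / 2)) * ky x z"
proof -
  have "\<bar>kUb i x z\<bar> \<le> L * norm (z - x) * heat s (z - x)"
    unfolding kUb_def kb_def abs_mult[of "(u z - u x) \<bullet> i"]
    by (intro mult_mono u_comp_le i \<sigma>_mult_le) (auto simp: L_nonneg)
  also have "\<dots> = L * (norm (z - x) * heat s (z - x))" by simp
  also have "\<dots> \<le> L * (3 * sqrt s * 2 powr (real DIM('a) / 2) * heat (2 * s) (z - x))"
    by (intro mult_left_mono norm_heat_le s L_nonneg)
  finally show ?thesis by (simp add: ky_def)
qed

lemma L1_kUb:
  assumes i: "i \<in> Basis"
  shows "L1_kernel M (kUb i)"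
proof (rule L1_kernel_heatI[where s=s and r="\<lambda>\<omega>. 2 * s" and x="\<lambda>x. x" and
      c="L * (3 * sqrt s * 2 powr (real DIM('a) / 2))"])
  show "\<bar>kUb i x z\<bar> \<le> L * (3 * sqrt s * 2 powr (real DIM('a) / 2)) * heat (2 * s) (z - x)" for x z
    using kUb_le[OF i, of x z] by (simp add: ky_def)
qed (use s in \<open>auto simp: kUb_def kb_def\<close>)

text \<open>\<open>H\<close> is the late potential and \<open>P i\<close> plays the role of its
  partial derivative, defined directly by averaging the differentiated kernels. \<open>F\<close> is
  the source smeared up to time \<open>s\<close>, \<open>V i\<close> the commutator of that smearing
  with multiplication by a component of \<open>u\<close>, and \<open>Y\<close> the smearing of the
  positive measure \<open>M\<close> up to time \<open>2 * s\<close>.\<close>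

definition "H z = (\<integral>\<omega>. ka \<omega> z \<partial>Q)"
definition "P i z = (\<integral>\<omega>. kA i \<omega> z \<partial>Q)"
definition "F z = (\<integral>x. kb x z \<partial>M)"
definition "V i z = (\<integral>x. kUb i x z \<partial>M)"
definition "Y z = (\<integral>x. ky x z \<partial>M)"

section \<open>Averages over sources and times, and the equation of the late potential\<close>

lemma integrable_bounded_M:
  fixes f :: "'a \<Rightarrow> real"
  assumes [measurable]: "f \<in> borel_measurable borel" and B: "\<And>x. \<bar>f x\<bar> \<le> B"
  shows "integrable M f"
proof (rule finite_measure.integrable_const_bound[OF finite_M])
  show "AE x in M. norm (f x) \<le> B" using B by simp
qed measurable

lemma integral_Q:
  fixes f :: "'a \<Rightarrow> real \<Rightarrow> real"
  assumes [measurable]: "(\<lambda>(x, t). f x t) \<in> borel_measurable (borel \<Otimes>\<^sub>M borel)" and B: "\<And>x t. \<bar>f x t\<bar> \<le> B"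
  shows "(\<integral>\<omega>. f (fst \<omega>) (snd \<omega>) \<partial>Q) = (\<integral>x. \<integral>t. f x t \<partial>\<Theta> \<partial>M)"
proof -
  interpret M: finite_measure M by (rule finite_M)
  interpret T: finite_measure \<Theta> by (rule finite_\<Theta>)
  interpret P: pair_sigma_finite M \<Theta> ..
  interpret Q: finite_measure "M \<Otimes>\<^sub>M \<Theta>" using finite_Q by (simp add: Q_def)
  have "integrable (M \<Otimes>\<^sub>M \<Theta>) (\<lambda>\<omega>. f (fst \<omega>) (snd \<omega>))"
  proof (rule Q.integrable_const_bound)
    show "AE \<omega> in M \<Otimes>\<^sub>M \<Theta>. norm (f (fst \<omega>) (snd \<omega>)) \<le> B" using B by simp
    show "(\<lambda>\<omega>. f (fst \<omega>) (snd \<omega>)) \<in> borel_measurable (M \<Otimes>\<^sub>M \<Theta>)"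
    proof -
      have "sets (M \<Otimes>\<^sub>M \<Theta>) = sets (borel \<Otimes>\<^sub>M borel)" by (intro sets_pair_measure_cong) auto
      from measurable_cong_sets[OF this refl] assms(1) show ?thesis by (simp add: split_beta')
    qed
  qed
  from P.integral_fst'[OF this] show ?thesis by (simp add: Q_def)
qed

lemma integral_M_Q:
  fixes f :: "'a \<Rightarrow> 'a \<Rightarrow> real \<Rightarrow> real"
  assumes [measurable]: "(\<lambda>(x, y, t). f x y t) \<in> borel_measurable (borel \<Otimes>\<^sub>M borel \<Otimes>\<^sub>M borel)"
    and B: "\<And>x y t. \<bar>f x y t\<bar> \<le> B"
  shows "(\<integral>p. f (fst p) (fst (snd p)) (snd (snd p)) \<partial>(M \<Otimes>\<^sub>M Q)) = (\<integral>q. \<integral>t. f (fst q) (snd q) t \<partial>\<Theta> \<partial>(M \<Otimes>\<^sub>M M))"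
proof -
  interpret M: finite_measure M by (rule finite_M)
  interpret T: finite_measure \<Theta> by (rule finite_\<Theta>)
  interpret Q: finite_measure Q by (rule finite_Q)
  interpret MQ: pair_sigma_finite M Q ..
  interpret MM: pair_sigma_finite M M ..
  interpret FMQ: finite_measure "M \<Otimes>\<^sub>M Q" by (rule finite_measure_pair_measure[OF finite_Q finite_M])
  interpret FMM: finite_measure "M \<Otimes>\<^sub>M M" by (rule finite_measure_pair_measure[OF finite_M finite_M])
  have m3: "(\<lambda>p. f (fst p) (fst (snd p)) (snd (snd p))) \<in> borel_measurable (borel \<Otimes>\<^sub>M borel \<Otimes>\<^sub>M borel)"
    using assms(1) by (simp add: split_beta')
  have sq: "sets (M \<Otimes>\<^sub>M Q) = sets (borel \<Otimes>\<^sub>M borel \<Otimes>\<^sub>M borel)" by (intro sets_pair_measure_cong) auto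
  have smm: "sets (M \<Otimes>\<^sub>M M) = sets (borel \<Otimes>\<^sub>M borel)" by (intro sets_pair_measure_cong) auto
  have "integrable (M \<Otimes>\<^sub>M Q) (\<lambda>p. f (fst p) (fst (snd p)) (snd (snd p)))"
  proof (rule FMQ.integrable_const_bound)
    show "AE p in M \<Otimes>\<^sub>M Q. norm (f (fst p) (fst (snd p)) (snd (snd p))) \<le> B" using B by simp
    show "(\<lambda>p. f (fst p) (fst (snd p)) (snd (snd p))) \<in> borel_measurable (M \<Otimes>\<^sub>M Q)"
      using m3 measurable_cong_sets[OF sq refl] by blast
  qed
  from MQ.integral_fst'[OF this]
  have "(\<integral>p. f (fst p) (fst (snd p)) (snd (snd p)) \<partial>(M \<Otimes>\<^sub>M Q)) = (\<integral>x. \<integral>\<omega>. f x (fst \<omega>) (snd \<omega>) \<partial>Q \<partial>M)"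
    by simp
  also have "\<dots> = (\<integral>x. \<integral>y. \<integral>t. f x y t \<partial>\<Theta> \<partial>M \<partial>M)"
  proof (rule Bochner_Integration.integral_cong[OF refl])
    fix x
    have "(\<lambda>q. (x, q)) \<in> (borel :: 'a measure) \<Otimes>\<^sub>M (borel :: real measure) \<rightarrow>\<^sub>M (borel :: 'a measure) \<Otimes>\<^sub>M borel \<Otimes>\<^sub>M borel" by measurable
    from measurable_compose[OF this assms(1)]
    have "(\<lambda>(y, t). f x y t) \<in> borel_measurable (borel \<Otimes>\<^sub>M borel)" by (simp add: split_beta')
    then show "(\<integral>\<omega>. f x (fst \<omega>) (snd \<omega>) \<partial>Q) = (\<integral>y. \<integral>t. f x y t \<partial>\<Theta> \<partial>M)"
      by (rule integral_Q) (rule B)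
  qed
  also have "\<dots> = (\<integral>q. \<integral>t. f (fst q) (snd q) t \<partial>\<Theta> \<partial>(M \<Otimes>\<^sub>M M))"
  proof -
    have m: "(\<lambda>q. \<integral>t. f (fst q) (snd q) t \<partial>\<Theta>) \<in> borel_measurable (borel \<Otimes>\<^sub>M borel)"
    proof (rule T.borel_measurable_lebesgue_integral)
      have "(\<lambda>r. (fst (fst r), snd (fst r), snd r)) \<in> ((borel :: 'a measure) \<Otimes>\<^sub>M (borel :: 'a measure)) \<Otimes>\<^sub>M (borel :: real measure) \<rightarrow>\<^sub>M borel \<Otimes>\<^sub>M borel \<Otimes>\<^sub>M borel"
        by measurable
      from measurable_compose[OF this m3]
      have "(\<lambda>r. f (fst (fst r)) (snd (fst r)) (snd r)) \<in> borel_measurable ((borel \<Otimes>\<^sub>M borel) \<Otimes>\<^sub>M borel)" by simp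
      moreover have "sets ((borel \<Otimes>\<^sub>M borel) \<Otimes>\<^sub>M borel) = sets ((borel \<Otimes>\<^sub>M borel) \<Otimes>\<^sub>M \<Theta>)"
        by (intro sets_pair_measure_cong) auto
      ultimately show "(\<lambda>(q, t). f (fst q) (snd q) t) \<in> borel_measurable ((borel \<Otimes>\<^sub>M borel) \<Otimes>\<^sub>M \<Theta>)"
        using measurable_cong_sets[OF _ refl] by (simp add: split_beta')
    qed
    have "integrable (M \<Otimes>\<^sub>M M) (\<lambda>q. \<integral>t. f (fst q) (snd q) t \<partial>\<Theta>)"
    proof (rule FMM.integrable_const_bound)
      show "AE q in M \<Otimes>\<^sub>M M. norm (\<integral>t. f (fst q) (snd q) t \<partial>\<Theta>) \<le> measure \<Theta> (space \<Theta>) * B"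
      proof (rule AE_I2)
        fix q
        have "B \<ge> 0" using order.trans[OF abs_ge_zero B] .
        then have "norm (\<integral>t. f (fst q) (snd q) t \<partial>\<Theta>) \<le> (\<integral>t. B \<partial>\<Theta>)"
          using B by (intro order.trans[OF integral_norm_bound] Bochner_Integration.integral_mono') auto
        then show "norm (\<integral>t. f (fst q) (snd q) t \<partial>\<Theta>) \<le> measure \<Theta> (space \<Theta>) * B" by simp
      qed
      show "(\<lambda>q. \<integral>t. f (fst q) (snd q) t \<partial>\<Theta>) \<in> borel_measurable (M \<Otimes>\<^sub>M M)"
        using m measurable_cong_sets[OF smm refl] by blast
    qed
    from MM.integral_fst'[OF this] show ?thesis by simp
  qed
  finally show ?thesis .
qed

text \<open>Damping accumulated up to the cutting time; it comes from the boundary term of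
  \<open>integral_damped_heat_generator\<close>.\<close>

definition "e = exp (- \<kappa>\<^sup>2 * s)"

lemma e_pos: "0 < e" and e_le: "e \<le> 1"
  using s by (auto simp: e_def)

lemma translate_max:
  fixes g :: "real \<Rightarrow> real"
  assumes [measurable]: "g \<in> borel_measurable borel"
  shows "e * (\<integral>t. g (s + max s t) \<partial>\<Theta>) = (\<integral>t. g t \<partial>damped \<kappa> {2 * s..})"
proof -
  have "(\<integral>t. g (s + max s t) \<partial>\<Theta>) = (\<integral>t. g (t + s) \<partial>\<Theta>)"
  proof (rule integral_cong_AE)
    show "AE t in \<Theta>. g (s + max s t) = g (t + s)"
      unfolding \<Theta>_def using AE_damped[of "{s..}" \<kappa>, simplified]
      by eventually_elim (simp add: add.commute)
  qed measurable
  then show ?thesis using damped_translate[OF assms, of \<kappa> s] by (simp add: \<Theta>_def e_def)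
qed

text \<open>The elliptic equation of the late potential: \<Delta> - \<open>\<kappa>\<^sup>2\<close>
  applied to \<open>H\<close> gives minus \<open>e\<close> times \<open>F\<close>, read off kernel
  by kernel from the time integral.\<close>

lemma integral_kB: "(\<integral>\<omega>. kB \<omega> z \<partial>Q) = - e * F z"
proof -
  define f where "f = (\<lambda>x t. \<sigma> x * (heat_laplacian (max s t) (z - x) - \<kappa>\<^sup>2 * heat (max s t) (z - x)))"
  obtain B where B: "\<And>\<omega> z. \<bar>kB \<omega> z\<bar> \<le> B" using L1_kB by (auto simp: L1_kernel_def bounded_kernel_def)
  have "(\<integral>\<omega>. f (fst \<omega>) (snd \<omega>) \<partial>Q) = (\<integral>x. \<integral>t. f x t \<partial>\<Theta> \<partial>M)"
  proof (rule integral_Q)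
    show "(\<lambda>(x, t). f x t) \<in> borel_measurable (borel \<Otimes>\<^sub>M borel)" unfolding f_def by measurable
    show "\<bar>f x t\<bar> \<le> B" for x t using B[of "(x, t)" z] by (simp add: kB_def f_def)
  qed
  also have "\<dots> = (\<integral>x. - e * kb x z \<partial>M)"
    using integral_damped_heat_generator[OF \<kappa> s, where 'a='a]
    by (intro Bochner_Integration.integral_cong refl) (simp add: f_def \<Theta>_def kb_def e_def)
  finally show ?thesis by (simp add: f_def kB_def F_def)
qed

text \<open>The increment of \<open>u\<close> does not depend on time, so it passes through the time
  integral of the preceding equation.\<close>

lemma integral_kUB:
  assumes i: "i \<in> Basis"
  shows "(\<integral>\<omega>. kUB i \<omega> z \<partial>Q) = - e * V i z"
proof -
  define f where "f = (\<lambda>x t. ((u z - u x) \<bullet> i) * (\<sigma> x * (heat_laplacian (max s t) (z - x) - \<kappa>\<^sup>2 * heat (max s t) (z - x))))"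
  obtain B where B: "\<And>\<omega> z. \<bar>kUB i \<omega> z\<bar> \<le> B" using bounded_kUB[OF i] by (auto simp: bounded_kernel_def)
  have "(\<integral>\<omega>. f (fst \<omega>) (snd \<omega>) \<partial>Q) = (\<integral>x. \<integral>t. f x t \<partial>\<Theta> \<partial>M)"
  proof (rule integral_Q)
    show "(\<lambda>(x, t). f x t) \<in> borel_measurable (borel \<Otimes>\<^sub>M borel)" unfolding f_def by measurable
    show "\<bar>f x t\<bar> \<le> B" for x t using B[of "(x, t)" z] by (simp add: kUB_def kB_def f_def)
  qed
  also have "\<dots> = (\<integral>x. - e * kUb i x z \<partial>M)"
    using integral_damped_heat_generator[OF \<kappa> s, where 'a='a]
    by (intro Bochner_Integration.integral_cong refl) (simp add: f_def \<Theta>_def kUb_def kb_def e_def)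
  finally show ?thesis by (simp add: f_def kUB_def kB_def V_def)
qed

lemma L1_kernel_bounded: "L1_kernel R g \<Longrightarrow> bounded_kernel R g"
  by (simp add: L1_kernel_def)

section \<open>The energy of the late potential\<close>

lemma fubini_kA_kA:
  "i \<in> Basis \<Longrightarrow> j \<in> Basis \<Longrightarrow>
    fubini_pair (Q \<Otimes>\<^sub>M Q) (\<lambda>p z. kA i (fst p) z * kA j (snd p) z) (\<lambda>z. P i z * P j z)"
  unfolding P_def by (intro fubini_pair_kernel finite_Q L1_kernel_bounded L1_kA)

lemma fubini_ka_ka: "fubini_pair (Q \<Otimes>\<^sub>M Q) (\<lambda>p z. ka (fst p) z * ka (snd p) z) (\<lambda>z. H z * H z)"
  unfolding H_def by (intro fubini_pair_kernel finite_Q L1_kernel_bounded L1_ka)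

text \<open>Contribution of a pair of kernels to the energy density of \<open>H\<close>; averaged
  over pairs it gives \<open>EH\<close>, the squared gradient plus \<open>\<kappa>\<^sup>2\<close>
  times the squared potential.\<close>

definition "EP p = (\<lambda>z. (\<Sum>k\<in>Basis. kA k (fst p) z * kA k (snd p) z) + \<kappa>\<^sup>2 * (ka (fst p) z * ka (snd p) z))"
definition "EH = (\<lambda>z. (\<Sum>k\<in>Basis. P k z * P k z) + \<kappa>\<^sup>2 * (H z * H z))"

lemma fubini_E: "fubini_pair (Q \<Otimes>\<^sub>M Q) EP EH"
  unfolding EP_def EH_def
  by (intro fubini_pair_add fubini_pair_sum fubini_pair_cmult fubini_kA_kA fubini_ka_ka) auto

lemma integral_EP: "(\<integral>z. EP p z \<partial>lborel) = - (\<integral>z. ka (fst p) z * kB (snd p) z \<partial>lborel)"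
proof -
  let ?t = "max s (snd (fst p))" and ?r = "max s (snd (snd p))" and ?x = "fst (fst p)" and ?y = "fst (snd p)"
  have "(\<integral>z. EP p z \<partial>lborel) = (\<integral>z. \<sigma> ?x * \<sigma> ?y * ((\<Sum>k\<in>Basis. dheat k ?t (z - ?x) * dheat k ?r (z - ?y))
      + \<kappa>\<^sup>2 * (heat ?t (z - ?x) * heat ?r (z - ?y))) \<partial>lborel)"
    by (intro Bochner_Integration.integral_cong refl)
      (simp add: EP_def kA_def ka_def sum_distrib_left distrib_left mult_ac)
  also have "\<dots> = - (\<integral>z. \<sigma> ?x * \<sigma> ?y * (heat ?t (z - ?x) * (heat_laplacian ?r (z - ?y) - \<kappa>\<^sup>2 * heat ?r (z - ?y))) \<partial>lborel)"
    unfolding integral_mult_right_zero using s by (subst integral_dheat_dheat) auto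
  also have "\<dots> = - (\<integral>z. ka (fst p) z * kB (snd p) z \<partial>lborel)"
    by (intro arg_cong[where f=uminus] Bochner_Integration.integral_cong refl) (simp add: ka_def kB_def mult_ac)
  finally show ?thesis .
qed

lemma EH_nonneg: "0 \<le> EH z"
  by (auto simp: EH_def intro!: add_nonneg_nonneg sum_nonneg)

lemma integrable_EH: "integrable lborel EH"
  by (rule fubini_pairD[OF fubini_E])

lemma fubini_ka_kB: "fubini_pair (Q \<Otimes>\<^sub>M Q) (\<lambda>p z. ka (fst p) z * kB (snd p) z) (\<lambda>z. H z * (- e * F z))"
  unfolding H_def integral_kB[symmetric]
  by (intro fubini_pair_kernel finite_Q L1_kernel_bounded L1_ka L1_kB)

lemma fubini_kb_ka: "fubini_pair (M \<Otimes>\<^sub>M Q) (\<lambda>p z. kb (fst p) z * ka (snd p) z) (\<lambda>z. F z * H z)"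
  unfolding H_def F_def by (intro fubini_pair_kernel finite_M finite_Q L1_kernel_bounded L1_kb L1_ka)

text \<open>Green's identity and the equation of \<open>H\<close> reduce the energy to
  \<open>e\<close> times the pairing of \<open>F\<close> with \<open>H\<close>. By the semigroup law
  that pairing has kernels at times \<open>s + t\<close>, and the shift of time turns them into the
  late kernel from \<open>2 * s\<close> on. Since the left side is a sum of squares, this also shows
  that the late kernel is positive definite.\<close>

lemma energy_identity:
  "(\<integral>z. EH z \<partial>lborel) = (\<integral>q. \<sigma> (fst q) * \<sigma> (snd q) * far \<kappa> (2 * s) (fst q - snd q) \<partial>(M \<Otimes>\<^sub>M M))"
proof -
  note [simp] = has_bochner_integral_iff
  have "(\<integral>z. EH z \<partial>lborel) = (\<integral>p. (\<integral>z. EP p z \<partial>lborel) \<partial>(Q \<Otimes>\<^sub>M Q))"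
    using fubini_pairD(2)[OF fubini_E] by simp
  also have "\<dots> = - (\<integral>p. (\<integral>z. ka (fst p) z * kB (snd p) z \<partial>lborel) \<partial>(Q \<Otimes>\<^sub>M Q))"
    by (simp add: integral_EP)
  also have "\<dots> = - (\<integral>z. H z * (- e * F z) \<partial>lborel)"
    using fubini_pairD(2)[OF fubini_ka_kB] by simp
  also have "\<dots> = e * (\<integral>z. F z * H z \<partial>lborel)"
    by (simp add: mult.commute mult.left_commute flip: integral_mult_right_zero)
  also have "(\<integral>z. F z * H z \<partial>lborel) = (\<integral>p. (\<integral>z. kb (fst p) z * ka (snd p) z \<partial>lborel) \<partial>(M \<Otimes>\<^sub>M Q))"
    using fubini_pairD(2)[OF fubini_kb_ka] by simp
  also have "\<dots> = (\<integral>p. \<sigma> (fst p) * \<sigma> (fst (snd p)) * heat (s + max s (snd (snd p))) (fst p - fst (snd p)) \<partial>(M \<Otimes>\<^sub>M Q))"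
  proof (intro Bochner_Integration.integral_cong refl)
    fix p
    have "(\<integral>z. kb (fst p) z * ka (snd p) z \<partial>lborel)
      = (\<integral>z. \<sigma> (fst p) * \<sigma> (fst (snd p)) * (heat s (z - fst p) * heat (max s (snd (snd p))) (z - fst (snd p))) \<partial>lborel)"
      by (intro Bochner_Integration.integral_cong refl) (simp add: kb_def ka_def)
    also have "\<dots> = \<sigma> (fst p) * \<sigma> (fst (snd p)) * heat (s + max s (snd (snd p))) (fst p - fst (snd p))"
      unfolding integral_mult_right_zero using s by (subst integral_heat_mult) auto
    finally show "(\<integral>z. kb (fst p) z * ka (snd p) z \<partial>lborel)
      = \<sigma> (fst p) * \<sigma> (fst (snd p)) * heat (s + max s (snd (snd p))) (fst p - fst (snd p))" .
  qed
  also have "\<dots> = (\<integral>q. \<integral>t. \<sigma> (fst q) * \<sigma> (snd q) * heat (s + max s t) (fst q - snd q) \<partial>\<Theta> \<partial>(M \<Otimes>\<^sub>M M))"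
  proof (rule integral_M_Q)
    show "\<bar>\<sigma> x * \<sigma> y * heat (s + max s t) (x - y)\<bar> \<le> heat s (0 :: 'a)" for x y t
      unfolding mult.assoc using s by (intro \<sigma>_mult_le) (simp add: heat_le_heat_zero)
  qed measurable
  also have "e * \<dots> = (\<integral>q. \<sigma> (fst q) * \<sigma> (snd q) * far \<kappa> (2 * s) (fst q - snd q) \<partial>(M \<Otimes>\<^sub>M M))"
    unfolding integral_mult_right_zero[symmetric]
  proof (intro Bochner_Integration.integral_cong refl)
    fix q
    have "e * (\<integral>t. \<sigma> (fst q) * \<sigma> (snd q) * heat (s + max s t) (fst q - snd q) \<partial>\<Theta>)
        = \<sigma> (fst q) * \<sigma> (snd q) * (e * (\<integral>t. heat (s + max s t) (fst q - snd q) \<partial>\<Theta>))"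
      by simp
    also have "e * (\<integral>t. heat (s + max s t) (fst q - snd q) \<partial>\<Theta>) = far \<kappa> (2 * s) (fst q - snd q)"
      unfolding far_def by (rule translate_max) measurable
    finally show "(\<integral>t. e * (\<sigma> (fst q) * \<sigma> (snd q) * heat (s + max s t) (fst q - snd q)) \<partial>\<Theta>)
        = \<sigma> (fst q) * \<sigma> (snd q) * far \<kappa> (2 * s) (fst q - snd q)" by simp
  qed
  finally show ?thesis .
qed

text \<open>The pairing of \<open>TH\<close> with difference quotients of \<open>u\<close> is at most a constant times the energy, and its limit,
  computed on pairs of heat kernels by integration by parts, produces the commutator.\<close>

definition "kT i j p = (\<lambda>z. (kA i (fst p) z * kA j (snd p) z + kA j (fst p) z * kA i (snd p) z)
     + (if i = j then -1 else 0) * EP p z)"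
definition "TH i j = (\<lambda>z. (P i z * P j z + P j z * P i z) + (if i = j then -1 else 0) * EH z)"

lemma fubini_T: "i \<in> Basis \<Longrightarrow> j \<in> Basis \<Longrightarrow> fubini_pair (Q \<Otimes>\<^sub>M Q) (kT i j) (TH i j)"
  unfolding kT_def TH_def
  by (intro fubini_pair_add fubini_pair_cmult fubini_kA_kA fubini_E)

lemma abs_P_mult_le:
  assumes "i \<in> Basis" "j \<in> Basis"
  shows "\<bar>P i z * P j z\<bar> \<le> EH z"
proof -
  have le: "P k z * P k z \<le> EH z" if "k \<in> Basis" for k
  proof -
    have "P k z * P k z \<le> (\<Sum>k\<in>Basis. P k z * P k z)" using that by (intro member_le_sum) auto
    then show ?thesis by (simp add: EH_def add_increasing2)
  qed
  have "2 * \<bar>P i z * P j z\<bar> \<le> P i z * P i z + P j z * P j z"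
    using sum_squares_bound[of "\<bar>P i z\<bar>" "\<bar>P j z\<bar>"] by (simp add: abs_mult power2_eq_square)
  then show ?thesis using le[OF assms(1)] le[OF assms(2)] by linarith
qed

lemma abs_TH_le: "i \<in> Basis \<Longrightarrow> j \<in> Basis \<Longrightarrow> \<bar>TH i j z\<bar> \<le> 3 * EH z"
  using abs_P_mult_le[of i j z] abs_P_mult_le[of j i z] EH_nonneg[of z] unfolding TH_def
  by (auto simp: abs_le_iff)

section \<open>The limit of the stress paired with difference quotients\<close>

definition "h n = 1 / real (Suc n)"
definition "quot n i j z = ((u (z - h n *\<^sub>R j) - u z) \<bullet> i) / h n"

lemma h_pos: "0 < h n" by (simp add: h_def)

lemma quot_measurable [measurable]: "quot n i j \<in> borel_measurable borel"
  unfolding quot_def by measurable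

lemma quot_le:
  assumes "i \<in> Basis" "j \<in> Basis"
  shows "\<bar>quot n i j z\<bar> \<le> L"
proof -
  have "\<bar>(u (z - h n *\<^sub>R j) - u z) \<bullet> i\<bar> \<le> L * norm ((z - h n *\<^sub>R j) - z)"
    by (rule u_comp_le[OF assms(1)])
  also have "\<dots> = L * h n" using assms(2) h_pos[of n] by simp
  finally show ?thesis using h_pos[of n] by (simp add: quot_def abs_mult divide_le_eq)
qed

text \<open>The divergence of the stress of the pair \<open>p\<close>, tested with \<open>u\<close>
  minus its value at the second source point. Placing this increment on the second kernel in both
  halves makes each half a product of an integrable and a bounded kernel.\<close>

definition "W p = (\<Sum>i\<in>Basis. (\<integral>z. kA i (fst p) z * kUB i (snd p) z \<partial>lborel)
    + (\<integral>z. kB (fst p) z * kUA i (snd p) z \<partial>lborel))"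

lemma fubini_kA_kUB: "i \<in> Basis \<Longrightarrow>
    fubini_pair (Q \<Otimes>\<^sub>M Q) (\<lambda>p z. kA i (fst p) z * kUB i (snd p) z) (\<lambda>z. P i z * (- e * V i z))"
  unfolding P_def integral_kUB[symmetric]
  by (intro fubini_pair_kernel finite_Q L1_kA bounded_kUB)

definition "Z i z = (\<integral>\<omega>. kUA i \<omega> z \<partial>Q)"

lemma fubini_kB_kUA: "i \<in> Basis \<Longrightarrow>
    fubini_pair (Q \<Otimes>\<^sub>M Q) (\<lambda>p z. kB (fst p) z * kUA i (snd p) z) (\<lambda>z. (- e * F z) * Z i z)"
  unfolding Z_def integral_kB[symmetric]
  by (intro fubini_pair_kernel finite_Q L1_kB L1_kUA L1_kernel_bounded)

lemma has_bochner_integral_W: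
  "has_bochner_integral (Q \<Otimes>\<^sub>M Q) W
    (\<Sum>i\<in>Basis. (\<integral>z. P i z * (- e * V i z) \<partial>lborel) + (\<integral>z. (- e * F z) * Z i z \<partial>lborel))"
  unfolding W_def
  by (intro has_bochner_integral_sum has_bochner_integral_add fubini_pairD(2) fubini_kA_kUB fubini_kB_kUA)

lemma stress_quotient_limit:
  "(\<lambda>n. \<Sum>i\<in>Basis. \<Sum>j\<in>Basis. \<integral>z. quot n i j z * kT i j p z \<partial>lborel) \<longlonglongrightarrow> W p"
proof -
  let ?t = "max s (snd (fst p))" and ?r = "max s (snd (snd p))" and ?x = "fst (fst p)" and ?y = "fst (snd p)"
  let ?c = "\<sigma> ?x * \<sigma> ?y"
  \<comment> \<open>A constant may be subtracted from \<open>u\<close>; this choice keeps both halves of the limit absolutely integrable.\<close>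
  define v where "v = (\<lambda>i z. (u z - u ?y) \<bullet> i)"
  have t: "0 < ?t" "0 < ?r" using s by auto
  have v: "L-lipschitz_on UNIV (v i)" if "i \<in> Basis" for i
  proof (rule lipschitz_onI)
    show "dist (v i a) (v i b) \<le> L * dist a b" for a b
      using u_comp_le[OF that, of a b] by (simp add: v_def dist_norm inner_diff_left)
  qed (rule L_nonneg)
  have h: "h \<longlonglongrightarrow> 0" "\<And>n. h n \<noteq> 0" "\<And>n. \<bar>h n\<bar> \<le> 1"
    using LIMSEQ_inverse_real_of_nat by (auto simp: h_def[abs_def] inverse_eq_divide)
  define S where "S = stress \<kappa> (\<lambda>k z. dheat k ?t (z - ?x)) (\<lambda>k z. dheat k ?r (z - ?y))
    (\<lambda>z. heat ?t (z - ?x)) (\<lambda>z. heat ?r (z - ?y))"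
  have kT: "kT i j p z = ?c * S i j z" for i j z
    by (simp add: kT_def EP_def S_def stress_def kA_def ka_def sum_distrib_left algebra_simps)
  have quot: "quot n i j z = (v i (z - h n *\<^sub>R j) - v i z) / h n" for n i j z
    by (simp add: quot_def v_def inner_diff_left)
  have lim: "(\<lambda>n. ?c * (\<Sum>i\<in>Basis. \<Sum>j\<in>Basis. \<integral>z. (v i (z - h n *\<^sub>R j) - v i z) / h n * S i j z \<partial>lborel))
    \<longlonglongrightarrow> ?c * (\<Sum>i\<in>Basis. \<integral>z. v i z *
      (dheat i ?t (z - ?x) * (heat_laplacian ?r (z - ?y) - \<kappa>\<^sup>2 * heat ?r (z - ?y))
      + dheat i ?r (z - ?y) * (heat_laplacian ?t (z - ?x) - \<kappa>\<^sup>2 * heat ?t (z - ?x))) \<partial>lborel)"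
    unfolding S_def by (intro tendsto_mult_left stress_difference_quotient_limit[OF t v h])
  have lhs: "?c * (\<Sum>i\<in>Basis. \<Sum>j\<in>Basis. \<integral>z. (v i (z - h n *\<^sub>R j) - v i z) / h n * S i j z \<partial>lborel)
      = (\<Sum>i\<in>Basis. \<Sum>j\<in>Basis. \<integral>z. quot n i j z * kT i j p z \<partial>lborel)" for n
    unfolding sum_distrib_left integral_mult_right_zero[symmetric] kT quot
    by (intro sum.cong Bochner_Integration.integral_cong refl) (simp only: mult_ac)
  have rhs: "?c * (\<Sum>i\<in>Basis. \<integral>z. v i z *
      (dheat i ?t (z - ?x) * (heat_laplacian ?r (z - ?y) - \<kappa>\<^sup>2 * heat ?r (z - ?y))
      + dheat i ?r (z - ?y) * (heat_laplacian ?t (z - ?x) - \<kappa>\<^sup>2 * heat ?t (z - ?x))) \<partial>lborel) = W p"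
    unfolding sum_distrib_left integral_mult_right_zero[symmetric] W_def
  proof (rule sum.cong[OF refl])
    fix i assume i: "i \<in> (Basis :: 'a set)"
    have "(\<integral>z. kA i (fst p) z * kUB i (snd p) z \<partial>lborel) + (\<integral>z. kB (fst p) z * kUA i (snd p) z \<partial>lborel)
        = (\<integral>z. kA i (fst p) z * kUB i (snd p) z + kB (fst p) z * kUA i (snd p) z \<partial>lborel)"
      using fubini_pairD(3)[OF fubini_kA_kUB[OF i]] fubini_pairD(3)[OF fubini_kB_kUA[OF i]] by simp
    also have "\<dots> = (\<integral>z. ?c * (v i z *
      (dheat i ?t (z - ?x) * (heat_laplacian ?r (z - ?y) - \<kappa>\<^sup>2 * heat ?r (z - ?y))
      + dheat i ?r (z - ?y) * (heat_laplacian ?t (z - ?x) - \<kappa>\<^sup>2 * heat ?t (z - ?x)))) \<partial>lborel)"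
      by (intro Bochner_Integration.integral_cong refl)
        (simp only: kA_def kB_def kUA_def kUB_def v_def distrib_left mult_ac)
    finally show "(\<integral>z. ?c * (v i z *
      (dheat i ?t (z - ?x) * (heat_laplacian ?r (z - ?y) - \<kappa>\<^sup>2 * heat ?r (z - ?y))
      + dheat i ?r (z - ?y) * (heat_laplacian ?t (z - ?x) - \<kappa>\<^sup>2 * heat ?t (z - ?x)))) \<partial>lborel)
      = (\<integral>z. kA i (fst p) z * kUB i (snd p) z \<partial>lborel) + (\<integral>z. kB (fst p) z * kUA i (snd p) z \<partial>lborel)"
      by simp
  qed
  show ?thesis using lim unfolding lhs rhs .
qed

text \<open>For a fixed step, averaging over pairs comes first: it assembles \<open>TH\<close>,
  which the energy density dominates. Only then does the step tend to zero, by dominated convergence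
  over the pairs, where the limit is known even though the quotients of \<open>u\<close> need not
  converge. The constant is 3 from \<open>abs_TH_le\<close> times the number of index pairs.\<close>

lemma abs_integral_W_le:
  "\<bar>\<integral>p. W p \<partial>(Q \<Otimes>\<^sub>M Q)\<bar> \<le> 3 * (real DIM('a))\<^sup>2 * L * (\<integral>z. EH z \<partial>lborel)"
proof -
  interpret QQ: finite_measure "Q \<Otimes>\<^sub>M Q" by (rule finite_measure_pair_measure[OF finite_Q finite_Q])
  have "\<exists>C\<ge>0. fubini_bound (Q \<Otimes>\<^sub>M Q) (kT i j) (TH i j) C" if "i \<in> Basis" "j \<in> Basis" for i j
    using fubini_T[OF that] by (simp add: fubini_pair_def)
  then obtain C where C: "\<And>i j. i \<in> Basis \<Longrightarrow> j \<in> Basis \<Longrightarrow> fubini_bound (Q \<Otimes>\<^sub>M Q) (kT i j) (TH i j) (C i j)"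
    by metis
  note fb = fubini_boundD[OF C quot_measurable quot_le]
  define D where "D = (\<lambda>n p. \<Sum>i\<in>Basis. \<Sum>j\<in>Basis. \<integral>z. quot n i j z * kT i j p z \<partial>lborel)"
  have D: "has_bochner_integral (Q \<Otimes>\<^sub>M Q) (D n) (\<Sum>i\<in>Basis. \<Sum>j\<in>Basis. \<integral>z. quot n i j z * TH i j z \<partial>lborel)" for n
    unfolding D_def by (intro has_bochner_integral_sum fb(2))
  have D_le: "\<bar>D n p\<bar> \<le> (\<Sum>i\<in>Basis. \<Sum>j\<in>Basis. L * C i j)" for n p
    unfolding D_def by (intro order.trans[OF sum_abs] sum_mono fb(4))
  have lim: "(\<lambda>n. \<integral>p. D n p \<partial>(Q \<Otimes>\<^sub>M Q)) \<longlonglongrightarrow> (\<integral>p. W p \<partial>(Q \<Otimes>\<^sub>M Q))"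
  proof (rule integral_dominated_convergence)
    show "W \<in> borel_measurable (Q \<Otimes>\<^sub>M Q)"
      using has_bochner_integral_W by (auto simp: has_bochner_integral_iff)
    show "D n \<in> borel_measurable (Q \<Otimes>\<^sub>M Q)" for n
      using D by (auto simp: has_bochner_integral_iff)
    show "integrable (Q \<Otimes>\<^sub>M Q) (\<lambda>p. \<Sum>i\<in>(Basis::'a set). \<Sum>j\<in>(Basis::'a set). L * C i j)" by simp
    show "AE p in Q \<Otimes>\<^sub>M Q. (\<lambda>n. D n p) \<longlonglongrightarrow> W p"
      unfolding D_def by (intro AE_I2 stress_quotient_limit)
    show "AE p in Q \<Otimes>\<^sub>M Q. norm (D n p) \<le> (\<Sum>i\<in>Basis. \<Sum>j\<in>Basis. L * C i j)" for n
      using D_le by simp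
  qed
  have le: "\<bar>\<integral>p. D n p \<partial>(Q \<Otimes>\<^sub>M Q)\<bar> \<le> 3 * (real DIM('a))\<^sup>2 * L * (\<integral>z. EH z \<partial>lborel)" for n
  proof -
    have "\<bar>\<integral>p. D n p \<partial>(Q \<Otimes>\<^sub>M Q)\<bar> = \<bar>\<Sum>i\<in>Basis. \<Sum>j\<in>Basis. \<integral>z. quot n i j z * TH i j z \<partial>lborel\<bar>"
      using D[of n] by (simp add: has_bochner_integral_iff)
    also have "\<dots> \<le> (\<Sum>i\<in>(Basis::'a set). \<Sum>j\<in>(Basis::'a set). L * (3 * (\<integral>z. EH z \<partial>lborel)))"
    proof (intro order.trans[OF sum_abs] sum_mono)
      fix i j assume ij: "i \<in> (Basis::'a set)" "j \<in> (Basis::'a set)"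
      have "\<bar>\<integral>z. quot n i j z * TH i j z \<partial>lborel\<bar> \<le> (\<integral>z. \<bar>quot n i j z * TH i j z\<bar> \<partial>lborel)"
        by (rule integral_abs_bound)
      also have "\<dots> \<le> (\<integral>z. L * (3 * EH z) \<partial>lborel)"
      proof (rule integral_mono)
        show "integrable lborel (\<lambda>z. \<bar>quot n i j z * TH i j z\<bar>)"
          by (intro integrable_abs fb(1) ij)
        show "integrable lborel (\<lambda>z. L * (3 * EH z))" using integrable_EH by simp
        show "\<bar>quot n i j z * TH i j z\<bar> \<le> L * (3 * EH z)" for z
          unfolding abs_mult using ij by (intro mult_mono quot_le abs_TH_le) (auto simp: L_nonneg)
      qed
      finally show "\<bar>\<integral>z. quot n i j z * TH i j z \<partial>lborel\<bar> \<le> L * (3 * (\<integral>z. EH z \<partial>lborel))" by simp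
    qed
    also have "\<dots> = 3 * (real DIM('a))\<^sup>2 * L * (\<integral>z. EH z \<partial>lborel)" by (simp add: power2_eq_square)
    finally show ?thesis .
  qed
  show ?thesis
    by (rule tendsto_upperbound[OF tendsto_rabs[OF lim]]) (use le in auto)
qed

section \<open>From the stress to the commutator\<close>

lemma fubini_kb_kUA: "i \<in> Basis \<Longrightarrow>
    fubini_pair (M \<Otimes>\<^sub>M Q) (\<lambda>p z. kb (fst p) z * kUA i (snd p) z) (\<lambda>z. F z * Z i z)"
  unfolding F_def Z_def
  by (intro fubini_pair_kernel finite_M finite_Q L1_kb L1_kUA L1_kernel_bounded)

lemma fubini_kUb_kA: "i \<in> Basis \<Longrightarrow>
    fubini_pair (M \<Otimes>\<^sub>M Q) (\<lambda>p z. kUb i (fst p) z * kA i (snd p) z) (\<lambda>z. V i z * P i z)"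
  unfolding V_def P_def
  by (intro fubini_pair_kernel finite_M finite_Q L1_kUb L1_kA L1_kernel_bounded)

lemma fubini_ky_ky: "fubini_pair (M \<Otimes>\<^sub>M M) (\<lambda>p z. ky (fst p) z * ky (snd p) z) (\<lambda>z. Y z * Y z)"
  unfolding Y_def
  by (intro fubini_pair_kernel finite_M L1_ky L1_kernel_bounded)

text \<open>The increment of \<open>u\<close> from the second source to \<open>z\<close> is split at
  the first source. One part moves over to the smeared source and makes it \<open>kUb\<close>; the
  other no longer depends on \<open>z\<close>, so the semigroup law with one derivative evaluates
  the rest.\<close>

lemma integral_kb_kUA:
  assumes i: "i \<in> Basis"
  shows "(\<integral>z. kb (fst p) z * kUA i (snd p) z \<partial>lborel)
    = (\<integral>z. kUb i (fst p) z * kA i (snd p) z \<partial>lborel)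
      + \<sigma> (fst p) * \<sigma> (fst (snd p)) * (((u (fst p) - u (fst (snd p))) \<bullet> i)
          * dheat i (max s (snd (snd p)) + s) (fst p - fst (snd p)))"
proof -
  let ?x = "fst p" and ?y = "fst (snd p)" and ?t = "max s (snd (snd p))"
  let ?c = "\<sigma> ?x * \<sigma> ?y * ((u ?x - u ?y) \<bullet> i)"
  have t: "0 < ?t" using s by auto
  have int: "integrable lborel (\<lambda>z. dheat i ?t (z - ?y) * heat s (z - ?x))"
    by (rule integrable_gaussian_decay[OF gaussian_decay_mult]) (auto intro: gaussian_decay_dheat gaussian_decay_heat t s i)
  have "(\<integral>z. kb ?x z * kUA i (snd p) z \<partial>lborel)
      = (\<integral>z. kUb i ?x z * kA i (snd p) z + ?c * (dheat i ?t (z - ?y) * heat s (z - ?x)) \<partial>lborel)"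
    by (intro Bochner_Integration.integral_cong refl)
      (simp add: kb_def kUA_def kUb_def kA_def inner_diff_left algebra_simps)
  also have "\<dots> = (\<integral>z. kUb i ?x z * kA i (snd p) z \<partial>lborel) + ?c * dheat i (?t + s) (?x - ?y)"
    using fubini_pairD(3)[OF fubini_kUb_kA[OF i], of p] int integral_dheat_mult_heat[OF t s i, of ?y ?x] by simp
  finally show ?thesis by (simp add: mult.assoc)
qed

lemma sum_inner_dheat:
  "(\<Sum>i\<in>Basis. (v \<bullet> i) * dheat i t y) = - ((v \<bullet> y) * (heat t y / (2 * t)))" for v y :: 'a
proof -
  have "(\<Sum>i\<in>Basis. (v \<bullet> i) * dheat i t y) = (\<Sum>i\<in>Basis. (v \<bullet> i) * (y \<bullet> i)) * (- (heat t y / (2 * t)))"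
    unfolding sum_distrib_right by (simp add: dheat_def mult.assoc)
  then show ?thesis by (simp add: euclidean_inner[of v y])
qed

lemma inner_heat_le:
  assumes t: "0 < t"
  shows "\<bar>((u x - u y) \<bullet> (x - y)) * (heat t (x - y) / (2 * t))\<bar> \<le> L * (4 * 2 powr (real DIM('a) / 2)) * heat (2 * t) (x - y)"
proof -
  have "\<bar>(u x - u y) \<bullet> (x - y)\<bar> \<le> L * norm (x - y) * norm (x - y)"
    by (rule order.trans[OF Cauchy_Schwarz_ineq2]) (intro mult_right_mono u_diff_le norm_ge_zero)
  then have "\<bar>((u x - u y) \<bullet> (x - y)) * (heat t (x - y) / (2 * t))\<bar> \<le> L * norm (x - y) * norm (x - y) * (heat t (x - y) / (2 * t))"
    unfolding abs_mult using t by (intro mult_mono) auto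
  also have "\<dots> = L / (2 * t) * ((norm (x - y))\<^sup>2 * heat t (x - y))" by (simp add: power2_eq_square)
  also have "\<dots> \<le> L / (2 * t) * (8 * t * 2 powr (real DIM('a) / 2) * heat (2 * t) (x - y))"
    using t by (intro mult_left_mono norm_power2_heat_le) (auto simp: L_nonneg)
  also have "\<dots> = L * (4 * 2 powr (real DIM('a) / 2)) * heat (2 * t) (x - y)"
    using t by (simp add: field_simps)
  finally show ?thesis .
qed

text \<open>The late part of the commutator with opposite sign: \<open>far_slope\<close> enters the
  gradient of the late kernel with a minus.\<close>

definition "interaction = (\<integral>q. \<sigma> (fst q) * \<sigma> (snd q) *
  (((u (fst q) - u (snd q)) \<bullet> (fst q - snd q)) * far_slope \<kappa> (2 * s) (fst q - snd q)) \<partial>(M \<Otimes>\<^sub>M M))"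

text \<open>The splitting of \<open>integral_kb_kUA\<close>, summed over coordinates and averaged
  over sources and times. The gradients at times \<open>s + t\<close> combine, by the shift of time,
  into the slope of the late kernel from \<open>2 * s\<close> on.\<close>

lemma sum_integral_F_Z:
  "e * (\<Sum>i\<in>Basis. \<integral>z. F z * Z i z \<partial>lborel) = e * (\<Sum>i\<in>Basis. \<integral>z. V i z * P i z \<partial>lborel) - interaction"
proof -
  define g where "g = (\<lambda>p. \<Sum>i\<in>Basis. \<sigma> (fst p) * \<sigma> (fst (snd p)) * (((u (fst p) - u (fst (snd p))) \<bullet> i)
          * dheat i (max s (snd (snd p)) + s) (fst p - fst (snd p))))"
  have hb: "has_bochner_integral (M \<Otimes>\<^sub>M Q) g
      ((\<Sum>i\<in>Basis. \<integral>z. F z * Z i z \<partial>lborel) - (\<Sum>i\<in>Basis. \<integral>z. V i z * P i z \<partial>lborel))"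
  proof -
    have "has_bochner_integral (M \<Otimes>\<^sub>M Q) (\<lambda>p. (\<Sum>i\<in>Basis. (\<integral>z. kb (fst p) z * kUA i (snd p) z \<partial>lborel))
        - (\<Sum>i\<in>Basis. (\<integral>z. kUb i (fst p) z * kA i (snd p) z \<partial>lborel)))
      ((\<Sum>i\<in>Basis. \<integral>z. F z * Z i z \<partial>lborel) - (\<Sum>i\<in>Basis. \<integral>z. V i z * P i z \<partial>lborel))"
      by (intro has_bochner_integral_diff has_bochner_integral_sum fubini_pairD(2) fubini_kb_kUA fubini_kUb_kA)
    also have "(\<lambda>p. (\<Sum>i\<in>Basis. (\<integral>z. kb (fst p) z * kUA i (snd p) z \<partial>lborel))
        - (\<Sum>i\<in>Basis. (\<integral>z. kUb i (fst p) z * kA i (snd p) z \<partial>lborel))) = g"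
      by (simp add: g_def integral_kb_kUA sum.distrib)
    finally show ?thesis .
  qed
  define f where "f = (\<lambda>x y t. \<sigma> x * (\<sigma> y * (- (((u x - u y) \<bullet> (x - y)) * (heat (s + max s t) (x - y) / (2 * (s + max s t)))))))"
  have g: "g p = f (fst p) (fst (snd p)) (snd (snd p))" for p
    unfolding g_def f_def sum_distrib_left[symmetric] sum_inner_dheat by (simp add: add.commute mult.assoc)
  have "(\<integral>p. g p \<partial>(M \<Otimes>\<^sub>M Q)) = (\<integral>q. \<integral>t. f (fst q) (snd q) t \<partial>\<Theta> \<partial>(M \<Otimes>\<^sub>M M))"
    unfolding g
  proof (rule integral_M_Q)
    show "(\<lambda>(x, y, t). f x y t) \<in> borel_measurable (borel \<Otimes>\<^sub>M borel \<Otimes>\<^sub>M borel)"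
      unfolding f_def by measurable
    show "\<bar>f x y t\<bar> \<le> L * (4 * 2 powr (real DIM('a) / 2)) * heat s (0 :: 'a)" for x y t
      unfolding f_def
    proof (intro \<sigma>_mult_le)
      have "\<bar>((u x - u y) \<bullet> (x - y)) * (heat (s + max s t) (x - y) / (2 * (s + max s t)))\<bar>
          \<le> L * (4 * 2 powr (real DIM('a) / 2)) * heat (2 * (s + max s t)) (x - y)"
        using s by (intro inner_heat_le) auto
      also have "\<dots> \<le> L * (4 * 2 powr (real DIM('a) / 2)) * heat s (0 :: 'a)"
        using s by (intro mult_left_mono heat_le_heat_zero) (auto simp: L_nonneg)
      finally show "\<bar>- (((u x - u y) \<bullet> (x - y)) * (heat (s + max s t) (x - y) / (2 * (s + max s t))))\<bar>
          \<le> L * (4 * 2 powr (real DIM('a) / 2)) * heat s (0 :: 'a)" by simp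
    qed
  qed
  also have "e * \<dots> = - interaction"
    unfolding interaction_def integral_mult_right_zero[symmetric] Bochner_Integration.integral_minus[symmetric]
  proof (intro Bochner_Integration.integral_cong refl)
    fix q :: "'a \<times> 'a"
    let ?x = "fst q" and ?y = "snd q"
    have "(\<integral>t. e * f ?x ?y t \<partial>\<Theta>)
        = (\<integral>t. (- (\<sigma> ?x * \<sigma> ?y * ((u ?x - u ?y) \<bullet> (?x - ?y)) * e)) * (heat (s + max s t) (?x - ?y) / (2 * (s + max s t))) \<partial>\<Theta>)"
      by (intro Bochner_Integration.integral_cong refl) (simp add: f_def mult_ac)
    also have "\<dots> = - (\<sigma> ?x * \<sigma> ?y * ((u ?x - u ?y) \<bullet> (?x - ?y)))
        * (e * (\<integral>t. heat (s + max s t) (?x - ?y) / (2 * (s + max s t)) \<partial>\<Theta>))"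
      by (subst integral_mult_right_zero) simp
    also have "e * (\<integral>t. heat (s + max s t) (?x - ?y) / (2 * (s + max s t)) \<partial>\<Theta>) = far_slope \<kappa> (2 * s) (?x - ?y)"
      unfolding far_slope_def by (rule translate_max) measurable
    finally show "(\<integral>t. e * f ?x ?y t \<partial>\<Theta>) = - (\<sigma> ?x * \<sigma> ?y *
        (((u ?x - u ?y) \<bullet> (?x - ?y)) * far_slope \<kappa> (2 * s) (?x - ?y)))" by simp
  qed
  finally have "e * ((\<Sum>i\<in>Basis. \<integral>z. F z * Z i z \<partial>lborel) - (\<Sum>i\<in>Basis. \<integral>z. V i z * P i z \<partial>lborel)) = - interaction"
    using hb by (simp add: has_bochner_integral_iff)
  then show ?thesis by (simp add: right_diff_distrib)
qed

text \<open>Each half of \<open>W\<close> leaves one copy of the smearing error, the pairing of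
  \<open>V\<close> with the gradient \<open>P\<close>: the first directly, the second through
  \<open>sum_integral_F_Z\<close>. Hence the factor 2.\<close>

lemma interaction_eq:
  "interaction = (\<integral>p. W p \<partial>(Q \<Otimes>\<^sub>M Q)) + 2 * e * (\<Sum>i\<in>Basis. \<integral>z. V i z * P i z \<partial>lborel)"
proof -
  have "(\<integral>p. W p \<partial>(Q \<Otimes>\<^sub>M Q))
      = (\<Sum>i\<in>Basis. (\<integral>z. P i z * (- e * V i z) \<partial>lborel) + (\<integral>z. (- e * F z) * Z i z \<partial>lborel))"
    using has_bochner_integral_W by (simp add: has_bochner_integral_iff)
  also have "\<dots> = (\<Sum>i\<in>Basis. - e * (\<integral>z. V i z * P i z \<partial>lborel) + - e * (\<integral>z. F z * Z i z \<partial>lborel))"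
    unfolding integral_mult_right_zero[symmetric]
    by (intro sum.cong arg_cong2[where f="(+)"] Bochner_Integration.integral_cong refl) simp_all
  also have "\<dots> = - e * (\<Sum>i\<in>Basis. \<integral>z. V i z * P i z \<partial>lborel) - e * (\<Sum>i\<in>Basis. \<integral>z. F z * Z i z \<partial>lborel)"
    by (simp add: sum_subtractf sum_distrib_left sum_negf)
  finally show ?thesis using sum_integral_F_Z by simp
qed

lemma integral_Y: "(\<integral>z. Y z * Y z \<partial>lborel) = (\<integral>q. heat (4 * s) (fst q - snd q) \<partial>(M \<Otimes>\<^sub>M M))"
proof -
  have "(\<integral>z. Y z * Y z \<partial>lborel) = (\<integral>q. (\<integral>z. ky (fst q) z * ky (snd q) z \<partial>lborel) \<partial>(M \<Otimes>\<^sub>M M))"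
    using fubini_pairD(2)[OF fubini_ky_ky] by (simp add: has_bochner_integral_iff)
  also have "\<dots> = (\<integral>q. heat (4 * s) (fst q - snd q) \<partial>(M \<Otimes>\<^sub>M M))"
    unfolding ky_def using s by (subst integral_heat_mult) auto
  finally show ?thesis .
qed

lemma V_le:
  assumes i: "i \<in> Basis"
  shows "\<bar>V i z\<bar> \<le> L * (3 * sqrt s * 2 powr (real DIM('a) / 2)) * Y z"
proof -
  obtain B where B: "\<And>x z. \<bar>ky x z\<bar> \<le> B" using L1_ky by (auto simp: L1_kernel_def bounded_kernel_def)
  obtain B' where B': "\<And>x z. \<bar>kUb i x z\<bar> \<le> B'" using L1_kUb[OF i] by (auto simp: L1_kernel_def bounded_kernel_def)
  have "\<bar>V i z\<bar> \<le> (\<integral>x. \<bar>kUb i x z\<bar> \<partial>M)" unfolding V_def by (rule integral_abs_bound)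
  also have "\<dots> \<le> (\<integral>x. L * (3 * sqrt s * 2 powr (real DIM('a) / 2)) * ky x z \<partial>M)"
  proof (rule integral_mono[OF _ _ kUb_le[OF i]])
    show "integrable M (\<lambda>x. \<bar>kUb i x z\<bar>)"
      by (intro integrable_abs integrable_bounded_M[OF _ B']) (simp add: kUb_def kb_def)
    show "integrable M (\<lambda>x. L * (3 * sqrt s * 2 powr (real DIM('a) / 2)) * ky x z)"
      by (intro integrable_mult_right integrable_bounded_M[OF _ B]) (simp add: ky_def)
  qed
  finally show ?thesis by (simp add: Y_def)
qed

lemma smeared_commutator_estimate:
  "\<bar>interaction\<bar> \<le> L * ((3 * (real DIM('a))\<^sup>2 + 1)
      * (\<integral>q. \<sigma> (fst q) * \<sigma> (snd q) * far \<kappa> (2 * s) (fst q - snd q) \<partial>(M \<Otimes>\<^sub>M M))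
    + 9 * real DIM('a) * 2 powr real DIM('a) * s * (\<integral>q. heat (4 * s) (fst q - snd q) \<partial>(M \<Otimes>\<^sub>M M)))"
proof -
  let ?c = "3 * sqrt s * 2 powr (real DIM('a) / 2)"
  have c2: "?c\<^sup>2 = 9 * s * 2 powr real DIM('a)"
    using s by (simp add: power_mult_distrib powr_power)
  have c0: "0 \<le> ?c" using s by simp
  have Y0: "0 \<le> Y z" for z
    unfolding Y_def by (intro Bochner_Integration.integral_nonneg) (simp add: ky_def)
  have P2: "fubini_pair (Q \<Otimes>\<^sub>M Q) (\<lambda>p z. kA i (fst p) z * kA i (snd p) z) (\<lambda>z. P i z * P i z)" if "i \<in> Basis" for i
    by (rule fubini_kA_kA[OF that that])
  \<comment> \<open>Young's inequality with one factor \<open>L\<close> kept outside: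
    \<open>V\<close> is at most \<open>L\<close> times \<open>?c * Y\<close>, and the square is
    completed between \<open>P\<close> and \<open>?c * Y\<close> only. The result stays linear in
    \<open>L\<close>.\<close>
  have one: "2 * \<bar>\<integral>z. V i z * P i z \<partial>lborel\<bar> \<le> L * ((\<integral>z. P i z * P i z \<partial>lborel) + ?c\<^sup>2 * (\<integral>z. Y z * Y z \<partial>lborel))"
    if i: "i \<in> Basis" for i
  proof -
    have "2 * \<bar>\<integral>z. V i z * P i z \<partial>lborel\<bar> \<le> (\<integral>z. 2 * \<bar>V i z * P i z\<bar> \<partial>lborel)"
      using integral_abs_bound[of lborel "\<lambda>z. V i z * P i z"] by simp
    also have "\<dots> \<le> (\<integral>z. L * (P i z * P i z + ?c\<^sup>2 * (Y z * Y z)) \<partial>lborel)"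
    proof (rule integral_mono)
      show "integrable lborel (\<lambda>z. 2 * \<bar>V i z * P i z\<bar>)"
        using fubini_pairD(1)[OF fubini_kUb_kA[OF i]] by simp
      show "integrable lborel (\<lambda>z. L * (P i z * P i z + ?c\<^sup>2 * (Y z * Y z)))"
        by (intro integrable_mult_right Bochner_Integration.integrable_add
            fubini_pairD(1)[OF P2[OF i]] fubini_pairD(1)[OF fubini_ky_ky])
      show "2 * \<bar>V i z * P i z\<bar> \<le> L * (P i z * P i z + ?c\<^sup>2 * (Y z * Y z))" for z
      proof -
        have "\<bar>V i z\<bar> * \<bar>P i z\<bar> \<le> (L * ?c * Y z) * \<bar>P i z\<bar>"
          by (intro mult_right_mono V_le[OF i]) simp
        then have "2 * \<bar>V i z * P i z\<bar> \<le> L * (2 * \<bar>P i z\<bar> * (?c * Y z))" by (simp add: abs_mult mult_ac)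
        also have "2 * \<bar>P i z\<bar> * (?c * Y z) \<le> \<bar>P i z\<bar>\<^sup>2 + (?c * Y z)\<^sup>2"
          by (rule sum_squares_bound)
        also have "\<bar>P i z\<bar>\<^sup>2 + (?c * Y z)\<^sup>2 = P i z * P i z + ?c\<^sup>2 * (Y z * Y z)"
          by (simp only: power2_abs power_mult_distrib) (simp add: power2_eq_square)
        finally show ?thesis using L_nonneg by (simp add: mult_left_mono)
      qed
    qed
    also have "\<dots> = L * ((\<integral>z. P i z * P i z \<partial>lborel) + ?c\<^sup>2 * (\<integral>z. Y z * Y z \<partial>lborel))"
      using fubini_pairD(1)[OF P2[OF i]] fubini_pairD(1)[OF fubini_ky_ky] by simp
    finally show ?thesis .
  qed
  have sumP: "(\<Sum>i\<in>Basis. \<integral>z. P i z * P i z \<partial>lborel) \<le> (\<integral>z. EH z \<partial>lborel)"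
  proof -
    have "(\<Sum>i\<in>Basis. \<integral>z. P i z * P i z \<partial>lborel) = (\<integral>z. (\<Sum>i\<in>Basis. P i z * P i z) \<partial>lborel)"
      by (rule Bochner_Integration.integral_sum[symmetric]) (rule fubini_pairD(1)[OF P2])
    also have "\<dots> \<le> (\<integral>z. EH z \<partial>lborel)"
      by (rule integral_mono[OF Bochner_Integration.integrable_sum integrable_EH])
        (auto simp: EH_def intro: fubini_pairD(1)[OF P2])
    finally show ?thesis .
  qed
  have "\<bar>2 * e * (\<Sum>i\<in>Basis. \<integral>z. V i z * P i z \<partial>lborel)\<bar> = e * (2 * \<bar>\<Sum>i\<in>Basis. \<integral>z. V i z * P i z \<partial>lborel\<bar>)"
    using e_pos by (simp add: abs_mult)
  also have "\<dots> \<le> 1 * (2 * (\<Sum>i\<in>Basis. \<bar>\<integral>z. V i z * P i z \<partial>lborel\<bar>))"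
    using e_le e_pos by (intro mult_mono sum_abs) auto
  also have "\<dots> \<le> (\<Sum>i\<in>Basis. L * ((\<integral>z. P i z * P i z \<partial>lborel) + ?c\<^sup>2 * (\<integral>z. Y z * Y z \<partial>lborel)))"
    unfolding mult_1 sum_distrib_left by (intro sum_mono one)
  also have "\<dots> = L * ((\<Sum>i\<in>Basis. \<integral>z. P i z * P i z \<partial>lborel) + real DIM('a) * ?c\<^sup>2 * (\<integral>z. Y z * Y z \<partial>lborel))"
    by (simp add: sum_distrib_left[symmetric] sum.distrib)
  also have "\<dots> \<le> L * ((\<integral>z. EH z \<partial>lborel) + real DIM('a) * ?c\<^sup>2 * (\<integral>z. Y z * Y z \<partial>lborel))"
    using sumP by (intro mult_left_mono L_nonneg) simp
  finally have 2: "\<bar>2 * e * (\<Sum>i\<in>Basis. \<integral>z. V i z * P i z \<partial>lborel)\<bar>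
      \<le> L * ((\<integral>z. EH z \<partial>lborel) + real DIM('a) * ?c\<^sup>2 * (\<integral>z. Y z * Y z \<partial>lborel))" .
  have "\<bar>interaction\<bar> \<le> 3 * (real DIM('a))\<^sup>2 * L * (\<integral>z. EH z \<partial>lborel)
      + L * ((\<integral>z. EH z \<partial>lborel) + real DIM('a) * ?c\<^sup>2 * (\<integral>z. Y z * Y z \<partial>lborel))"
    unfolding interaction_eq by (rule order.trans[OF abs_triangle_ineq add_mono[OF abs_integral_W_le 2]])
  also have "\<dots> = L * ((3 * (real DIM('a))\<^sup>2 + 1) * (\<integral>z. EH z \<partial>lborel)
      + 9 * real DIM('a) * 2 powr real DIM('a) * s * (\<integral>z. Y z * Y z \<partial>lborel))"
    unfolding c2 by (simp add: algebra_simps)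
  finally show ?thesis unfolding energy_identity integral_Y .
qed

lemma energy_nonneg: "0 \<le> (\<integral>q. \<sigma> (fst q) * \<sigma> (snd q) * far \<kappa> (2 * s) (fst q - snd q) \<partial>(M \<Otimes>\<^sub>M M))"
  unfolding energy_identity[symmetric] by (intro Bochner_Integration.integral_nonneg EH_nonneg)

end

section \<open>The Yukawa kernel as a superposition of heat kernels\<close>

lemma powr_mult_exp_minus_bounded:
  assumes "0 \<le> p"
  shows "\<exists>B. \<forall>w>0. w powr p * exp (- w) \<le> (B :: real)"
proof -
  define k where "k = Suc (nat \<lceil>p\<rceil>)"
  have k: "p \<le> real k" "0 < k" by (auto simp: k_def real_nat_ceiling_ge intro: order.trans[OF real_nat_ceiling_ge])
  show ?thesis
  proof (intro exI[of _ "real k ^ k + 1"] allI impI)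
    fix w :: real assume w: "0 < w"
    show "w powr p * exp (- w) \<le> real k ^ k + 1"
    proof (cases "w \<le> 1")
      case True
      have "w powr p * exp (- w) \<le> 1 * 1"
        using w True assms by (intro mult_mono) (auto simp: powr_le1)
      then show ?thesis by (simp add: add_increasing)
    next
      case False
      have "w powr p \<le> w powr real k" using False k by (intro powr_mono) auto
      also have "\<dots> = w ^ k" using w by (simp add: powr_realpow)
      also have "\<dots> = real k ^ k * (w / real k) ^ k" using k(2) by (simp add: power_divide)
      also have "\<dots> \<le> real k ^ k * exp (w / real k) ^ k"
      proof (intro mult_left_mono power_mono)
        show "w / real k \<le> exp (w / real k)" using exp_ge_add_one_self[of "w / real k"] by linarith
      qed (use w in auto)
      also have "exp (w / real k) ^ k = exp w" using k(2) by (simp flip: exp_of_nat_mult)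
      finally have "w powr p \<le> real k ^ k * exp w" .
      then have "w powr p * exp (- w) \<le> real k ^ k" by (simp add: exp_minus field_simps)
      then show ?thesis by simp
    qed
  qed
qed

text \<open>Away from the origin the Gaussian factor beats every power of \<open>1 / t\<close> as
  the time tends to 0. This makes the time integrals of the kernel and of its slope converge without
  a cut.\<close>

lemma heat_time_bounded:
  assumes q: "0 < q" and p: "0 \<le> p"
  shows "\<exists>B\<ge>0. \<forall>t>0. (1 / t) powr p * exp (- q / (4 * t)) \<le> (B :: real)"
proof -
  obtain B where B: "\<And>w. w > 0 \<Longrightarrow> w powr p * exp (- w) \<le> B"
    using powr_mult_exp_minus_bounded[OF p] by blast
  have B0: "0 \<le> B" using order.trans[OF _ B[of 1]] by simp
  show ?thesis
  proof (intro exI[of _ "(4 / q) powr p * B"] conjI allI impI)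
    fix t :: real assume t: "0 < t"
    have "1 / t = (4 / q) * (q / (4 * t))" using q by simp
    then have "(1 / t) powr p * exp (- q / (4 * t)) = (4 / q) powr p * ((q / (4 * t)) powr p * exp (- (q / (4 * t))))"
      using q t by (simp only: powr_mult) simp
    also have "\<dots> \<le> (4 / q) powr p * B" using q t by (intro mult_left_mono B) auto
    finally show "(1 / t) powr p * exp (- q / (4 * t)) \<le> (4 / q) powr p * B" .
  qed (use B0 in auto)
qed

lemma heat_amplitude:
  assumes "0 < t"
  shows "(4 * pi * t) powr (- real d / 2) = (4 * pi) powr (- real d / 2) * (1 / t) powr (real d / 2)"
proof -
  have "(1 / t) powr (real d / 2) = t powr (- (real d / 2))"
    by (simp only: powr_minus_divide powr_divide powr_one_eq_one)
  moreover have "- real d / 2 = - (real d / 2)" by simp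
  ultimately show ?thesis by (simp only: powr_mult)
qed

lemma integrable_heat_time:
  fixes k :: real and A :: "real set"
  assumes \<kappa>: "0 < \<kappa>" and q: "0 < q" and k: "0 \<le> k" and A: "A \<subseteq> {0<..}" "A \<in> sets borel"
  shows "integrable (damped \<kappa> A) (\<lambda>t. (4 * pi * t) powr (- real d / 2) * (1 / t) powr k * exp (- q / (4 * t)))"
proof -
  from heat_time_bounded[OF q, of "real d / 2 + k"] k obtain B where
    B: "\<And>t. t > 0 \<Longrightarrow> (1 / t) powr (real d / 2 + k) * exp (- q / (4 * t)) \<le> B" by auto
  show ?thesis
  proof (rule integrable_damped_bounded[OF \<kappa>])
    show "\<bar>(4 * pi * t) powr (- real d / 2) * (1 / t) powr k * exp (- q / (4 * t))\<bar> \<le> (4 * pi) powr (- real d / 2) * B"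
      if "t \<in> A" for t
    proof -
      have t: "0 < t" using that A by auto
      have "\<bar>(4 * pi * t) powr (- real d / 2) * (1 / t) powr k * exp (- q / (4 * t))\<bar>
          = (4 * pi) powr (- real d / 2) * ((1 / t) powr (real d / 2 + k) * exp (- q / (4 * t)))"
        unfolding heat_amplitude[OF t] powr_add by (simp add: abs_mult)
      also have "\<dots> \<le> (4 * pi) powr (- real d / 2) * B" using t by (intro mult_left_mono B) auto
      finally show ?thesis .
    qed
  qed (use A in auto)
qed

lemma integrable_heat_damped:
  assumes "0 < \<kappa>" "y \<noteq> 0" "A \<subseteq> {0<..}" "A \<in> sets borel"
  shows "integrable (damped \<kappa> A) (\<lambda>t. heat t (y :: 'a::euclidean_space))"
proof -
  have "integrable (damped \<kappa> A) (\<lambda>t. (4 * pi * t) powr (- real DIM('a) / 2) * (1 / t) powr 0 * exp (- (norm y)\<^sup>2 / (4 * t)))"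
    using assms by (intro integrable_heat_time) auto
  then show ?thesis
    by (rule integrable_cong_AE[THEN iffD1, rotated -1])
      (use AE_damped[OF assms(4), of \<kappa>] assms(3) in \<open>auto simp: heat_def elim!: eventually_mono\<close>)
qed

lemma integrable_heat_damped_slope:
  assumes "0 < \<kappa>" "y \<noteq> 0" "A \<subseteq> {0<..}" "A \<in> sets borel"
  shows "integrable (damped \<kappa> A) (\<lambda>t. heat t (y :: 'a::euclidean_space) / (2 * t))"
proof -
  have "integrable (damped \<kappa> A) (\<lambda>t. 1 / 2 * ((4 * pi * t) powr (- real DIM('a) / 2) * (1 / t) powr 1 * exp (- (norm y)\<^sup>2 / (4 * t))))"
    using assms by (intro integrable_mult_right integrable_heat_time) auto
  then show ?thesis
    by (rule integrable_cong_AE[THEN iffD1, rotated -1])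
      (use AE_damped[OF assms(4), of \<kappa>] assms(3) in \<open>auto simp: heat_def elim!: eventually_mono\<close>)
qed

lemma abs_exp_minus_one_le: "\<bar>exp y - 1\<bar> \<le> \<bar>y\<bar> * exp \<bar>y\<bar>" for y :: real
proof (cases "0 \<le> y")
  case True
  have "1 - exp (- y) \<le> y" using exp_ge_add_one_self[of "- y"] by linarith
  then have "(1 - exp (- y)) * exp y \<le> y * exp y" by (intro mult_right_mono) auto
  then show ?thesis using True by (simp add: left_diff_distrib flip: exp_add)
next
  case False
  then have "\<bar>exp y - 1\<bar> = 1 - exp y" by simp
  also have "\<dots> \<le> - y" using exp_ge_add_one_self[of y] by linarith
  also have "\<dots> \<le> - y * exp (- y)" using False by simp
  finally show ?thesis using False by simp
qed

text \<open>As a function of the squared distance the kernel is a Laplace transform, with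
  \<open>w\<close> the reciprocal of \<open>4 * t\<close>; differentiating in that single variable
  avoids a differentiation in space under the integral.\<close>

lemma has_derivative_laplace_transform:
  fixes f w :: "'b \<Rightarrow> real"
  assumes q: "0 < q"
    and int0: "\<And>q. 0 < q \<Longrightarrow> integrable \<mu> (\<lambda>t. f t * exp (- q * w t))"
    and int1: "\<And>q. 0 < q \<Longrightarrow> integrable \<mu> (\<lambda>t. f t * w t * exp (- q * w t))"
    and w: "AE t in \<mu>. 0 \<le> w t"
  shows "((\<lambda>q. \<integral>t. f t * exp (- q * w t) \<partial>\<mu>) has_real_derivative - (\<integral>t. f t * w t * exp (- q * w t) \<partial>\<mu>)) (at q)"
proof -
  let ?\<phi> = "\<lambda>q. \<integral>t. f t * exp (- q * w t) \<partial>\<mu>"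
  \<comment> \<open>With steps shorter than \<open>q / 2\<close>, half of the exponent remains, so
    the integrable derivative at \<open>q / 2\<close> dominates all quotients.\<close>
  let ?S = "{- q / 2 <..< q / 2}"
  have "((\<lambda>h. (?\<phi> (q + h) - ?\<phi> q) / h) \<longlongrightarrow> - (\<integral>t. f t * w t * exp (- q * w t) \<partial>\<mu>)) (at 0 within ?S)"
    unfolding tendsto_at_iff_sequentially
  proof (intro allI impI)
    fix h :: "nat \<Rightarrow> real"
    assume h: "\<forall>n. h n \<in> ?S - {0}" "h \<longlonglongrightarrow> 0"
    have hb: "\<bar>h n\<bar> < q / 2" "h n \<noteq> 0" "0 < q + h n" for n
      using h(1)[rule_format, of n] by auto
    have eq: "(?\<phi> (q + h n) - ?\<phi> q) / h n = (\<integral>t. f t * ((exp (- (q + h n) * w t) - exp (- q * w t)) / h n) \<partial>\<mu>)" for n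
      using int0[OF hb(3)[of n]] int0[OF q] by (simp add: right_diff_distrib diff_divide_distrib)
    have "(\<lambda>n. \<integral>t. f t * ((exp (- (q + h n) * w t) - exp (- q * w t)) / h n) \<partial>\<mu>)
        \<longlonglongrightarrow> (\<integral>t. f t * (- w t * exp (- q * w t)) \<partial>\<mu>)"
    proof (rule integral_dominated_convergence)
      show "integrable \<mu> (\<lambda>t. \<bar>f t * w t * exp (- (q / 2) * w t)\<bar>)"
        using int1[of "q / 2"] q by (intro integrable_abs) simp
      show "(\<lambda>t. f t * (- w t * exp (- q * w t))) \<in> borel_measurable \<mu>"
        using borel_measurable_integrable[OF int1[OF q]] by (simp add: mult.assoc)
      show "(\<lambda>t. f t * ((exp (- (q + h n) * w t) - exp (- q * w t)) / h n)) \<in> borel_measurable \<mu>" for n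
        using borel_measurable_integrable[OF int0[OF q]] borel_measurable_integrable[OF int0[OF hb(3)[of n]]]
        by (simp add: right_diff_distrib)
      show "AE t in \<mu>. (\<lambda>n. f t * ((exp (- (q + h n) * w t) - exp (- q * w t)) / h n)) \<longlonglongrightarrow> f t * (- w t * exp (- q * w t))"
      proof (intro AE_I2 tendsto_mult_left)
        fix t
        have "((\<lambda>q. exp (- q * w t)) has_real_derivative (- w t * exp (- q * w t))) (at q)"
          by (auto intro!: derivative_eq_intros)
        then have "((\<lambda>h. (exp (- (q + h) * w t) - exp (- q * w t)) / h) \<longlongrightarrow> - w t * exp (- q * w t)) (at 0)"
          unfolding DERIV_def .
        moreover have "filterlim h (at 0) sequentially" using h(2) hb(2) by (simp add: filterlim_at)
        ultimately show "(\<lambda>n. (exp (- (q + h n) * w t) - exp (- q * w t)) / h n) \<longlonglongrightarrow> - w t * exp (- q * w t)"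
          by (rule filterlim_compose)
      qed
      show "AE t in \<mu>. norm (f t * ((exp (- (q + h n) * w t) - exp (- q * w t)) / h n)) \<le> \<bar>f t * w t * exp (- (q / 2) * w t)\<bar>" for n
        using w
      proof eventually_elim
        fix t assume wt: "0 \<le> w t"
        have "exp (- (q + h n) * w t) - exp (- q * w t) = exp (- q * w t) * (exp (- h n * w t) - 1)"
          by (simp add: right_diff_distrib algebra_simps flip: exp_add)
        then have "\<bar>exp (- (q + h n) * w t) - exp (- q * w t)\<bar> = exp (- q * w t) * \<bar>exp (- h n * w t) - 1\<bar>"
          by (simp add: abs_mult)
        also have "\<dots> \<le> exp (- q * w t) * (\<bar>- h n * w t\<bar> * exp \<bar>- h n * w t\<bar>)"
          by (intro mult_left_mono abs_exp_minus_one_le) simp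
        also have "\<dots> = \<bar>h n\<bar> * (w t * exp (- q * w t + \<bar>h n\<bar> * w t))"
          unfolding exp_add using wt by (simp add: abs_mult)
        also have "\<dots> \<le> \<bar>h n\<bar> * (w t * exp (- (q / 2) * w t))"
        proof -
          have "\<bar>h n\<bar> * w t \<le> (q / 2) * w t" using hb(1)[of n] wt by (intro mult_right_mono) auto
          then show ?thesis using wt by (intro mult_left_mono) (auto simp: algebra_simps)
        qed
        finally have "\<bar>(exp (- (q + h n) * w t) - exp (- q * w t)) / h n\<bar> \<le> w t * exp (- (q / 2) * w t)"
          using hb(2)[of n] by (simp add: abs_divide divide_le_eq mult.commute)
        then have "\<bar>f t\<bar> * \<bar>(exp (- (q + h n) * w t) - exp (- q * w t)) / h n\<bar> \<le> \<bar>f t\<bar> * (w t * exp (- (q / 2) * w t))"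
          by (intro mult_left_mono) auto
        then show "norm (f t * ((exp (- (q + h n) * w t) - exp (- q * w t)) / h n)) \<le> \<bar>f t * w t * exp (- (q / 2) * w t)\<bar>"
          using wt by (simp add: abs_mult mult.assoc)
      qed
    qed
    then show "((\<lambda>h. (?\<phi> (q + h) - ?\<phi> q) / h) \<circ> h) \<longlonglongrightarrow> - (\<integral>t. f t * w t * exp (- q * w t) \<partial>\<mu>)"
      unfolding comp_def eq by (simp add: mult.assoc)
  qed
  moreover have "at 0 within ?S = at (0 :: real)" using q by (intro at_within_open) auto
  ultimately show ?thesis unfolding DERIV_def by (simp only:)
qed

definition near :: "real \<Rightarrow> real \<Rightarrow> 'a::euclidean_space \<Rightarrow> real" where
  "near \<kappa> \<tau> y = (\<integral>t. heat t y \<partial>damped \<kappa> {0<..<\<tau>})"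

definition near_slope :: "real \<Rightarrow> real \<Rightarrow> 'a::euclidean_space \<Rightarrow> real" where
  "near_slope \<kappa> \<tau> y = (\<integral>t. heat t y / (2 * t) \<partial>damped \<kappa> {0<..<\<tau>})"

lemma integral_damped_split:
  fixes f :: "real \<Rightarrow> real"
  assumes \<tau>: "0 < \<tau>" and f: "integrable (damped \<kappa> {0<..}) f" and [measurable]: "f \<in> borel_measurable borel"
  shows "(\<integral>t. f t \<partial>damped \<kappa> {0<..}) = (\<integral>t. f t \<partial>damped \<kappa> {0<..<\<tau>}) + (\<integral>t. f t \<partial>damped \<kappa> {\<tau>..})"
proof -
  have int: "integrable lborel (\<lambda>t. indicator {0<..} t * exp (- \<kappa>\<^sup>2 * t) * f t)"
    using f by (subst (asm) integrable_damped_iff) auto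
  have i: "integrable lborel (\<lambda>t. indicator A t * exp (- \<kappa>\<^sup>2 * t) * f t)" if "A \<subseteq> {0<..}" and [measurable]: "A \<in> sets borel" for A
    by (rule Bochner_Integration.integrable_bound[OF int]) (use that in \<open>auto simp: indicator_def\<close>)
  have "(\<integral>t. indicator {0<..} t * exp (- \<kappa>\<^sup>2 * t) * f t \<partial>lborel)
      = (\<integral>t. indicator {0<..<\<tau>} t * exp (- \<kappa>\<^sup>2 * t) * f t + indicator {\<tau>..} t * exp (- \<kappa>\<^sup>2 * t) * f t \<partial>lborel)"
    using \<tau> by (intro Bochner_Integration.integral_cong refl) (auto simp: indicator_def)
  also have "\<dots> = (\<integral>t. indicator {0<..<\<tau>} t * exp (- \<kappa>\<^sup>2 * t) * f t \<partial>lborel) + (\<integral>t. indicator {\<tau>..} t * exp (- \<kappa>\<^sup>2 * t) * f t \<partial>lborel)"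
    using \<tau> by (intro Bochner_Integration.integral_add i) auto
  finally show ?thesis by (simp add: integral_damped)
qed

text \<open>Folding the line at the origin: the first exponential is even, and the two reflected
  copies of the second add up to twice the hyperbolic cosine.\<close>

lemma bessel_K_whole_line:
  fixes f :: "real \<Rightarrow> real"
  assumes f: "f = (\<lambda>\<tau>. exp (- r * cosh \<tau>) * exp (- \<nu> * \<tau>))" and int: "integrable lborel f"
  shows "(\<integral>\<tau>. f \<tau> \<partial>lborel) = 2 * bessel_K \<nu> r"
proof -
  have [measurable]: "f \<in> borel_measurable borel" using int by simp
  have i: "integrable lborel (\<lambda>\<tau>. indicator A \<tau> * f \<tau>)" if [measurable]: "A \<in> sets borel" for A
    by (rule Bochner_Integration.integrable_bound[OF int]) (auto simp: indicator_def)
  have refl_int: "integrable lborel (\<lambda>\<tau>. indicator {0..} \<tau> * f (- \<tau>))"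
  proof -
    have "integrable lborel (\<lambda>\<tau>. indicator {..0} (0 + (-1) * \<tau>) * f (0 + (-1) * \<tau>))"
      by (rule lborel_integrable_real_affine[OF i]) auto
    moreover have "indicator {..0} (0 + (-1) * \<tau>) = (indicator {0..} \<tau> :: real)" for \<tau> :: real
      by (auto simp: indicator_def)
    ultimately show ?thesis by simp
  qed
  have "(\<integral>\<tau>. f \<tau> \<partial>lborel) = (\<integral>\<tau>. indicator {0..} \<tau> * f \<tau> + indicator {..0} \<tau> * f \<tau> \<partial>lborel)"
  proof (rule integral_cong_AE)
    show "AE \<tau> in lborel. f \<tau> = indicator {0..} \<tau> * f \<tau> + indicator {..0} \<tau> * f \<tau>"
      using AE_lborel_singleton[of "0::real"] by eventually_elim (auto simp: indicator_def)
  qed auto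
  also have "\<dots> = (\<integral>\<tau>. indicator {0..} \<tau> * f \<tau> \<partial>lborel) + (\<integral>\<tau>. indicator {..0} \<tau> * f \<tau> \<partial>lborel)"
    by (intro Bochner_Integration.integral_add i) auto
  also have "(\<integral>\<tau>. indicator {..0} \<tau> * f \<tau> \<partial>lborel) = (\<integral>\<tau>. indicator {..0} (- \<tau>) * f (- \<tau>) \<partial>lborel)"
    by (rule integral_lborel_uminus[symmetric]) measurable
  also have "\<dots> = (\<integral>\<tau>. indicator {0..} \<tau> * f (- \<tau>) \<partial>lborel)"
    by (intro Bochner_Integration.integral_cong refl) (auto simp: indicator_def)
  also have "(\<integral>\<tau>. indicator {0..} \<tau> * f \<tau> \<partial>lborel) + \<dots>
      = (\<integral>\<tau>. indicator {0..} \<tau> * f \<tau> + indicator {0..} \<tau> * f (- \<tau>) \<partial>lborel)"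
    by (intro Bochner_Integration.integral_add[symmetric] i refl_int) auto
  also have "\<dots> = (\<integral>\<tau>. 2 * (indicator {0..} \<tau> * (exp (- r * cosh \<tau>) * cosh (\<nu> * \<tau>))) \<partial>lborel)"
  proof (intro Bochner_Integration.integral_cong refl)
    fix \<tau>
    have c: "2 * cosh (\<nu> * \<tau>) = exp (- \<nu> * \<tau>) + exp (- \<nu> * - \<tau>)"
      by (simp add: cosh_field_def)
    have "f \<tau> + f (- \<tau>) = 2 * (exp (- r * cosh \<tau>) * cosh (\<nu> * \<tau>))"
      unfolding f cosh_minus distrib_left[symmetric] c[symmetric] by simp
    then show "indicator {0..} \<tau> * f \<tau> + indicator {0..} \<tau> * f (- \<tau>)
        = 2 * (indicator {0..} \<tau> * (exp (- r * cosh \<tau>) * cosh (\<nu> * \<tau>)))"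
      by (simp add: indicator_def)
  qed
  finally show ?thesis
    by (simp add: bessel_K_def set_lebesgue_integral_def)
qed

text \<open>Substituting for \<open>t\<close> the multiple r / (2 \<kappa>) of the exponential of a
  new variable \<tau> balances the damping against the Gaussian: their exponents add up to -
  \<kappa> r cosh \<tau>, the integrand of the Bessel function on the whole line.\<close>

lemma yukawa_eq_heat_integral:
  fixes x :: "real ^ 'd::finite"
  assumes \<kappa>: "0 < \<kappa>" and x: "x \<noteq> 0"
  shows "yukawa \<kappa> x = (\<integral>t. heat t x \<partial>damped \<kappa> {0<..})"
proof -
  define r where "r = norm x"
  have r: "0 < r" using x by (simp add: r_def)
  define d where "d = real CARD('d)"
  define \<nu> where "\<nu> = d / 2 - 1"
  define f where "f = (\<lambda>\<tau>. exp (- (\<kappa> * r) * cosh \<tau>) * exp (- \<nu> * \<tau>))"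
  define g where "g = (\<lambda>t. ln (2 * \<kappa> * t / r))"
  \<comment> \<open>The power \<open>- d / 2\<close> of the time splits as \<open>- \<nu>\<close>
    and \<open>- 1\<close>. The first part becomes the exponential in \<open>f\<close> up to the
    constants collected here, the second is the derivative of \<open>g\<close>.\<close>
  define c where "c = (4 * pi) powr (- d / 2) * (r / (2 * \<kappa>)) powr (- \<nu>)"
  have c: "0 < c" using r \<kappa> by (simp add: c_def)
  have fg: "exp (- \<kappa>\<^sup>2 * t) * heat t x = c * (f (g t) * (1 / t))" if t: "0 < t" for t
  proof -
    define w where "w = 2 * \<kappa> * t / r"
    have w: "0 < w" using t r \<kappa> by (simp add: w_def)
    have tw: "t = r / (2 * \<kappa>) * w" using r \<kappa> by (simp add: w_def)
    have e: "- \<kappa>\<^sup>2 * t + - r\<^sup>2 / (4 * t) = - (\<kappa> * r) * cosh (ln w)"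
      using w r \<kappa> by (simp add: cosh_ln_real w_def) (simp add: field_simps power2_eq_square)
    have p: "(4 * pi * t) powr (- d / 2) = c * (exp (- \<nu> * ln w) * (1 / t))"
    proof -
      have "- d / 2 = - \<nu> + - 1" by (simp add: \<nu>_def)
      then have "t powr (- d / 2) = t powr (- \<nu>) * (1 / t)"
        using t by (simp only: powr_add) (simp add: powr_minus_divide)
      also have "t powr (- \<nu>) = (r / (2 * \<kappa>)) powr (- \<nu>) * w powr (- \<nu>)"
        by (subst tw) (rule powr_mult)
      also have "w powr (- \<nu>) = exp (- \<nu> * ln w)" using w by (simp add: powr_def)
      finally show ?thesis unfolding c_def powr_mult[of "4 * pi" t] by (simp add: mult_ac)
    qed
    have "exp (- \<kappa>\<^sup>2 * t) * heat t x = (4 * pi * t) powr (- d / 2) * exp (- \<kappa>\<^sup>2 * t + - r\<^sup>2 / (4 * t))"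
      unfolding exp_add by (simp add: heat_def d_def r_def)
    also have "\<dots> = c * (f (g t) * (1 / t))"
      unfolding e p by (simp add: f_def g_def w_def mult_ac)
    finally show ?thesis .
  qed
  have fg': "exp (- (\<kappa>\<^sup>2 * t)) * heat t x = c * (f (g t) * (1 / t))" if "0 < t" for t
    using fg[OF that] by (simp only: mult_minus_left)
  have int: "set_integrable lborel (einterval (ereal 0) \<infinity>) (\<lambda>t. f (g t) * (1 / t))"
  proof -
    have "integrable (damped \<kappa> {0<..}) (\<lambda>t. heat t x)"
      using \<kappa> x by (intro integrable_heat_damped) auto
    then have "integrable lborel (\<lambda>t. (1 / c) * (indicator {0<..} t * exp (- \<kappa>\<^sup>2 * t) * heat t x))"
      by (subst (asm) integrable_damped_iff) auto
    also have "(\<lambda>t. (1 / c) * (indicator {0<..} t * exp (- \<kappa>\<^sup>2 * t) * heat t x))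
        = (\<lambda>t. indicator (einterval (ereal 0) \<infinity>) t *\<^sub>R (f (g t) * (1 / t)))"
      using c by (auto simp: fun_eq_iff indicator_def einterval_def fg')
    finally show ?thesis unfolding set_integrable_def .
  qed
  have deriv: "DERIV g t :> 1 / t" if "ereal 0 < ereal t" for t
    using that r \<kappa> unfolding g_def by (auto intro!: derivative_eq_intros)
  have contf: "isCont f \<tau>" for \<tau> unfolding f_def cosh_field_def by (intro continuous_intros) auto
  have A: "((ereal \<circ> g \<circ> real_of_ereal) \<longlongrightarrow> - \<infinity>) (at_right (ereal 0))"
  proof -
    have "filterlim g at_bot (at_right 0)"
      unfolding g_def using r \<kappa> by real_asymp
    then show ?thesis by (simp add: ereal_tendsto_simps)
  qed
  have B: "((ereal \<circ> g \<circ> real_of_ereal) \<longlongrightarrow> \<infinity>) (at_left \<infinity>)"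
  proof -
    have "filterlim g at_top at_top"
      unfolding g_def using r \<kappa> by real_asymp
    then show ?thesis by (simp add: ereal_tendsto_simps)
  qed
  note sub = interval_integral_substitution_nonneg[where a="ereal 0" and b=\<infinity> and g=g and g'="\<lambda>t. 1 / t" and f=f
      and A="-\<infinity>" and B=\<infinity>]
  have fint: "integrable lborel f"
    using sub(1)[OF _ deriv contf _ _ _ A B int] by (auto simp: set_integrable_def f_def)
  have "(LBINT \<tau>=-\<infinity>..\<infinity>. f \<tau>) = (LBINT t=ereal 0..\<infinity>. f (g t) * (1 / t))"
    using sub(2)[OF _ deriv contf _ _ _ A B int] by (auto simp: f_def)
  then have "(\<integral>\<tau>. f \<tau> \<partial>lborel) = (\<integral>t. indicator {0<..} t * (f (g t) * (1 / t)) \<partial>lborel)"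
    by (simp add: interval_lebesgue_integral_def set_lebesgue_integral_def einterval_def greaterThan_def)
  also have "\<dots> = (\<integral>t. (1 / c) * (indicator {0<..} t * exp (- \<kappa>\<^sup>2 * t) * heat t x) \<partial>lborel)"
    using c by (intro Bochner_Integration.integral_cong refl) (auto simp: indicator_def fg')
  also have "\<dots> = (1 / c) * (\<integral>t. heat t x \<partial>damped \<kappa> {0<..})"
    by (simp add: integral_damped)
  finally have main: "2 * c * bessel_K \<nu> (\<kappa> * r) = (\<integral>t. heat t x \<partial>damped \<kappa> {0<..})"
    using bessel_K_whole_line[OF f_def fint] c by (simp add: field_simps)
  have "2 * c = (2 * pi) powr (- d / 2) * (\<kappa> / r) powr \<nu>"
  proof -
    have "(r / (2 * \<kappa>)) powr (- \<nu>) = (2 * (\<kappa> / r)) powr \<nu>"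
      using r \<kappa> by (simp add: powr_minus powr_divide powr_mult field_simps)
    also have "\<dots> = 2 powr \<nu> * (\<kappa> / r) powr \<nu>" by (rule powr_mult)
    finally have 1: "(r / (2 * \<kappa>)) powr (- \<nu>) = 2 powr \<nu> * (\<kappa> / r) powr \<nu>" .
    have 2: "(4 * pi) powr (- d / 2) = 2 powr (- d / 2) * (2 * pi) powr (- d / 2)"
      by (simp flip: powr_mult)
    have 3: "2 * 2 powr (- d / 2) * 2 powr \<nu> = (1 :: real)"
    proof -
      have "2 powr 1 * 2 powr (- d / 2) * 2 powr \<nu> = (2 :: real) powr (1 + - d / 2 + \<nu>)"
        by (simp only: powr_add)
      also have "1 + - d / 2 + \<nu> = 0" by (simp add: \<nu>_def)
      finally show ?thesis by simp
    qed
    have "2 * c = (2 * 2 powr (- d / 2) * 2 powr \<nu>) * ((2 * pi) powr (- d / 2) * (\<kappa> / r) powr \<nu>)"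
      unfolding c_def 1 2 by (simp only: mult_ac)
    then show ?thesis unfolding 3 by simp
  qed
  then show ?thesis using main by (simp add: yukawa_def Let_def d_def r_def \<nu>_def)
qed

lemma yukawa_eq_near_far:
  fixes x :: "real ^ 'd::finite"
  assumes "0 < \<kappa>" "x \<noteq> 0" "0 < \<tau>"
  shows "yukawa \<kappa> x = near \<kappa> \<tau> x + far \<kappa> \<tau> x"
  unfolding near_def far_def yukawa_eq_heat_integral[OF assms(1,2)]
  using assms by (intro integral_damped_split integrable_heat_damped) auto

text \<open>Chain rule through the squared distance. Since \<open>gradient\<close> is a definite
  description, uniqueness of the derivative is needed to evaluate it.\<close>

lemma gradient_yukawa:
  fixes x :: "real ^ 'd::finite"
  assumes \<kappa>: "0 < \<kappa>" and x: "x \<noteq> 0" and \<tau>: "0 < \<tau>"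
  shows "gradient (yukawa \<kappa>) x = - (near_slope \<kappa> \<tau> x + far_slope \<kappa> \<tau> x) *\<^sub>R x"
proof -
  define a where "a = (\<lambda>t. (4 * pi * t) powr (- real CARD('d) / 2))"
  define w where "w = (\<lambda>t::real. 1 / (4 * t))"
  define \<phi> where "\<phi> = (\<lambda>q. \<integral>t. a t * exp (- q * w t) \<partial>damped \<kappa> {0<..})"
  define \<phi>' where "\<phi>' = (\<lambda>q. - (\<integral>t. a t * w t * exp (- q * w t) \<partial>damped \<kappa> {0<..}))"
  have AE: "AE t in damped \<kappa> {0<..}. 0 < t"
    using AE_damped[of "{0<..}" \<kappa>] by simp
  have i0: "integrable (damped \<kappa> {0<..}) (\<lambda>t. a t * exp (- q * w t))" if "0 < q" for q
  proof (rule integrable_cong_AE[THEN iffD1, rotated -1])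
    show "integrable (damped \<kappa> {0<..}) (\<lambda>t. (4 * pi * t) powr (- real CARD('d) / 2) * (1 / t) powr 0 * exp (- q / (4 * t)))"
      using \<kappa> that by (intro integrable_heat_time) auto
    show "AE t in damped \<kappa> {0<..}. (4 * pi * t) powr (- real CARD('d) / 2) * (1 / t) powr 0 * exp (- q / (4 * t)) = a t * exp (- q * w t)"
      using AE by eventually_elim (simp add: a_def w_def)
  qed (simp_all add: a_def w_def)
  have i1: "integrable (damped \<kappa> {0<..}) (\<lambda>t. a t * w t * exp (- q * w t))" if "0 < q" for q
  proof (rule integrable_cong_AE[THEN iffD1, rotated -1])
    show "integrable (damped \<kappa> {0<..}) (\<lambda>t. 1 / 4 * ((4 * pi * t) powr (- real CARD('d) / 2) * (1 / t) powr 1 * exp (- q / (4 * t))))"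
      using \<kappa> that by (intro integrable_mult_right integrable_heat_time) auto
    show "AE t in damped \<kappa> {0<..}. 1 / 4 * ((4 * pi * t) powr (- real CARD('d) / 2) * (1 / t) powr 1 * exp (- q / (4 * t))) = a t * w t * exp (- q * w t)"
      using AE by eventually_elim (simp add: a_def w_def)
  qed (simp_all add: a_def w_def)
  have deriv: "(\<phi> has_real_derivative \<phi>' q) (at q)" if "0 < q" for q
    unfolding \<phi>_def \<phi>'_def
  proof (rule has_derivative_laplace_transform[OF that i0 i1])
    show "AE t in damped \<kappa> {0<..}. 0 \<le> w t" using AE by eventually_elim (simp add: w_def)
  qed auto
  have yuk: "yukawa \<kappa> y = \<phi> (y \<bullet> y)" if "y \<noteq> 0" for y :: "real ^ 'd"
    unfolding yukawa_eq_heat_integral[OF \<kappa> that] \<phi>_def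
    by (intro Bochner_Integration.integral_cong refl) (simp add: heat_def a_def w_def power2_norm_eq_inner)
  define S where "S = near_slope \<kappa> \<tau> x + far_slope \<kappa> \<tau> x"
  have S: "S = (\<integral>t. heat t x / (2 * t) \<partial>damped \<kappa> {0<..})"
    unfolding S_def near_slope_def far_slope_def
    by (rule integral_damped_split[symmetric]) (use \<tau> \<kappa> x in \<open>auto intro: integrable_heat_damped_slope\<close>)
  \<comment> \<open>The factor 2 from differentiating the squared distance meets the 4 in
    \<open>w\<close>, which leaves the divisor \<open>2 * t\<close> of the slopes.\<close>
  have S': "2 * \<phi>' (x \<bullet> x) = - S"
  proof -
    have "2 * (\<integral>t. a t * w t * exp (- (x \<bullet> x) * w t) \<partial>damped \<kappa> {0<..}) = S"
      unfolding S integral_mult_right_zero[symmetric]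
      by (intro Bochner_Integration.integral_cong refl) (simp add: heat_def a_def w_def power2_norm_eq_inner)
    then show ?thesis by (simp add: \<phi>'_def)
  qed
  have "((\<lambda>y. \<phi> (y \<bullet> y)) has_derivative (\<lambda>h. \<phi>' (x \<bullet> x) * (x \<bullet> h + h \<bullet> x))) (at x)"
  proof (rule has_derivative_compose[of "\<lambda>y. y \<bullet> y" "\<lambda>h. x \<bullet> h + h \<bullet> x" x UNIV \<phi> "\<lambda>h. \<phi>' (x \<bullet> x) * h"])
    show "((\<lambda>y. y \<bullet> y) has_derivative (\<lambda>h. x \<bullet> h + h \<bullet> x)) (at x)"
      by (auto intro!: derivative_eq_intros)
    show "(\<phi> has_derivative (*) (\<phi>' (x \<bullet> x))) (at (x \<bullet> x))"
      using deriv[of "x \<bullet> x"] x by (simp add: has_field_derivative_def)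
  qed
  then have "(yukawa \<kappa> has_derivative (\<lambda>h. \<phi>' (x \<bullet> x) * (x \<bullet> h + h \<bullet> x))) (at x)"
    by (rule has_derivative_transform_within_open[of _ _ _ _ "- {0}"]) (use x yuk in auto)
  moreover have "(\<lambda>h. \<phi>' (x \<bullet> x) * (x \<bullet> h + h \<bullet> x)) = (\<lambda>h. h \<bullet> (- S *\<^sub>R x))"
    using S' by (auto simp: fun_eq_iff inner_commute algebra_simps)
  ultimately have G: "GDERIV (yukawa \<kappa>) x :> - S *\<^sub>R x"
    by (simp add: gderiv_def)
  show ?thesis
    unfolding gradient_def S_def[symmetric]
  proof (rule the_equality)
    show "GDERIV (yukawa \<kappa>) x :> - S *\<^sub>R x" by (rule G)
  next
    fix D assume "GDERIV (yukawa \<kappa>) x :> D"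
    from this G have "(\<lambda>h. h \<bullet> D) = (\<lambda>h. h \<bullet> (- S *\<^sub>R x))"
      unfolding gderiv_def by (rule has_derivative_unique)
    then have "h \<bullet> D = h \<bullet> (- S *\<^sub>R x)" for h by metis
    then show "D = - S *\<^sub>R x" by (metis inner_commute vector_eq_rdot)
  qed
qed

section \<open>Short and long times\<close>

lemma near_measurable [measurable]:
  fixes g :: "'x \<Rightarrow> 'a::euclidean_space"
  assumes [measurable]: "g \<in> borel_measurable M"
  shows "(\<lambda>x. near \<kappa> \<tau> (g x)) \<in> borel_measurable M"
proof -
  have "near \<kappa> \<tau> y = (\<integral>t. indicator {0<..<\<tau>} t * exp (- \<kappa>\<^sup>2 * t) * heat t y \<partial>lborel)" for y :: 'a
    unfolding near_def by (rule integral_damped) auto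
  then show ?thesis by simp
qed

lemma near_slope_measurable [measurable]:
  fixes g :: "'x \<Rightarrow> 'a::euclidean_space"
  assumes [measurable]: "g \<in> borel_measurable M"
  shows "(\<lambda>x. near_slope \<kappa> \<tau> (g x)) \<in> borel_measurable M"
proof -
  have "near_slope \<kappa> \<tau> y = (\<integral>t. indicator {0<..<\<tau>} t * exp (- \<kappa>\<^sup>2 * t) * (heat t y / (2 * t)) \<partial>lborel)" for y :: 'a
    unfolding near_slope_def by (rule integral_damped) auto
  then show ?thesis by simp
qed

lemma far_measurable [measurable]:
  fixes g :: "'x \<Rightarrow> 'a::euclidean_space"
  assumes [measurable]: "g \<in> borel_measurable M"
  shows "(\<lambda>x. far \<kappa> \<tau> (g x)) \<in> borel_measurable M"
proof -
  have "far \<kappa> \<tau> y = (\<integral>t. indicator {\<tau>..} t * exp (- \<kappa>\<^sup>2 * t) * heat t y \<partial>lborel)" for y :: 'a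
    unfolding far_def by (rule integral_damped) auto
  then show ?thesis by simp
qed

lemma far_slope_measurable [measurable]:
  fixes g :: "'x \<Rightarrow> 'a::euclidean_space"
  assumes [measurable]: "g \<in> borel_measurable M"
  shows "(\<lambda>x. far_slope \<kappa> \<tau> (g x)) \<in> borel_measurable M"
proof -
  have "far_slope \<kappa> \<tau> y = (\<integral>t. indicator {\<tau>..} t * exp (- \<kappa>\<^sup>2 * t) * (heat t y / (2 * t)) \<partial>lborel)" for y :: 'a
    unfolding far_slope_def by (rule integral_damped) auto
  then show ?thesis by simp
qed

lemma near_nonneg: "0 \<le> near \<kappa> \<tau> y"
  unfolding near_def by simp

lemma near_slope_nonneg: "0 \<le> near_slope \<kappa> \<tau> y"
  unfolding near_slope_def
  by (rule Bochner_Integration.integral_nonneg_AE)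
    (use AE_damped[of "{0<..<\<tau>}" \<kappa>] in \<open>auto elim!: eventually_mono\<close>)

lemma far_bounded:
  assumes \<kappa>: "0 < \<kappa>" and \<tau>: "0 < \<tau>"
  shows "\<exists>B. \<forall>y :: 'a::euclidean_space. \<bar>far \<kappa> \<tau> y\<bar> \<le> B"
proof (intro exI allI)
  fix y :: 'a
  interpret finite_measure "damped \<kappa> {\<tau>..}" by (rule finite_damped) (use \<kappa> \<tau> in auto)
  have "norm (far \<kappa> \<tau> y) \<le> (\<integral>t. norm (heat t y) \<partial>damped \<kappa> {\<tau>..})"
    unfolding far_def by (rule integral_norm_bound)
  also have "\<dots> \<le> (\<integral>t. heat \<tau> (0 :: 'a) \<partial>damped \<kappa> {\<tau>..})"
  proof (rule integral_mono_AE')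
    show "AE t in damped \<kappa> {\<tau>..}. norm (heat t y) \<le> heat \<tau> (0 :: 'a)"
      using AE_damped[of "{\<tau>..}" \<kappa>, simplified] by eventually_elim (use \<tau> in \<open>simp add: heat_le_heat_zero\<close>)
  qed auto
  finally show "\<bar>far \<kappa> \<tau> y\<bar> \<le> (\<integral>t. heat \<tau> (0 :: 'a) \<partial>damped \<kappa> {\<tau>..})" by simp
qed

lemma inner_far_slope_bounded:
  assumes \<kappa>: "0 < \<kappa>" and \<tau>: "0 < \<tau>"
  shows "\<exists>B. \<forall>y :: 'a::euclidean_space. (norm y)\<^sup>2 * \<bar>far_slope \<kappa> \<tau> y\<bar> \<le> B"
proof (intro exI allI)
  fix y :: 'a
  let ?B = "4 * 2 powr (real DIM('a) / 2) * heat \<tau> (0 :: 'a)"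
  interpret finite_measure "damped \<kappa> {\<tau>..}" by (rule finite_damped) (use \<kappa> \<tau> in auto)
  have "(norm y)\<^sup>2 * \<bar>far_slope \<kappa> \<tau> y\<bar> = norm (\<integral>t. (norm y)\<^sup>2 * (heat t y / (2 * t)) \<partial>damped \<kappa> {\<tau>..})"
    unfolding far_slope_def integral_mult_right_zero by (simp add: abs_mult)
  also have "\<dots> \<le> (\<integral>t. norm ((norm y)\<^sup>2 * (heat t y / (2 * t))) \<partial>damped \<kappa> {\<tau>..})"
    by (rule integral_norm_bound)
  also have "\<dots> \<le> (\<integral>t. ?B \<partial>damped \<kappa> {\<tau>..})"
  proof (rule integral_mono_AE')
    show "AE t in damped \<kappa> {\<tau>..}. norm ((norm y)\<^sup>2 * (heat t y / (2 * t))) \<le> ?B"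
      using AE_damped[of "{\<tau>..}" \<kappa>, simplified]
    proof eventually_elim
      fix t assume "\<tau> \<le> t"
      then have t: "0 < t" using \<tau> by simp
      have "norm ((norm y)\<^sup>2 * (heat t y / (2 * t))) = (norm y)\<^sup>2 * heat t y / (2 * t)" using t by simp
      also have "\<dots> \<le> 8 * t * 2 powr (real DIM('a) / 2) * heat (2 * t) y / (2 * t)"
        using t by (intro divide_right_mono norm_power2_heat_le) auto
      also have "\<dots> = 4 * 2 powr (real DIM('a) / 2) * heat (2 * t) y" using t by simp
      also have "\<dots> \<le> ?B" using \<tau> \<open>\<tau> \<le> t\<close> by (intro mult_left_mono heat_le_heat_zero) auto
      finally show "norm ((norm y)\<^sup>2 * (heat t y / (2 * t))) \<le> ?B" .
    qed
  qed auto
  finally show "(norm y)\<^sup>2 * \<bar>far_slope \<kappa> \<tau> y\<bar> \<le> (\<integral>t. ?B \<partial>damped \<kappa> {\<tau>..})" .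
qed

text \<open>If \<open>f\<close> is not integrable, its Bochner integral is the default value 0 and
  the inequality is trivial. So the value of \<open>near\<close> at the origin, where its time
  integral may diverge, needs no separate treatment.\<close>

lemma ennreal_integral_le_nn_integral:
  assumes "f \<in> borel_measurable M" "\<And>x. 0 \<le> f x"
  shows "ennreal (\<integral>x. f x \<partial>M) \<le> (\<integral>\<^sup>+x. ennreal (f x) \<partial>M)"
  using assms by (cases "integrable M f") (auto simp: nn_integral_eq_integral not_integrable_integral_eq)

lemma nn_integral_near:
  fixes x :: "'a::euclidean_space"
  assumes \<tau>: "0 \<le> \<tau>"
  shows "(\<integral>\<^sup>+z. ennreal (near \<kappa> \<tau> (z - x)) \<partial>lborel) \<le> ennreal \<tau>"
proof -
  have "(\<integral>\<^sup>+z. ennreal (near \<kappa> \<tau> (z - x)) \<partial>lborel)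
      \<le> (\<integral>\<^sup>+z. \<integral>\<^sup>+t. ennreal (indicator {0<..<\<tau>} t * exp (- \<kappa>\<^sup>2 * t)) * ennreal (heat t (z - x)) \<partial>lborel \<partial>lborel)"
  proof (rule nn_integral_mono)
    fix z
    have "ennreal (near \<kappa> \<tau> (z - x)) \<le> (\<integral>\<^sup>+t. ennreal (heat t (z - x)) \<partial>damped \<kappa> {0<..<\<tau>})"
      unfolding near_def by (rule ennreal_integral_le_nn_integral) auto
    then show "ennreal (near \<kappa> \<tau> (z - x)) \<le> (\<integral>\<^sup>+t. ennreal (indicator {0<..<\<tau>} t * exp (- \<kappa>\<^sup>2 * t)) * ennreal (heat t (z - x)) \<partial>lborel)"
      by (subst (asm) nn_integral_damped) auto
  qed
  also have "\<dots> = (\<integral>\<^sup>+t. \<integral>\<^sup>+z. ennreal (indicator {0<..<\<tau>} t * exp (- \<kappa>\<^sup>2 * t)) * ennreal (heat t (z - x)) \<partial>lborel \<partial>lborel)"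
    by (rule lborel_pair.Fubini') measurable
  also have "\<dots> \<le> (\<integral>\<^sup>+t. indicator {0<..<\<tau>} t \<partial>lborel)"
  proof (rule nn_integral_mono)
    fix t :: real
    show "(\<integral>\<^sup>+z. ennreal (indicator {0<..<\<tau>} t * exp (- \<kappa>\<^sup>2 * t)) * ennreal (heat t (z - x)) \<partial>lborel) \<le> indicator {0<..<\<tau>} t"
    proof (cases "t \<in> {0<..<\<tau>}")
      case True
      then have "(\<integral>\<^sup>+z. ennreal (indicator {0<..<\<tau>} t * exp (- \<kappa>\<^sup>2 * t)) * ennreal (heat t (z - x)) \<partial>lborel)
          = ennreal (exp (- \<kappa>\<^sup>2 * t))"
        by (subst nn_integral_cmult) (auto simp: nn_integral_heat)
      also have "\<dots> \<le> ennreal 1" using True by (intro ennreal_leI) (simp add: zero_le_mult_iff)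
      finally show ?thesis using True by simp
    qed simp
  qed
  also have "\<dots> = ennreal \<tau>" using \<tau> by simp
  finally show ?thesis .
qed

lemma near_eq: "near \<kappa> \<tau> y = (\<integral>t. indicator {0<..<\<tau>} t * exp (- \<kappa>\<^sup>2 * t) * heat t y \<partial>lborel)"
  unfolding near_def by (rule integral_damped) auto

lemma integrable_near:
  assumes "0 < \<kappa>" "y \<noteq> 0"
  shows "integrable lborel (\<lambda>t. indicator {0<..<\<tau>} t * exp (- \<kappa>\<^sup>2 * t) * heat t (y :: 'a::euclidean_space))"
proof -
  have "integrable (damped \<kappa> {0<..<\<tau>}) (\<lambda>t. heat t y)"
    by (rule integrable_heat_damped) (use assms in auto)
  then show ?thesis by (subst (asm) integrable_damped_iff) auto
qed

lemma near_mono: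
  assumes "0 < \<kappa>" "y \<noteq> 0" "\<tau> \<le> \<tau>'"
  shows "near \<kappa> \<tau> (y :: 'a::euclidean_space) \<le> near \<kappa> \<tau>' y"
  unfolding near_eq
  by (rule integral_mono[OF integrable_near integrable_near]) (use assms in \<open>auto simp: indicator_def\<close>)

text \<open>Inside the time integral the squared distance over \<open>t\<close> is traded for the
  kernel at time \<open>2 * t\<close>, and substituting the doubled time doubles the window. The
  factor \<open>exp (\<kappa>\<^sup>2 * \<tau>)\<close> pays for the stronger damping at the doubled
  time.\<close>

lemma norm_power2_near_slope_le:
  assumes \<kappa>: "0 < \<kappa>" and y: "y \<noteq> 0"
  shows "(norm y)\<^sup>2 * near_slope \<kappa> \<tau> y
    \<le> 2 * 2 powr (real DIM('a) / 2) * exp (\<kappa>\<^sup>2 * \<tau>) * near \<kappa> (2 * \<tau>) (y :: 'a::euclidean_space)"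
proof -
  let ?K = "4 * 2 powr (real DIM('a) / 2) * exp (\<kappa>\<^sup>2 * \<tau>)"
  define G where "G = (\<lambda>t. indicator {0<..<2 * \<tau>} t * exp (- \<kappa>\<^sup>2 * t) * heat t y)"
  have G: "integrable lborel G" unfolding G_def by (rule integrable_near[OF \<kappa> y])
  have G2: "integrable lborel (\<lambda>t. G (0 + 2 * t))" by (rule lborel_integrable_real_affine[OF G]) simp
  have "(norm y)\<^sup>2 * near_slope \<kappa> \<tau> y
      = (\<integral>t. (norm y)\<^sup>2 * (indicator {0<..<\<tau>} t * exp (- \<kappa>\<^sup>2 * t) * (heat t y / (2 * t))) \<partial>lborel)"
    unfolding near_slope_def integral_mult_right_zero by (subst integral_damped) auto
  also have "\<dots> \<le> (\<integral>t. ?K * G (0 + 2 * t) \<partial>lborel)"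
  proof (rule integral_mono_AE')
    show "integrable lborel (\<lambda>t. ?K * G (0 + 2 * t))" using G2 by (rule integrable_mult_right)
    show "AE t in lborel. (norm y)\<^sup>2 * (indicator {0<..<\<tau>} t * exp (- \<kappa>\<^sup>2 * t) * (heat t y / (2 * t))) \<le> ?K * G (0 + 2 * t)"
    proof (rule AE_I2)
      fix t :: real
      show "(norm y)\<^sup>2 * (indicator {0<..<\<tau>} t * exp (- \<kappa>\<^sup>2 * t) * (heat t y / (2 * t))) \<le> ?K * G (0 + 2 * t)"
      proof (cases "t \<in> {0<..<\<tau>}")
        case True
        then have t: "0 < t" "t \<le> \<tau>" by auto
        have "(norm y)\<^sup>2 * heat t y / (2 * t) \<le> 8 * t * 2 powr (real DIM('a) / 2) * heat (2 * t) y / (2 * t)"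
          using t by (intro divide_right_mono norm_power2_heat_le) auto
        also have "\<dots> = 4 * 2 powr (real DIM('a) / 2) * heat (2 * t) y" using t by simp
        finally have 1: "(norm y)\<^sup>2 * heat t y / (2 * t) \<le> 4 * 2 powr (real DIM('a) / 2) * heat (2 * t) y" .
        have "\<kappa>\<^sup>2 * t \<le> \<kappa>\<^sup>2 * \<tau>" using t by (intro mult_left_mono) auto
        then have 2: "exp (- \<kappa>\<^sup>2 * t) \<le> exp (\<kappa>\<^sup>2 * \<tau>) * exp (- \<kappa>\<^sup>2 * (2 * t))"
          by (simp add: mult.commute flip: exp_add)
        have "exp (- \<kappa>\<^sup>2 * t) * ((norm y)\<^sup>2 * heat t y / (2 * t))
            \<le> (exp (\<kappa>\<^sup>2 * \<tau>) * exp (- \<kappa>\<^sup>2 * (2 * t))) * (4 * 2 powr (real DIM('a) / 2) * heat (2 * t) y)"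
          using t by (intro mult_mono 1 2) auto
        then show ?thesis using True by (simp add: G_def mult_ac)
      qed (auto simp: G_def)
    qed
    show "AE t in lborel. 0 \<le> ?K * G (0 + 2 * t)"
      by (auto simp: G_def indicator_def)
  qed
  also have "\<dots> = ?K * (\<integral>t. G (0 + 2 * t) \<partial>lborel)" by simp
  also have "(\<integral>t. G (0 + 2 * t) \<partial>lborel) = 1 / 2 * near \<kappa> (2 * \<tau>) y"
    using lborel_integral_real_affine[of 2 G 0] by (simp add: near_eq G_def)
  finally show ?thesis by (simp add: mult_ac)
qed

text \<open>Up to a factor, the kernel at time \<open>s\<close> is below the kernel at each time
  between \<open>s\<close> and \<open>2 * s\<close>. Integrating over that interval, of length
  \<open>s\<close>, controls a smeared particle interaction by the early one.\<close>

lemma heat_le_near: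
  assumes \<kappa>: "0 < \<kappa>" and y: "y \<noteq> 0" and s: "0 < s"
  shows "s * heat s y \<le> 2 powr (real DIM('a) / 2) * exp (2 * \<kappa>\<^sup>2 * s) * near \<kappa> (2 * s) (y :: 'a::euclidean_space)"
proof -
  let ?c = "2 powr (real DIM('a) / 2) * exp (2 * \<kappa>\<^sup>2 * s)"
  have "s * heat s y = (\<integral>t. indicator {s..<2 * s} t * heat s y \<partial>lborel)" using s by simp
  also have "\<dots> \<le> (\<integral>t. ?c * (indicator {0<..<2 * s} t * exp (- \<kappa>\<^sup>2 * t) * heat t y) \<partial>lborel)"
  proof (rule integral_mono)
    show "integrable lborel (\<lambda>t. indicator {s..<2 * s} t * heat s y)"
      using s by (intro integrable_mult_left) simp
    show "integrable lborel (\<lambda>t. ?c * (indicator {0<..<2 * s} t * exp (- \<kappa>\<^sup>2 * t) * heat t y))"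
      by (intro integrable_mult_right integrable_near \<kappa> y)
    show "indicator {s..<2 * s} t * heat s y \<le> ?c * (indicator {0<..<2 * s} t * exp (- \<kappa>\<^sup>2 * t) * heat t y)" for t
    proof (cases "t \<in> {s..<2 * s}")
      case True
      then have t: "s \<le> t" "t < 2 * s" by auto
      have "heat s y \<le> (t / s) powr (real DIM('a) / 2) * heat t y" by (rule heat_mono_scale[OF s t(1)])
      also have "\<dots> \<le> 2 powr (real DIM('a) / 2) * heat t y"
        using s t by (intro mult_right_mono powr_mono2) (auto simp: divide_le_eq)
      finally have 1: "heat s y \<le> 2 powr (real DIM('a) / 2) * heat t y" .
      have "\<kappa>\<^sup>2 * t \<le> \<kappa>\<^sup>2 * (2 * s)" using t by (intro mult_left_mono) auto
      then have "1 \<le> exp (2 * \<kappa>\<^sup>2 * s) * exp (- \<kappa>\<^sup>2 * t)" by (simp flip: exp_add)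
      then have "1 * heat s y \<le> (exp (2 * \<kappa>\<^sup>2 * s) * exp (- \<kappa>\<^sup>2 * t)) * (2 powr (real DIM('a) / 2) * heat t y)"
        by (intro mult_mono 1) auto
      then show ?thesis using True s by (simp add: mult_ac)
    qed auto
  qed
  also have "\<dots> = ?c * near \<kappa> (2 * s) y" by (simp add: near_eq)
  finally show ?thesis .
qed

text \<open>From dimension three on, the kernel at the origin is integrable at large times without
  help from the damping, so the bound is uniform in \<kappa>. The constant 2 stems from the exponent
  exceeding 1 by at least one half.\<close>

lemma far_zero_le_powr:
  assumes \<kappa>: "0 < \<kappa>" and \<tau>: "0 < \<tau>" and d: "3 \<le> DIM('a)"
  shows "far \<kappa> \<tau> (0 :: 'a::euclidean_space) \<le> 2 * \<tau> powr (1 - real DIM('a) / 2)"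
proof -
  define p where "p = real DIM('a) / 2"
  have p: "3 / 2 \<le> p" using d by (simp add: p_def)
  have "ennreal (far \<kappa> \<tau> (0 :: 'a)) \<le> (\<integral>\<^sup>+t. ennreal (heat t (0 :: 'a)) \<partial>damped \<kappa> {\<tau>..})"
    unfolding far_def by (rule ennreal_integral_le_nn_integral) auto
  also have "\<dots> = (\<integral>\<^sup>+t. ennreal (indicator {\<tau>..} t * exp (- \<kappa>\<^sup>2 * t)) * ennreal (heat t (0 :: 'a)) \<partial>lborel)"
    by (rule nn_integral_damped) auto
  also have "\<dots> \<le> (\<integral>\<^sup>+t. ennreal (t powr (- p)) * indicator {\<tau>..} t \<partial>lborel)"
  proof (rule nn_integral_mono)
    fix t :: real
    show "ennreal (indicator {\<tau>..} t * exp (- \<kappa>\<^sup>2 * t)) * ennreal (heat t (0 :: 'a)) \<le> ennreal (t powr (- p)) * indicator {\<tau>..} t"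
    proof (cases "\<tau> \<le> t")
      case True
      then have t: "0 < t" using \<tau> by simp
      have "heat t (0 :: 'a) = (4 * pi * t) powr (- p)" by (simp add: heat_def p_def)
      also have "\<dots> \<le> t powr (- p)" using t p pi_ge_two by (intro powr_mono2') auto
      finally have "exp (- \<kappa>\<^sup>2 * t) * heat t (0 :: 'a) \<le> 1 * t powr (- p)"
        using t by (intro mult_mono) auto
      then show ?thesis using True by (simp add: ennreal_leI flip: ennreal_mult)
    qed simp
  qed
  also have "\<dots> = ennreal (0 - \<tau> powr (1 - p) / (1 - p))"
  proof (rule nn_integral_FTC_atLeast)
    show "((\<lambda>t. t powr (1 - p) / (1 - p)) has_real_derivative t powr (- p)) (at t)" if "\<tau> \<le> t" for t
      using that \<tau> p by (auto intro!: derivative_eq_intros)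
    have "((\<lambda>t. t powr (- (p - 1))) \<longlongrightarrow> 0) at_top"
      using p by (intro tendsto_neg_powr filterlim_ident) auto
    then have "((\<lambda>t. t powr (- (p - 1)) / (1 - p)) \<longlongrightarrow> 0 / (1 - p)) at_top"
      using p by (intro tendsto_divide tendsto_const) auto
    then show "((\<lambda>t. t powr (1 - p) / (1 - p)) \<longlongrightarrow> 0) at_top" by simp
  qed auto
  also have "0 - \<tau> powr (1 - p) / (1 - p) = \<tau> powr (1 - p) / (p - 1)"
    using p by (simp add: field_simps)
  finally have "far \<kappa> \<tau> (0 :: 'a) \<le> \<tau> powr (1 - p) / (p - 1)"
    using p by (subst (asm) ennreal_le_iff) auto
  also have "\<dots> \<le> \<tau> powr (1 - p) / (1 / 2)" using p by (intro divide_left_mono) auto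
  finally show ?thesis by (simp add: p_def)
qed

text \<open>In dimension two the kernel at the origin is a multiple of \<open>1 / t\<close>, and
  only the damping makes the time integral converge. The dependence on \<kappa> is kept explicit,
  since the normalization has to cancel it.\<close>

lemma far_zero_le_ln:
  assumes \<kappa>: "0 < \<kappa>" and \<tau>: "0 < \<tau>" and d: "DIM('a) = 2"
  shows "far \<kappa> \<tau> (0 :: 'a::euclidean_space) \<le> (max 0 (- ln (\<kappa>\<^sup>2 * \<tau>)) + 1) / (4 * pi)"
proof -
  \<comment> \<open>The time at which damping sets in. Before it the damping is dropped and
    \<open>1 / t\<close> integrates to a logarithm; after it \<open>1 / t\<close> is at most
    \<open>\<kappa>\<^sup>2\<close> and the exponential contributes total mass at most 1.\<close>
  define b where "b = 1 / \<kappa>\<^sup>2"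
  have b: "0 < b" using \<kappa> by (simp add: b_def)
  have "ennreal (far \<kappa> \<tau> (0 :: 'a)) \<le> (\<integral>\<^sup>+t. ennreal (heat t (0 :: 'a)) \<partial>damped \<kappa> {\<tau>..})"
    unfolding far_def by (rule ennreal_integral_le_nn_integral) auto
  also have "\<dots> = (\<integral>\<^sup>+t. ennreal (indicator {\<tau>..} t * exp (- \<kappa>\<^sup>2 * t)) * ennreal (heat t (0 :: 'a)) \<partial>lborel)"
    by (rule nn_integral_damped) auto
  also have "\<dots> \<le> (\<integral>\<^sup>+t. ennreal (1 / (4 * pi)) * (ennreal (1 / t) * indicator {\<tau>..b} t
      + ennreal (\<kappa>\<^sup>2 * exp (- \<kappa>\<^sup>2 * t)) * indicator {0..} t) \<partial>lborel)"
  proof (rule nn_integral_mono)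
    fix t :: real
    show "ennreal (indicator {\<tau>..} t * exp (- \<kappa>\<^sup>2 * t)) * ennreal (heat t (0 :: 'a))
      \<le> ennreal (1 / (4 * pi)) * (ennreal (1 / t) * indicator {\<tau>..b} t
        + ennreal (\<kappa>\<^sup>2 * exp (- \<kappa>\<^sup>2 * t)) * indicator {0..} t)"
    proof (cases "\<tau> \<le> t")
      case True
      then have t: "0 < t" using \<tau> by simp
      have h: "heat t (0 :: 'a) = 1 / (4 * pi) * (1 / t)"
        using t by (simp add: heat_def d powr_minus_divide)
      have eq: "ennreal (indicator {\<tau>..} t * exp (- \<kappa>\<^sup>2 * t)) * ennreal (heat t (0 :: 'a))
          = ennreal (1 / (4 * pi)) * ennreal (exp (- \<kappa>\<^sup>2 * t) * (1 / t))"
        unfolding h using True t by (simp add: mult_ac flip: ennreal_mult)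
      have "ennreal (exp (- \<kappa>\<^sup>2 * t) * (1 / t)) \<le> ennreal (1 / t) * indicator {\<tau>..b} t
          + ennreal (\<kappa>\<^sup>2 * exp (- \<kappa>\<^sup>2 * t)) * indicator {0..} t"
      proof (cases "t \<le> b")
        case True
        have "exp (- \<kappa>\<^sup>2 * t) * (1 / t) \<le> 1 * (1 / t)" using t by (intro mult_right_mono) auto
        then have "ennreal (exp (- \<kappa>\<^sup>2 * t) * (1 / t)) \<le> ennreal (1 / t)" by (intro ennreal_leI) simp
        also have "\<dots> \<le> ennreal (1 / t) + ennreal (\<kappa>\<^sup>2 * exp (- \<kappa>\<^sup>2 * t)) * indicator {0..} t"
          by simp
        finally show ?thesis using True \<open>\<tau> \<le> t\<close> by simp
      next
        case False
        then have "1 / t \<le> \<kappa>\<^sup>2" using t \<kappa> by (simp add: b_def field_simps)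
        then have "exp (- \<kappa>\<^sup>2 * t) * (1 / t) \<le> exp (- \<kappa>\<^sup>2 * t) * \<kappa>\<^sup>2" by (intro mult_left_mono) auto
        then show ?thesis using t False by (simp add: ennreal_leI mult.commute)
      qed
      then show ?thesis unfolding eq by (intro mult_left_mono) auto
    qed simp
  qed
  also have "\<dots> = ennreal (1 / (4 * pi)) * ((\<integral>\<^sup>+t. ennreal (1 / t) * indicator {\<tau>..b} t \<partial>lborel)
      + (\<integral>\<^sup>+t. ennreal (\<kappa>\<^sup>2 * exp (- \<kappa>\<^sup>2 * t)) * indicator {0..} t \<partial>lborel))"
    by (subst nn_integral_cmult, simp, subst nn_integral_add) auto
  also have "(\<integral>\<^sup>+t. ennreal (\<kappa>\<^sup>2 * exp (- \<kappa>\<^sup>2 * t)) * indicator {0..} t \<partial>lborel) = ennreal (0 - (- exp (- \<kappa>\<^sup>2 * 0)))"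
  proof (rule nn_integral_FTC_atLeast)
    show "((\<lambda>t. - exp (- \<kappa>\<^sup>2 * t)) has_real_derivative \<kappa>\<^sup>2 * exp (- \<kappa>\<^sup>2 * t)) (at t)" for t
      by (auto intro!: derivative_eq_intros)
    have "filterlim (\<lambda>t. - (\<kappa>\<^sup>2 * t)) at_bot at_top"
      unfolding filterlim_uminus_at_top[symmetric]
      by (rule filterlim_tendsto_pos_mult_at_top[OF tendsto_const _ filterlim_ident]) (use \<kappa> in simp)
    then have "((\<lambda>t. exp (- \<kappa>\<^sup>2 * t)) \<longlongrightarrow> 0) at_top"
      by (intro filterlim_compose[OF exp_at_bot]) simp
    then show "((\<lambda>t. - exp (- \<kappa>\<^sup>2 * t)) \<longlongrightarrow> 0) at_top" using tendsto_minus by fastforce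
  qed auto
  also have "(\<integral>\<^sup>+t. ennreal (1 / t) * indicator {\<tau>..b} t \<partial>lborel) \<le> ennreal (max 0 (- ln (\<kappa>\<^sup>2 * \<tau>)))"
  proof (cases "\<tau> \<le> b")
    case True
    have "(\<integral>\<^sup>+t. ennreal (1 / t) * indicator {\<tau>..b} t \<partial>lborel) = ennreal (ln b - ln \<tau>)"
    proof (rule nn_integral_FTC_Icc)
      show "(ln has_real_derivative 1 / t) (at t)" if "t \<in> {\<tau>..b}" for t
        using that \<tau> by (auto intro!: derivative_eq_intros)
    qed (use True \<tau> in auto)
    also have "ln b - ln \<tau> = - ln (\<kappa>\<^sup>2 * \<tau>)" using \<kappa> \<tau> by (simp add: b_def ln_div ln_mult)
    finally show ?thesis by (simp add: ennreal_leI)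
  qed simp
  finally have "ennreal (far \<kappa> \<tau> (0 :: 'a)) \<le> ennreal (1 / (4 * pi)) * (ennreal (max 0 (- ln (\<kappa>\<^sup>2 * \<tau>))) + ennreal 1)"
    by (simp add: add_right_mono mult_left_mono)
  also have "\<dots> = ennreal (1 / (4 * pi) * (max 0 (- ln (\<kappa>\<^sup>2 * \<tau>)) + 1))"
  proof -
    have gen: "ennreal c * (ennreal m + ennreal 1) = ennreal (c * (m + 1))" if "0 \<le> c" "0 \<le> m" for c m
      using that by (simp add: ennreal_mult ennreal_plus)
    show ?thesis by (rule gen) auto
  qed
  finally show ?thesis by (subst (asm) ennreal_le_iff) (auto simp: add_nonneg_nonneg)
qed

section \<open>Point configurations\<close>

definition sum_measure :: "'a measure \<Rightarrow> 'a measure \<Rightarrow> 'a measure" where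
  "sum_measure A B = measure_of (space A) (sets A) (\<lambda>S. emeasure A S + emeasure B S)"

lemma sets_sum_measure [simp, measurable_cong]: "sets (sum_measure A B) = sets A"
  by (simp add: sum_measure_def sets.sigma_sets_eq)

lemma space_sum_measure [simp]: "space (sum_measure A B) = space A"
  by (simp add: sum_measure_def)

lemma emeasure_sum_measure:
  assumes "sets B = sets A" "S \<in> sets A"
  shows "emeasure (sum_measure A B) S = emeasure A S + emeasure B S"
proof (rule emeasure_measure_of[OF sum_measure_def])
  show "countably_additive (sets (sum_measure A B)) (\<lambda>S. emeasure A S + emeasure B S)"
    unfolding countably_additive_def
  proof (intro allI impI)
    fix F :: "nat \<Rightarrow> 'a set"
    assume F: "range F \<subseteq> sets (sum_measure A B)" "disjoint_family F" "\<Union> (range F) \<in> sets (sum_measure A B)"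
    have "(\<Sum>i. emeasure A (F i) + emeasure B (F i)) = (\<Sum>i. emeasure A (F i)) + (\<Sum>i. emeasure B (F i))"
      by (intro suminf_add[symmetric]) auto
    then show "(\<Sum>i. emeasure A (F i) + emeasure B (F i)) = emeasure A (\<Union> (range F)) + emeasure B (\<Union> (range F))"
      using F assms(1) by (simp add: suminf_emeasure)
  qed
qed (use assms in \<open>auto simp: positive_def sets.space_closed\<close>)

lemma nn_integral_sum_measure:
  assumes eq: "sets B = sets A" and f: "f \<in> borel_measurable A"
  shows "(\<integral>\<^sup>+x. f x \<partial>sum_measure A B) = (\<integral>\<^sup>+x. f x \<partial>A) + (\<integral>\<^sup>+x. f x \<partial>B)"
proof -
  have cong: "g \<in> borel_measurable B \<longleftrightarrow> g \<in> borel_measurable A" "g \<in> borel_measurable (sum_measure A B) \<longleftrightarrow> g \<in> borel_measurable A"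
    for g :: "'a \<Rightarrow> ennreal"
    using measurable_cong_sets[OF eq refl] measurable_cong_sets[OF sets_sum_measure refl] by blast+
  have sp: "space B = space A" using eq by (rule sets_eq_imp_space_eq)
  show ?thesis
    using f
  proof (induction rule: borel_measurable_induct)
    case (cong f g)
    then show ?case
      using nn_integral_cong[of "sum_measure A B" f g] nn_integral_cong[of A f g] nn_integral_cong[of B f g] by (simp add: sp)
  next
    case (set S)
    then show ?case using emeasure_sum_measure[OF eq set] eq by simp
  next
    case (mult u c)
    then show ?case using cong by (simp add: nn_integral_cmult distrib_left)
  next
    case (add u v)
    then show ?case using cong by (simp add: nn_integral_add ac_simps)
  next
    case (seq U)
    have U: "U i \<in> borel_measurable A" for i using seq by simp
    have inc: "incseq (\<lambda>i. \<integral>\<^sup>+x. U i x \<partial>A)" "incseq (\<lambda>i. \<integral>\<^sup>+x. U i x \<partial>B)"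
      using seq(3) by (auto simp: incseq_def le_fun_def intro!: nn_integral_mono)
    have "(\<integral>\<^sup>+x. (SUP i. U i) x \<partial>sum_measure A B) = (SUP i. \<integral>\<^sup>+x. U i x \<partial>sum_measure A B)"
      unfolding SUP_apply using seq U cong by (intro nn_integral_monotone_convergence_SUP) auto
    also have "\<dots> = (SUP i. (\<integral>\<^sup>+x. U i x \<partial>A) + (\<integral>\<^sup>+x. U i x \<partial>B))" using seq by simp
    also have "\<dots> = (SUP i. \<integral>\<^sup>+x. U i x \<partial>A) + (SUP i. \<integral>\<^sup>+x. U i x \<partial>B)"
      using inc by (rule ennreal_SUP_add)
    also have "(SUP i. \<integral>\<^sup>+x. U i x \<partial>A) = (\<integral>\<^sup>+x. (SUP i. U i) x \<partial>A)"
      unfolding SUP_apply using seq U by (intro nn_integral_monotone_convergence_SUP[symmetric]) auto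
    also have "(SUP i. \<integral>\<^sup>+x. U i x \<partial>B) = (\<integral>\<^sup>+x. (SUP i. U i) x \<partial>B)"
      unfolding SUP_apply using seq U cong by (intro nn_integral_monotone_convergence_SUP[symmetric]) auto
    finally show ?case by simp
  qed
qed

lemma finite_sum_measure:
  assumes "sets B = sets A" "finite_measure A" "finite_measure B"
  shows "finite_measure (sum_measure A B)"
proof (rule finite_measureI)
  have "emeasure (sum_measure A B) (space A) = emeasure A (space A) + emeasure B (space B)"
    using emeasure_sum_measure[OF assms(1) sets.top] sets_eq_imp_space_eq[OF assms(1)] by simp
  then show "emeasure (sum_measure A B) (space (sum_measure A B)) \<noteq> \<infinity>"
    using finite_measure.emeasure_finite[OF assms(2)] finite_measure.emeasure_finite[OF assms(3)] by simp
qed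

lemma integral_sum_measure:
  fixes f :: "'a \<Rightarrow> real"
  assumes eq: "sets B = sets A" and fin: "finite_measure A" "finite_measure B"
    and f: "f \<in> borel_measurable A" and b: "\<And>x. \<bar>f x\<bar> \<le> c"
  shows "(\<integral>x. f x \<partial>sum_measure A B) = (\<integral>x. f x \<partial>A) + (\<integral>x. f x \<partial>B)"
proof -
  have meas: "f \<in> borel_measurable B" "f \<in> borel_measurable (sum_measure A B)"
    using f measurable_cong_sets[OF eq refl] measurable_cong_sets[OF sets_sum_measure refl] by blast+
  have int: "integrable A f" "integrable B f" "integrable (sum_measure A B) f"
    by (rule finite_measure.integrable_const_bound[where B=c]; use b f meas fin finite_sum_measure[OF eq fin] in simp)+
  have fin': "(\<integral>\<^sup>+x. ennreal (f x) \<partial>N) < \<infinity>" "(\<integral>\<^sup>+x. ennreal (- f x) \<partial>N) < \<infinity>" if "integrable N f" for N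
    using that by (auto simp: real_integrable_def less_top[symmetric])
  have pos: "(\<integral>\<^sup>+x. ennreal (f x) \<partial>sum_measure A B) = (\<integral>\<^sup>+x. ennreal (f x) \<partial>A) + (\<integral>\<^sup>+x. ennreal (f x) \<partial>B)"
    using f by (intro nn_integral_sum_measure[OF eq]) auto
  have neg: "(\<integral>\<^sup>+x. ennreal (- f x) \<partial>sum_measure A B) = (\<integral>\<^sup>+x. ennreal (- f x) \<partial>A) + (\<integral>\<^sup>+x. ennreal (- f x) \<partial>B)"
    using f by (intro nn_integral_sum_measure[OF eq]) auto
  show ?thesis
    unfolding real_lebesgue_integral_def[OF int(1)] real_lebesgue_integral_def[OF int(2)] real_lebesgue_integral_def[OF int(3)]
      pos neg using fin'[OF int(1)] fin'[OF int(2)] by (simp add: enn2real_plus)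
qed

definition pairing :: "('a \<times> 'a \<Rightarrow> real) \<Rightarrow> 'a measure \<Rightarrow> 'a measure \<Rightarrow> real" where
  "pairing K A B = (\<integral>q. K q \<partial>(A \<Otimes>\<^sub>M B))"

lemma pairing_iterated:
  fixes K :: "'a::euclidean_space \<times> 'a \<Rightarrow> real"
  assumes fin: "finite_measure A" "finite_measure B" and s: "sets A = sets borel" "sets B = sets borel"
    and K: "K \<in> borel_measurable (borel \<Otimes>\<^sub>M borel)" and b: "\<And>q. \<bar>K q\<bar> \<le> c"
  shows "integrable (A \<Otimes>\<^sub>M B) K" "pairing K A B = (\<integral>x. \<integral>y. K (x, y) \<partial>B \<partial>A)"
    "(\<lambda>x. \<integral>y. K (x, y) \<partial>B) \<in> borel_measurable borel"
    "\<bar>\<integral>y. K (x, y) \<partial>B\<bar> \<le> measure B (space B) * c"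
proof -
  interpret A: finite_measure A by (rule fin)
  interpret B: finite_measure B by (rule fin)
  interpret P: pair_sigma_finite A B ..
  interpret AB: finite_measure "A \<Otimes>\<^sub>M B" by (rule finite_measure_pair_measure[OF fin(2,1)])
  have ss: "sets (A \<Otimes>\<^sub>M B) = sets (borel \<Otimes>\<^sub>M borel)" using s by (intro sets_pair_measure_cong)
  have meas: "K \<in> borel_measurable (A \<Otimes>\<^sub>M B)" using K measurable_cong_sets[OF ss refl] by blast
  show int: "integrable (A \<Otimes>\<^sub>M B) K"
    using b meas by (intro AB.integrable_const_bound[of _ c]) auto
  show "pairing K A B = (\<integral>x. \<integral>y. K (x, y) \<partial>B \<partial>A)"
    unfolding pairing_def using P.integral_fst'[OF int] by simp
  have "(\<lambda>x. \<integral>y. K (x, y) \<partial>B) \<in> borel_measurable A"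
    using meas by (intro B.borel_measurable_lebesgue_integral) simp
  then show "(\<lambda>x. \<integral>y. K (x, y) \<partial>B) \<in> borel_measurable borel"
    using measurable_cong_sets[OF s(1) refl] by blast
  have c: "0 \<le> c" using order.trans[OF abs_ge_zero b] .
  have "norm (\<integral>y. K (x, y) \<partial>B) \<le> (\<integral>y. c \<partial>B)"
    using b c by (intro order.trans[OF integral_norm_bound] integral_mono_AE') auto
  then show "\<bar>\<integral>y. K (x, y) \<partial>B\<bar> \<le> measure B (space B) * c" by simp
qed

text \<open>The weight is almost everywhere constant on each summand, so the double integral expands
  bilinearly. Values 1 and - 1 give the product of the signed difference with itself, the constant
  weight 1 the product of the sum.\<close>

lemma pairing_sum_measure:
  fixes K :: "'a::euclidean_space \<times> 'a \<Rightarrow> real" and \<sigma> :: "'a \<Rightarrow> real"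
  assumes fin: "finite_measure A" "finite_measure B" and s: "sets A = sets borel" "sets B = sets borel"
    and K: "K \<in> borel_measurable (borel \<Otimes>\<^sub>M borel)" and b: "\<And>q. \<bar>K q\<bar> \<le> c"
    and \<sigma>[measurable]: "\<sigma> \<in> borel_measurable borel" "\<And>x. \<bar>\<sigma> x\<bar> \<le> 1"
    and AE: "AE x in A. \<sigma> x = \<alpha>" "AE x in B. \<sigma> x = \<beta>"
  shows "(\<integral>q. \<sigma> (fst q) * \<sigma> (snd q) * K q \<partial>(sum_measure A B \<Otimes>\<^sub>M sum_measure A B))
    = \<alpha> * \<alpha> * pairing K A A + \<alpha> * \<beta> * pairing K A B + \<beta> * \<alpha> * pairing K B A + \<beta> * \<beta> * pairing K B B"
proof -
  let ?M = "sum_measure A B"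
  have eq: "sets B = sets A" using s by simp
  have finM: "finite_measure ?M" by (rule finite_sum_measure[OF eq fin])
  have sM: "sets ?M = sets borel" using s by simp
  define K' where "K' = (\<lambda>q. \<sigma> (fst q) * \<sigma> (snd q) * K q)"
  note [measurable] = K
  have mult_le: "\<bar>\<sigma> x * r\<bar> \<le> R" if "\<bar>r\<bar> \<le> R" for x r R
    using mult_mono[OF \<sigma>(2)[of x] that] by (simp add: abs_mult)
  have K'm: "K' \<in> borel_measurable (borel \<Otimes>\<^sub>M borel)" unfolding K'_def by measurable
  have K'b: "\<bar>K' q\<bar> \<le> c" for q unfolding K'_def mult.assoc by (intro mult_le b)
  have cong: "(\<integral>x. \<sigma> x * f x \<partial>N) = \<gamma> * (\<integral>x. f x \<partial>N)"
    if "AE x in N. \<sigma> x = \<gamma>" "f \<in> borel_measurable borel" "sets N = sets borel" for N f \<gamma>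
  proof -
    have "(\<integral>x. \<sigma> x * f x \<partial>N) = (\<integral>x. \<gamma> * f x \<partial>N)"
    proof (rule integral_cong_AE)
      show "AE x in N. \<sigma> x * f x = \<gamma> * f x" using that(1) by eventually_elim simp
      have [measurable_cong]: "sets N = sets borel" by (rule that)
      note [measurable] = that(2)
      show "(\<lambda>x. \<sigma> x * f x) \<in> borel_measurable N" "(\<lambda>x. \<gamma> * f x) \<in> borel_measurable N" by measurable
    qed
    then show ?thesis by simp
  qed
  have split: "(\<integral>x. \<sigma> x * f x \<partial>?M) = \<alpha> * (\<integral>x. f x \<partial>A) + \<beta> * (\<integral>x. f x \<partial>B)"
    if f: "f \<in> borel_measurable borel" and fb: "\<And>x. \<bar>f x\<bar> \<le> R" for f R
  proof -
    have "(\<lambda>x. \<sigma> x * f x) \<in> borel_measurable borel" using f by measurable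
    then have "(\<lambda>x. \<sigma> x * f x) \<in> borel_measurable A" using measurable_cong_sets[OF s(1) refl] by blast
    from integral_sum_measure[OF eq fin this mult_le[OF fb]]
    show ?thesis by (simp add: cong[OF AE(1) f s(1)] cong[OF AE(2) f s(2)])
  qed
  have Kx: "(\<lambda>y. K (x, y)) \<in> borel_measurable borel" for x by measurable
  have outer: "(\<integral>x. \<alpha> * (\<integral>y. K (x, y) \<partial>A) + \<beta> * (\<integral>y. K (x, y) \<partial>B) \<partial>N) = \<alpha> * pairing K N A + \<beta> * pairing K N B"
    if N: "finite_measure N" "sets N = sets borel" for N
  proof -
    have int: "integrable N (\<lambda>x. \<integral>y. K (x, y) \<partial>R)" if R: "finite_measure R" "sets R = sets borel" for R
    proof (rule finite_measure.integrable_const_bound[OF N(1)])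
      show "AE x in N. norm (\<integral>y. K (x, y) \<partial>R) \<le> measure R (space R) * c"
        using pairing_iterated(4)[OF R(1) R(1) R(2) R(2) K b] by simp
      show "(\<lambda>x. \<integral>y. K (x, y) \<partial>R) \<in> borel_measurable N"
        by (rule pairing_iterated(3)[OF N(1) R(1) N(2) R(2) K b, unfolded measurable_cong_sets[OF N(2)[symmetric] refl]])
    qed
    show ?thesis
      using int[OF fin(1) s(1)] int[OF fin(2) s(2)]
      by (simp add: pairing_iterated(2)[OF N(1) fin(1) N(2) s(1) K b] pairing_iterated(2)[OF N(1) fin(2) N(2) s(2) K b])
  qed
  have "(\<integral>q. K' q \<partial>(?M \<Otimes>\<^sub>M ?M)) = (\<integral>x. \<integral>y. K' (x, y) \<partial>?M \<partial>?M)"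
    using pairing_iterated(2)[OF finM finM sM sM K'm K'b] by (simp add: pairing_def)
  also have "\<dots> = (\<integral>x. \<sigma> x * (\<alpha> * (\<integral>y. K (x, y) \<partial>A) + \<beta> * (\<integral>y. K (x, y) \<partial>B)) \<partial>?M)"
    by (intro Bochner_Integration.integral_cong refl) (simp add: K'_def mult.assoc split[OF Kx b])
  also have "\<dots> = \<alpha> * (\<integral>x. \<alpha> * (\<integral>y. K (x, y) \<partial>A) + \<beta> * (\<integral>y. K (x, y) \<partial>B) \<partial>A)
      + \<beta> * (\<integral>x. \<alpha> * (\<integral>y. K (x, y) \<partial>A) + \<beta> * (\<integral>y. K (x, y) \<partial>B) \<partial>B)"
  proof (rule split)
    show "(\<lambda>x. \<alpha> * (\<integral>y. K (x, y) \<partial>A) + \<beta> * (\<integral>y. K (x, y) \<partial>B)) \<in> borel_measurable borel"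
      using pairing_iterated(3)[OF fin(1) fin(1) s(1) s(1) K b] pairing_iterated(3)[OF fin(2) fin(2) s(2) s(2) K b]
      by measurable
    show "\<bar>\<alpha> * (\<integral>y. K (x, y) \<partial>A) + \<beta> * (\<integral>y. K (x, y) \<partial>B)\<bar>
        \<le> \<bar>\<alpha>\<bar> * (measure A (space A) * c) + \<bar>\<beta>\<bar> * (measure B (space B) * c)" for x
      unfolding abs_mult[symmetric]
      by (rule order.trans[OF abs_triangle_ineq])
        (simp add: abs_mult add_mono mult_left_mono pairing_iterated(4)[OF fin(1) fin(1) s(1) s(1) K b]
          pairing_iterated(4)[OF fin(2) fin(2) s(2) s(2) K b])
  qed
  also have "\<dots> = \<alpha> * (\<alpha> * pairing K A A + \<beta> * pairing K A B) + \<beta> * (\<alpha> * pairing K B A + \<beta> * pairing K B B)"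
    by (simp only: outer[OF fin(1) s(1)] outer[OF fin(2) s(2)])
  finally show ?thesis unfolding K'_def
    by (simp add: distrib_left mult.assoc)
qed

section \<open>The empirical measure\<close>

lemma sets_empirical_measure [simp, measurable_cong]: "sets (empirical_measure N x) = sets borel"
  by (simp add: empirical_measure_def)

lemma space_empirical_measure [simp]: "space (empirical_measure N x) = UNIV"
  by (simp add: empirical_measure_def)

lemma measurable_uniform_count_measure: "(x :: nat \<Rightarrow> 'a::topological_space) \<in> uniform_count_measure {..<N} \<rightarrow>\<^sub>M borel"
  by (auto simp: measurable_def sets_uniform_count_measure space_uniform_count_measure)

lemma prob_space_empirical_measure:
  assumes "0 < N"
  shows "prob_space (empirical_measure N (x :: nat \<Rightarrow> 'a::topological_space))"
  unfolding empirical_measure_def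
  by (rule prob_space.prob_space_distr[OF prob_space_uniform_count_measure measurable_uniform_count_measure])
    (use assms in auto)

lemma nn_integral_empirical_measure_lt_top:
  fixes f :: "'a::topological_space \<Rightarrow> ennreal"
  assumes f: "f \<in> borel_measurable borel" and lt: "\<And>i. i < N \<Longrightarrow> f (x i) < \<infinity>"
  shows "(\<integral>\<^sup>+y. f y \<partial>empirical_measure N x) < \<infinity>"
proof -
  have "(\<integral>\<^sup>+y. f y \<partial>empirical_measure N x) = (\<integral>\<^sup>+i. f (x i) \<partial>uniform_count_measure {..<N})"
    unfolding empirical_measure_def
    by (rule nn_integral_distr[OF measurable_uniform_count_measure]) (use f in simp)
  also have "\<dots> = (\<Sum>i<N. ennreal (1 / real (card {..<N})) * f (x i))"
    unfolding uniform_count_measure_def by (rule nn_integral_point_measure_finite) auto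
  also have "\<dots> < \<infinity>"
    using lt by (auto simp: ennreal_mult_less_top)
  finally show ?thesis .
qed

lemma AE_empirical_measure:
  assumes P: "{x. P x} \<in> sets borel" and "\<And>i. i < N \<Longrightarrow> P (X i)"
  shows "AE x in empirical_measure N X. P x"
  unfolding empirical_measure_def
  by (subst AE_distr_iff[OF measurable_uniform_count_measure])
    (use assms in \<open>auto simp: space_uniform_count_measure intro!: AE_I2\<close>)

section \<open>Integrals off the diagonal\<close>

definition offd :: "('a \<times> 'a \<Rightarrow> real) \<Rightarrow> 'a \<times> 'a \<Rightarrow> real" where
  "offd K q = (if fst q = snd q then 0 else K q)"

lemma offd_measurable [measurable]:
  fixes K :: "'a::euclidean_space \<times> 'a \<Rightarrow> real"
  assumes [measurable]: "K \<in> borel_measurable (borel \<Otimes>\<^sub>M borel)"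
  shows "offd K \<in> borel_measurable (borel \<Otimes>\<^sub>M borel)"
  unfolding offd_def by measurable

lemma offdiag_integral_eq:
  assumes F: "\<And>x y. x \<noteq> y \<Longrightarrow> F x y = K (x, y)"
  shows "offdiag_integral F A B = (\<integral>q. offd K q \<partial>(A \<Otimes>\<^sub>M B))"
  unfolding offdiag_integral_def set_lebesgue_integral_def
  by (intro Bochner_Integration.integral_cong refl) (auto simp: offd_def indicator_def F)

text \<open>For product measures that do not charge the diagonal, the bounded part \<open>K1\<close>
  may be integrated everywhere, and the singular part \<open>K2\<close> is treated as an error
  measured by its mass.\<close>

lemma offdiag_integral_error:
  fixes K1 K2 :: "'a::euclidean_space \<times> 'a \<Rightarrow> real"
  assumes fin: "finite_measure A" "finite_measure B" and s: "sets A = sets borel" "sets B = sets borel"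
    and K1: "K1 \<in> borel_measurable (borel \<Otimes>\<^sub>M borel)" and b: "\<And>q. \<bar>K1 q\<bar> \<le> b"
    and K2: "K2 \<in> borel_measurable (borel \<Otimes>\<^sub>M borel)"
    and F: "\<And>x y. x \<noteq> y \<Longrightarrow> F x y = K1 (x, y) + K2 (x, y)"
    and null: "AE q in A \<Otimes>\<^sub>M B. fst q \<noteq> snd q"
    and c: "0 \<le> c" "(\<integral>\<^sup>+q. ennreal \<bar>K2 q\<bar> \<partial>(A \<Otimes>\<^sub>M B)) \<le> ennreal c"
  shows "\<bar>offdiag_integral F A B - pairing K1 A B\<bar> \<le> c"
proof -
  have [measurable_cong]: "sets (A \<Otimes>\<^sub>M B) = sets (borel \<Otimes>\<^sub>M borel)" using s by (intro sets_pair_measure_cong)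
  note [measurable] = K1 K2
  have K2int: "integrable (A \<Otimes>\<^sub>M B) K2"
    by (rule integrableI_bounded) (use c(2) in \<open>auto simp: less_top[symmetric] top_unique\<close>)
  have K1int: "integrable (A \<Otimes>\<^sub>M B) K1" by (rule pairing_iterated(1)[OF fin s K1 b])
  have "offdiag_integral F A B = (\<integral>q. offd (\<lambda>q. K1 q + K2 q) q \<partial>(A \<Otimes>\<^sub>M B))"
    using F by (rule offdiag_integral_eq)
  also have "\<dots> = (\<integral>q. K1 q + K2 q \<partial>(A \<Otimes>\<^sub>M B))"
  proof (rule integral_cong_AE)
    show "AE q in A \<Otimes>\<^sub>M B. offd (\<lambda>q. K1 q + K2 q) q = K1 q + K2 q"
      using null by eventually_elim (simp add: offd_def)
  qed measurable
  also have "\<dots> = pairing K1 A B + (\<integral>q. K2 q \<partial>(A \<Otimes>\<^sub>M B))"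
    unfolding pairing_def by (rule Bochner_Integration.integral_add[OF K1int K2int])
  finally have "\<bar>offdiag_integral F A B - pairing K1 A B\<bar> = \<bar>\<integral>q. K2 q \<partial>(A \<Otimes>\<^sub>M B)\<bar>" by simp
  also have "\<dots> \<le> (\<integral>q. \<bar>K2 q\<bar> \<partial>(A \<Otimes>\<^sub>M B))" by (rule integral_abs_bound)
  also have "\<dots> \<le> c"
  proof -
    have "ennreal (\<integral>q. \<bar>K2 q\<bar> \<partial>(A \<Otimes>\<^sub>M B)) \<le> ennreal c"
      using c(2) K2int by (subst nn_integral_eq_integral[symmetric]) auto
    then show ?thesis using c(1) by (simp add: ennreal_le_iff)
  qed
  finally show ?thesis .
qed

text \<open>The bound on the density enters as domination of \<open>D\<close> by
  \<open>\<Lambda>\<close> times Lebesgue measure. It makes integrals of early kernels against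
  \<open>D\<close> small, and it makes \<open>D\<close> free of atoms.\<close>

locale configuration =
  fixes D :: "'a::euclidean_space measure" and \<Lambda> :: real and N :: nat and X :: "nat \<Rightarrow> 'a"
  assumes prob_D: "prob_space D" and sets_D [simp, measurable_cong]: "sets D = sets borel"
    and \<Lambda>: "0 \<le> \<Lambda>"
    and density_le: "\<And>f. f \<in> borel_measurable borel \<Longrightarrow> (\<integral>\<^sup>+x. f x \<partial>D) \<le> ennreal \<Lambda> * (\<integral>\<^sup>+x. f x \<partial>lborel)"
    and N: "0 < N" and X: "inj_on X {..<N}"
begin

abbreviation "\<mu> \<equiv> empirical_measure N X"

lemma finite_D: "finite_measure D"
  using prob_D by (rule prob_space.finite_measure)

lemma prob_\<mu>: "prob_space \<mu>"
  using N by (rule prob_space_empirical_measure)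

lemma finite_\<mu>: "finite_measure \<mu>"
  using prob_\<mu> by (rule prob_space.finite_measure)

lemma space_D [simp]: "space D = UNIV"
  using sets_eq_imp_space_eq[OF sets_D] by simp

lemma emeasure_D [simp]: "emeasure D UNIV = 1"
  using prob_space.emeasure_space_1[OF prob_D] by simp

lemma emeasure_\<mu> [simp]: "emeasure \<mu> UNIV = 1"
  using prob_space.emeasure_space_1[OF prob_\<mu>] by simp

lemma D_finite_null:
  assumes "finite S"
  shows "AE x in D. x \<notin> S"
proof -
  have S: "S \<in> sets borel" using assms by (simp add: finite_imp_closed)
  have "emeasure D S = (\<integral>\<^sup>+x. indicator S x \<partial>D)" using S by simp
  also have "\<dots> \<le> ennreal \<Lambda> * (\<integral>\<^sup>+x. indicator S x \<partial>lborel)"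
    using S by (intro density_le) simp
  also have "\<dots> = 0" using S assms by (simp add: emeasure_lborel_countable countable_finite)
  finally have "S \<in> null_sets D" using S by (auto simp: null_sets_def)
  then show ?thesis by (rule AE_not_in)
qed

text \<open>Since \<open>\<mu>\<close> and \<open>D\<close> are mutually singular, \<open>\<mu> - D\<close> is \<open>sgn_X\<close> times \<open>\<mu> + D\<close>.\<close>

definition "sgn_X x = (if x \<in> X ` {..<N} then 1 else - 1 :: real)"

lemma sgn_X_measurable [measurable]: "sgn_X \<in> borel_measurable borel"
proof -
  have [measurable]: "X ` {..<N} \<in> sets borel" by (intro borel_closed finite_imp_closed) auto
  show ?thesis unfolding sgn_X_def by measurable
qed

lemma abs_sgn_X: "\<bar>sgn_X x\<bar> \<le> 1"
  by (simp add: sgn_X_def)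

lemma sgn_X_\<mu>: "AE x in \<mu>. sgn_X x = 1"
proof (rule AE_empirical_measure)
  have "{x. sgn_X x = 1} = X ` {..<N}" by (auto simp: sgn_X_def)
  then show "{x. sgn_X x = 1} \<in> sets borel" by (simp add: finite_imp_closed)
qed (simp add: sgn_X_def)

lemma sgn_X_D: "AE x in D. sgn_X x = - 1"
  using D_finite_null[of "X ` {..<N}"] by (auto simp: sgn_X_def elim!: eventually_mono)

definition "M = sum_measure \<mu> D"

lemma sets_M [simp]: "sets M = sets borel"
  by (simp add: M_def)

lemma finite_M: "finite_measure M"
  unfolding M_def by (rule finite_sum_measure) (simp_all add: finite_\<mu> finite_D)

lemma pairing_M:
  fixes K :: "'a \<times> 'a \<Rightarrow> real"
  assumes K: "K \<in> borel_measurable (borel \<Otimes>\<^sub>M borel)" and b: "\<And>q. \<bar>K q\<bar> \<le> b"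
  shows "(\<integral>q. sgn_X (fst q) * sgn_X (snd q) * K q \<partial>(M \<Otimes>\<^sub>M M))
      = pairing K \<mu> \<mu> - pairing K \<mu> D - pairing K D \<mu> + pairing K D D"
    and "(\<integral>q. K q \<partial>(M \<Otimes>\<^sub>M M)) = pairing K \<mu> \<mu> + pairing K \<mu> D + pairing K D \<mu> + pairing K D D"
  unfolding M_def
  using pairing_sum_measure[OF finite_\<mu> finite_D _ _ K b sgn_X_measurable abs_sgn_X sgn_X_\<mu> sgn_X_D]
    pairing_sum_measure[OF finite_\<mu> finite_D _ _ K b, of "\<lambda>_. 1" 1 1]
  by simp_all

lemma integral_\<mu>_\<mu>:
  fixes f :: "'a \<times> 'a \<Rightarrow> real"
  assumes [measurable]: "f \<in> borel_measurable (borel \<Otimes>\<^sub>M borel)"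
  shows "(\<integral>q. f q \<partial>(\<mu> \<Otimes>\<^sub>M \<mu>)) = (\<Sum>i<N. \<Sum>j<N. f (X i, X j)) / (real N)\<^sup>2"
proof -
  interpret \<mu>: finite_measure \<mu> by (rule finite_\<mu>)
  interpret P: pair_sigma_finite \<mu> \<mu> ..
  have [measurable_cong]: "sets (\<mu> \<Otimes>\<^sub>M \<mu>) = sets (borel \<Otimes>\<^sub>M borel)" by (intro sets_pair_measure_cong) auto
  have int: "integrable (\<mu> \<Otimes>\<^sub>M \<mu>) f"
  proof (rule integrableI_bounded)
    have "(\<integral>\<^sup>+q. ennreal (norm (f q)) \<partial>(\<mu> \<Otimes>\<^sub>M \<mu>)) = (\<integral>\<^sup>+x. \<integral>\<^sup>+y. ennreal (norm (f (x, y))) \<partial>\<mu> \<partial>\<mu>)"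
      by (rule \<mu>.nn_integral_fst[symmetric]) measurable
    also have "\<dots> < \<infinity>"
    proof (intro nn_integral_empirical_measure_lt_top)
      show "(\<lambda>x. \<integral>\<^sup>+y. ennreal (norm (f (x, y))) \<partial>\<mu>) \<in> borel_measurable borel" by measurable
      show "(\<lambda>y. ennreal (norm (f (x, y)))) \<in> borel_measurable borel" for x by measurable
    qed simp
    finally show "(\<integral>\<^sup>+q. ennreal (norm (f q)) \<partial>(\<mu> \<Otimes>\<^sub>M \<mu>)) < \<infinity>" .
  qed measurable
  have "(\<integral>q. f q \<partial>(\<mu> \<Otimes>\<^sub>M \<mu>)) = (\<integral>x. \<integral>y. f (x, y) \<partial>\<mu> \<partial>\<mu>)"
    using P.integral_fst'[OF int] by simp
  also have "\<dots> = (\<integral>x. (\<Sum>j<N. f (x, X j)) / real N \<partial>\<mu>)"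
    by (intro Bochner_Integration.integral_cong refl integral_empirical_measure) measurable
  also have "\<dots> = (\<Sum>i<N. (\<Sum>j<N. f (X i, X j)) / real N) / real N"
    by (rule integral_empirical_measure) measurable
  finally show ?thesis by (simp add: sum_divide_distrib[symmetric] power2_eq_square)
qed

lemma nn_integral_D_le:
  assumes "f \<in> borel_measurable borel" "(\<integral>\<^sup>+x. ennreal (f x) \<partial>lborel) \<le> ennreal B"
  shows "(\<integral>\<^sup>+x. ennreal (f x) \<partial>D) \<le> ennreal (\<Lambda> * B)"
proof -
  have "(\<integral>\<^sup>+x. ennreal (f x) \<partial>D) \<le> ennreal \<Lambda> * (\<integral>\<^sup>+x. ennreal (f x) \<partial>lborel)"
    using assms(1) by (intro density_le) simp
  also have "\<dots> \<le> ennreal \<Lambda> * ennreal B" by (intro mult_left_mono assms) simp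
  finally show ?thesis using \<Lambda> by (simp add: ennreal_mult')
qed

lemma nn_integral_pair_D_le:
  fixes f :: "'a \<times> 'a \<Rightarrow> real"
  assumes [measurable]: "f \<in> borel_measurable (borel \<Otimes>\<^sub>M borel)"
    and 1: "\<And>x. (\<integral>\<^sup>+y. ennreal (f (x, y)) \<partial>lborel) \<le> ennreal B"
    and 2: "\<And>y. (\<integral>\<^sup>+x. ennreal (f (x, y)) \<partial>lborel) \<le> ennreal B"
  shows "(\<integral>\<^sup>+q. ennreal (f q) \<partial>(\<mu> \<Otimes>\<^sub>M D)) \<le> ennreal (\<Lambda> * B)"
    and "(\<integral>\<^sup>+q. ennreal (f q) \<partial>(D \<Otimes>\<^sub>M \<mu>)) \<le> ennreal (\<Lambda> * B)"
    and "(\<integral>\<^sup>+q. ennreal (f q) \<partial>(D \<Otimes>\<^sub>M D)) \<le> ennreal (\<Lambda> * B)"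
proof -
  interpret \<mu>: finite_measure \<mu> by (rule finite_\<mu>)
  interpret D: finite_measure D by (rule finite_D)
  interpret D\<mu>: pair_sigma_finite D \<mu> ..
  have [measurable_cong]: "sets (\<mu> \<Otimes>\<^sub>M D) = sets (borel \<Otimes>\<^sub>M borel)" "sets (D \<Otimes>\<^sub>M \<mu>) = sets (borel \<Otimes>\<^sub>M borel)"
    "sets (D \<Otimes>\<^sub>M D) = sets (borel \<Otimes>\<^sub>M borel)" by (intro sets_pair_measure_cong; simp)+
  have inner1: "(\<integral>\<^sup>+y. ennreal (f (x, y)) \<partial>D) \<le> ennreal (\<Lambda> * B)" for x by (rule nn_integral_D_le[OF _ 1]) measurable
  have inner2: "(\<integral>\<^sup>+x. ennreal (f (x, y)) \<partial>D) \<le> ennreal (\<Lambda> * B)" for y by (rule nn_integral_D_le[OF _ 2]) measurable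
  have "(\<integral>\<^sup>+q. ennreal (f q) \<partial>(\<mu> \<Otimes>\<^sub>M D)) = (\<integral>\<^sup>+x. \<integral>\<^sup>+y. ennreal (f (x, y)) \<partial>D \<partial>\<mu>)"
    by (rule D.nn_integral_fst[symmetric]) measurable
  also have "\<dots> \<le> (\<integral>\<^sup>+x. ennreal (\<Lambda> * B) \<partial>\<mu>)" by (intro nn_integral_mono inner1)
  finally show "(\<integral>\<^sup>+q. ennreal (f q) \<partial>(\<mu> \<Otimes>\<^sub>M D)) \<le> ennreal (\<Lambda> * B)" by simp
  have "(\<integral>\<^sup>+q. ennreal (f q) \<partial>(D \<Otimes>\<^sub>M D)) = (\<integral>\<^sup>+x. \<integral>\<^sup>+y. ennreal (f (x, y)) \<partial>D \<partial>D)"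
    by (rule D.nn_integral_fst[symmetric]) measurable
  also have "\<dots> \<le> (\<integral>\<^sup>+x. ennreal (\<Lambda> * B) \<partial>D)" by (intro nn_integral_mono inner1)
  finally show "(\<integral>\<^sup>+q. ennreal (f q) \<partial>(D \<Otimes>\<^sub>M D)) \<le> ennreal (\<Lambda> * B)" by simp
  have "(\<integral>\<^sup>+q. ennreal (f q) \<partial>(D \<Otimes>\<^sub>M \<mu>)) = (\<integral>\<^sup>+y. \<integral>\<^sup>+x. ennreal (f (x, y)) \<partial>D \<partial>\<mu>)"
    using D\<mu>.nn_integral_snd[of "\<lambda>q. ennreal (f q)"] by simp
  also have "\<dots> \<le> (\<integral>\<^sup>+x. ennreal (\<Lambda> * B) \<partial>\<mu>)" by (intro nn_integral_mono inner2)
  finally show "(\<integral>\<^sup>+q. ennreal (f q) \<partial>(D \<Otimes>\<^sub>M \<mu>)) \<le> ennreal (\<Lambda> * B)" by simp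
qed

text \<open>Every slice of the diagonal is a single point, so \<open>nn_integral_pair_D_le\<close>
  applies to its indicator with \<open>B\<close> equal to 0.\<close>

lemma diagonal_null:
  "AE q in \<mu> \<Otimes>\<^sub>M D. fst q \<noteq> snd q" "AE q in D \<Otimes>\<^sub>M \<mu>. fst q \<noteq> snd q" "AE q in D \<Otimes>\<^sub>M D. fst q \<noteq> snd q"
proof -
  define f :: "'a \<times> 'a \<Rightarrow> real" where "f = (\<lambda>q. if fst q = snd q then 1 else 0)"
  have f[measurable]: "f \<in> borel_measurable (borel \<Otimes>\<^sub>M borel)" unfolding f_def by measurable
  have z: "(\<integral>\<^sup>+y. ennreal (f (x, y)) \<partial>lborel) \<le> ennreal 0" "(\<integral>\<^sup>+y. ennreal (f (y, x)) \<partial>lborel) \<le> ennreal 0" for x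
  proof -
    have "(\<integral>\<^sup>+y. ennreal (f (x, y)) \<partial>lborel) = (\<integral>\<^sup>+y. indicator {x} y \<partial>lborel)"
      "(\<integral>\<^sup>+y. ennreal (f (y, x)) \<partial>lborel) = (\<integral>\<^sup>+y. indicator {x} y \<partial>lborel)"
      by (auto simp: f_def indicator_def intro!: nn_integral_cong)
    then show "(\<integral>\<^sup>+y. ennreal (f (x, y)) \<partial>lborel) \<le> ennreal 0" "(\<integral>\<^sup>+y. ennreal (f (y, x)) \<partial>lborel) \<le> ennreal 0" by simp_all
  qed
  have main: "AE q in R. fst q \<noteq> snd q" if "(\<integral>\<^sup>+q. ennreal (f q) \<partial>R) \<le> ennreal (\<Lambda> * 0)" "sets R = sets (borel \<Otimes>\<^sub>M borel)" for R
  proof -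
    have [measurable_cong]: "sets R = sets (borel \<Otimes>\<^sub>M borel)" by (rule that)
    have "(\<integral>\<^sup>+q. ennreal (f q) \<partial>R) = 0" using that(1) by simp
    then have "AE q in R. ennreal (f q) = 0" by (subst (asm) nn_integral_0_iff_AE) auto
    then show ?thesis by eventually_elim (auto simp: f_def split: if_splits)
  qed
  show "AE q in \<mu> \<Otimes>\<^sub>M D. fst q \<noteq> snd q" "AE q in D \<Otimes>\<^sub>M \<mu>. fst q \<noteq> snd q" "AE q in D \<Otimes>\<^sub>M D. fst q \<noteq> snd q"
    by (rule main[OF nn_integral_pair_D_le(1)[OF f z]] main[OF nn_integral_pair_D_le(2)[OF f z]]
        main[OF nn_integral_pair_D_le(3)[OF f z]]; intro sets_pair_measure_cong; simp)+
qed

text \<open>The bounded kernel \<open>K1\<close> is extended across the diagonal, at the price of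
  subtracting the self-interaction of the particles. The singular kernel \<open>K2\<close> is kept
  exactly between distinct particles, and its three integrals involving \<open>D\<close> each cost
  \<open>\<Lambda> * B\<close>.\<close>

lemma offdiag_integral_diff_decomposition:
  fixes K1 K2 :: "'a \<times> 'a \<Rightarrow> real"
  assumes K1: "K1 \<in> borel_measurable (borel \<Otimes>\<^sub>M borel)" and b: "\<And>q. \<bar>K1 q\<bar> \<le> b"
    and K2: "K2 \<in> borel_measurable (borel \<Otimes>\<^sub>M borel)" and B: "0 \<le> B"
    and F: "\<And>x y. x \<noteq> y \<Longrightarrow> F x y = K1 (x, y) + K2 (x, y)"
    and 1: "\<And>x. (\<integral>\<^sup>+y. ennreal \<bar>K2 (x, y)\<bar> \<partial>lborel) \<le> ennreal B"
    and 2: "\<And>y. (\<integral>\<^sup>+x. ennreal \<bar>K2 (x, y)\<bar> \<partial>lborel) \<le> ennreal B"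
  shows "\<bar>offdiag_integral_diff F \<mu> D - ((\<integral>q. sgn_X (fst q) * sgn_X (snd q) * K1 q \<partial>(M \<Otimes>\<^sub>M M))
      - (\<Sum>i<N. K1 (X i, X i)) / (real N)\<^sup>2 + (\<Sum>i<N. \<Sum>j\<in>{..<N} - {i}. K2 (X i, X j)) / (real N)\<^sup>2)\<bar> \<le> 3 * (\<Lambda> * B)"
proof -
  note [measurable] = K1 K2
  have c: "0 \<le> \<Lambda> * B" using \<Lambda> B by simp
  have nn: "(\<lambda>q. \<bar>K2 q\<bar>) \<in> borel_measurable (borel \<Otimes>\<^sub>M borel)" by measurable
  note err = offdiag_integral_error[OF _ _ _ _ K1 b K2 F _ c]
  have e1: "\<bar>offdiag_integral F \<mu> D - pairing K1 \<mu> D\<bar> \<le> \<Lambda> * B"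
    by (rule err[OF finite_\<mu> finite_D _ _ _ diagonal_null(1) nn_integral_pair_D_le(1)[OF nn 1 2]]) auto
  have e2: "\<bar>offdiag_integral F D \<mu> - pairing K1 D \<mu>\<bar> \<le> \<Lambda> * B"
    by (rule err[OF finite_D finite_\<mu> _ _ _ diagonal_null(2) nn_integral_pair_D_le(2)[OF nn 1 2]]) auto
  have e3: "\<bar>offdiag_integral F D D - pairing K1 D D\<bar> \<le> \<Lambda> * B"
    by (rule err[OF finite_D finite_D _ _ _ diagonal_null(3) nn_integral_pair_D_le(3)[OF nn 1 2]]) auto
  have "offdiag_integral F \<mu> \<mu> = (\<integral>q. offd (\<lambda>q. K1 q + K2 q) q \<partial>(\<mu> \<Otimes>\<^sub>M \<mu>))"
    using F by (rule offdiag_integral_eq)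
  also have "\<dots> = (\<Sum>i<N. \<Sum>j<N. offd (\<lambda>q. K1 q + K2 q) (X i, X j)) / (real N)\<^sup>2"
    by (rule integral_\<mu>_\<mu>) measurable
  also have "(\<Sum>i<N. \<Sum>j<N. offd (\<lambda>q. K1 q + K2 q) (X i, X j))
      = (\<Sum>i<N. (\<Sum>j<N. K1 (X i, X j)) - K1 (X i, X i) + (\<Sum>j\<in>{..<N} - {i}. K2 (X i, X j)))"
  proof (rule sum.cong[OF refl])
    fix i assume i: "i \<in> {..<N}"
    have "(\<Sum>j<N. offd (\<lambda>q. K1 q + K2 q) (X i, X j))
        = offd (\<lambda>q. K1 q + K2 q) (X i, X i) + (\<Sum>j\<in>{..<N} - {i}. offd (\<lambda>q. K1 q + K2 q) (X i, X j))"
      using i by (intro sum.remove) auto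
    also have "offd (\<lambda>q. K1 q + K2 q) (X i, X i) = 0" by (simp add: offd_def)
    also have "(\<Sum>j\<in>{..<N} - {i}. offd (\<lambda>q. K1 q + K2 q) (X i, X j)) = (\<Sum>j\<in>{..<N} - {i}. K1 (X i, X j) + K2 (X i, X j))"
      using i X by (intro sum.cong refl) (auto simp: offd_def dest: inj_onD)
    also have "\<dots> = (\<Sum>j\<in>{..<N} - {i}. K1 (X i, X j)) + (\<Sum>j\<in>{..<N} - {i}. K2 (X i, X j))"
      by (rule sum.distrib)
    also have "(\<Sum>j\<in>{..<N} - {i}. K1 (X i, X j)) = (\<Sum>j<N. K1 (X i, X j)) - K1 (X i, X i)"
      using i by (simp add: sum_diff1)
    finally show "(\<Sum>j<N. offd (\<lambda>q. K1 q + K2 q) (X i, X j))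
        = (\<Sum>j<N. K1 (X i, X j)) - K1 (X i, X i) + (\<Sum>j\<in>{..<N} - {i}. K2 (X i, X j))" by simp
  qed
  also have "\<dots> / (real N)\<^sup>2 = pairing K1 \<mu> \<mu> - (\<Sum>i<N. K1 (X i, X i)) / (real N)\<^sup>2
      + (\<Sum>i<N. \<Sum>j\<in>{..<N} - {i}. K2 (X i, X j)) / (real N)\<^sup>2"
    unfolding pairing_def integral_\<mu>_\<mu>[OF K1] by (simp add: sum.distrib sum_subtractf add_divide_distrib diff_divide_distrib)
  finally have e0: "offdiag_integral F \<mu> \<mu> = pairing K1 \<mu> \<mu> - (\<Sum>i<N. K1 (X i, X i)) / (real N)\<^sup>2
      + (\<Sum>i<N. \<Sum>j\<in>{..<N} - {i}. K2 (X i, X j)) / (real N)\<^sup>2" .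
  show ?thesis
    unfolding offdiag_integral_diff_def pairing_M(1)[OF K1 b] e0
    using e1 e2 e3 by (simp only: abs_le_iff) linarith
qed

end

lemma near_minus_commute: "near \<kappa> \<tau> (x - y) = near \<kappa> \<tau> (y - x)"
  unfolding near_def heat_minus_commute[of _ x y] by (rule refl)

context configuration
begin

section \<open>Energy and commutator of a configuration\<close>

definition near_pairs :: "real \<Rightarrow> real \<Rightarrow> real" where
  "near_pairs \<kappa> \<tau> = (\<Sum>i<N. \<Sum>j\<in>{..<N} - {i}. near \<kappa> \<tau> (X i - X j)) / (real N)\<^sup>2"

definition far_energy :: "real \<Rightarrow> real \<Rightarrow> real" where
  "far_energy \<kappa> \<tau> = (\<integral>q. sgn_X (fst q) * sgn_X (snd q) * far \<kappa> \<tau> (fst q - snd q) \<partial>(M \<Otimes>\<^sub>M M))"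

lemma near_pairs_nonneg: "0 \<le> near_pairs \<kappa> \<tau>"
  unfolding near_pairs_def by (intro divide_nonneg_nonneg sum_nonneg near_nonneg) auto

lemma smeared_measure_M:
  assumes "0 < \<kappa>" "0 < s" "L-lipschitz_on UNIV u"
  shows "smeared_measure M sgn_X \<kappa> s L u"
proof (rule smeared_measure.intro)
  show "sets M = sets borel" "finite_measure M" by (rule sets_M finite_M)+
qed (rule assms sgn_X_measurable abs_sgn_X)+

text \<open>Positive definiteness of the late kernel, taken from the energy identity. That identity
  has cut \<open>2 * s\<close>, hence the choice \<open>\<tau> / 2\<close>; the zero field serves as
  a Lipschitz field.\<close>

lemma far_energy_nonneg:
  assumes "0 < \<kappa>" "0 < \<tau>"
  shows "0 \<le> far_energy \<kappa> \<tau>"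
proof -
  have "0-lipschitz_on UNIV (\<lambda>_::'a. 0 :: 'a)" by (simp add: lipschitz_on_def)
  then interpret smeared_measure M sgn_X \<kappa> "\<tau> / 2" 0 "\<lambda>_. 0"
    using assms by (intro smeared_measure_M) auto
  show ?thesis using energy_nonneg by (simp add: far_energy_def)
qed

lemma energy_decomposition:
  assumes \<kappa>: "0 < \<kappa>" and \<tau>: "0 < \<tau>" and g: "\<And>y. y \<noteq> 0 \<Longrightarrow> g y = near \<kappa> \<tau> y + far \<kappa> \<tau> y"
  shows "\<bar>offdiag_integral_diff (\<lambda>x y. g (x - y)) \<mu> D
    - (far_energy \<kappa> \<tau> - far \<kappa> \<tau> (0 :: 'a) / real N + near_pairs \<kappa> \<tau>)\<bar> \<le> 3 * (\<Lambda> * \<tau>)"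
proof -
  obtain B where B: "\<And>y :: 'a. \<bar>far \<kappa> \<tau> y\<bar> \<le> B" using far_bounded[OF \<kappa> \<tau>] by blast
  have "(\<Sum>i<N. far \<kappa> \<tau> (fst (X i, X i) - snd (X i, X i))) / (real N)\<^sup>2 = far \<kappa> \<tau> (0 :: 'a) / real N"
    using N by (simp add: power2_eq_square)
  moreover have "\<bar>offdiag_integral_diff (\<lambda>x y. g (x - y)) \<mu> D
      - ((\<integral>q. sgn_X (fst q) * sgn_X (snd q) * far \<kappa> \<tau> (fst q - snd q) \<partial>(M \<Otimes>\<^sub>M M))
        - (\<Sum>i<N. far \<kappa> \<tau> (fst (X i, X i) - snd (X i, X i))) / (real N)\<^sup>2
        + (\<Sum>i<N. \<Sum>j\<in>{..<N} - {i}. near \<kappa> \<tau> (fst (X i, X j) - snd (X i, X j))) / (real N)\<^sup>2)\<bar> \<le> 3 * (\<Lambda> * \<tau>)"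
  proof (rule offdiag_integral_diff_decomposition)
    show "(\<lambda>q. far \<kappa> \<tau> (fst q - snd q)) \<in> borel_measurable (borel \<Otimes>\<^sub>M (borel :: 'a measure))" by measurable
    show "(\<lambda>q. near \<kappa> \<tau> (fst q - snd q)) \<in> borel_measurable (borel \<Otimes>\<^sub>M (borel :: 'a measure))" by measurable
    show "\<bar>far \<kappa> \<tau> (fst q - snd q)\<bar> \<le> B" for q :: "'a \<times> 'a" by (rule B)
    show "g (x - y) = far \<kappa> \<tau> (fst (x, y) - snd (x, y)) + near \<kappa> \<tau> (fst (x, y) - snd (x, y))" if "x \<noteq> y" for x y
      using g[of "x - y"] that by simp
    show "(\<integral>\<^sup>+y. ennreal \<bar>near \<kappa> \<tau> (fst (x, y) - snd (x, y))\<bar> \<partial>lborel) \<le> ennreal \<tau>" for x :: 'a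
      using nn_integral_near[of \<tau> \<kappa> x] \<tau> by (simp add: near_nonneg near_minus_commute[of _ _ x])
    show "(\<integral>\<^sup>+x. ennreal \<bar>near \<kappa> \<tau> (fst (x, y) - snd (x, y))\<bar> \<partial>lborel) \<le> ennreal \<tau>" for y :: 'a
      using nn_integral_near[of \<tau> \<kappa> y] \<tau> by (simp add: near_nonneg)
  qed (use \<tau> in auto)
  ultimately show ?thesis unfolding far_energy_def near_pairs_def by simp
qed

lemma energy_lower_bound:
  assumes "0 < \<kappa>" "0 < \<tau>" "\<And>y. y \<noteq> 0 \<Longrightarrow> g y = near \<kappa> \<tau> y + far \<kappa> \<tau> y"
  shows "far_energy \<kappa> \<tau> + near_pairs \<kappa> \<tau>
    \<le> offdiag_integral_diff (\<lambda>x y. g (x - y)) \<mu> D + far \<kappa> \<tau> (0 :: 'a) / real N + 3 * (\<Lambda> * \<tau>)"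
  using energy_decomposition[OF assms] by linarith

text \<open>The diagonal of the particle sum gives the first term. Each of the three pairings that
  involve \<open>D\<close> is at most \<open>\<Lambda>\<close>, because the heat kernel has mass one
  in either variable.\<close>

lemma heat_energy_le:
  assumes s: "0 < s"
  shows "(\<integral>q. heat s (fst q - snd q) \<partial>(M \<Otimes>\<^sub>M M))
    \<le> heat s (0 :: 'a) / real N + (\<Sum>i<N. \<Sum>j\<in>{..<N} - {i}. heat s (X i - X j)) / (real N)\<^sup>2 + 3 * \<Lambda>"
proof -
  define K :: "'a \<times> 'a \<Rightarrow> real" where "K = (\<lambda>q. heat s (fst q - snd q))"
  have K[measurable]: "K \<in> borel_measurable (borel \<Otimes>\<^sub>M borel)" unfolding K_def by measurable
  have b: "\<bar>K q\<bar> \<le> heat s (0 :: 'a)" for q unfolding K_def using s by (simp add: heat_le_zero)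
  have 1: "(\<integral>\<^sup>+y. ennreal (K (x, y)) \<partial>lborel) \<le> ennreal 1" for x
    using nn_integral_heat[OF s, of x] by (simp add: K_def heat_minus_commute[of _ x])
  have 2: "(\<integral>\<^sup>+x. ennreal (K (x, y)) \<partial>lborel) \<le> ennreal 1" for y
    using nn_integral_heat[OF s, of y] by (simp add: K_def)
  have le: "pairing K A B \<le> \<Lambda>" if AB: "(\<integral>\<^sup>+q. ennreal (K q) \<partial>(A \<Otimes>\<^sub>M B)) \<le> ennreal (\<Lambda> * 1)"
      "sets A = sets borel" "sets B = sets borel" for A B
  proof -
    have [measurable_cong]: "sets (A \<Otimes>\<^sub>M B) = sets (borel \<Otimes>\<^sub>M borel)" using AB by (intro sets_pair_measure_cong)
    have "ennreal (pairing K A B) \<le> (\<integral>\<^sup>+q. ennreal (K q) \<partial>(A \<Otimes>\<^sub>M B))"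
      unfolding pairing_def by (rule ennreal_integral_le_nn_integral) (measurable, simp add: K_def)
    also have "\<dots> \<le> ennreal \<Lambda>" using AB by simp
    finally show ?thesis using \<Lambda> by (simp add: ennreal_le_iff)
  qed
  have "pairing K \<mu> \<mu> = (\<Sum>i<N. \<Sum>j<N. K (X i, X j)) / (real N)\<^sup>2"
    unfolding pairing_def by (rule integral_\<mu>_\<mu>[OF K])
  also have "(\<Sum>i<N. \<Sum>j<N. K (X i, X j)) = (\<Sum>i<N. K (X i, X i) + (\<Sum>j\<in>{..<N} - {i}. K (X i, X j)))"
    by (intro sum.cong refl sum.remove) auto
  also have "\<dots> / (real N)\<^sup>2 = heat s (0 :: 'a) / real N + (\<Sum>i<N. \<Sum>j\<in>{..<N} - {i}. heat s (X i - X j)) / (real N)\<^sup>2"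
    using N by (simp add: K_def sum.distrib add_divide_distrib power2_eq_square)
  finally show ?thesis
    using pairing_M(2)[OF K b] le[OF nn_integral_pair_D_le(1)[OF K 1 2]] le[OF nn_integral_pair_D_le(2)[OF K 1 2]]
      le[OF nn_integral_pair_D_le(3)[OF K 1 2]] by (simp add: K_def)
qed

text \<open>All early quantities are brought to the window \<open>8 * s\<close>: the slope up to
  \<open>2 * s\<close> is bounded by the kernel up to \<open>4 * s\<close> and then enlarged, while
  the smearing error has heat kernels at time \<open>4 * s\<close>, bounded by the kernel up to
  \<open>8 * s\<close>. \<open>E\<close> covers the constants of both steps. The 24 is the product
  of three integrals against \<open>D\<close>, a factor 2 from the slope estimate, and the window
  \<open>4 * s\<close>.\<close>

lemma commutator_upper_bound:
  fixes u :: "'a \<Rightarrow> 'a"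
  assumes \<kappa>: "0 < \<kappa>" and s: "0 < s" and u: "L-lipschitz_on UNIV u"
    and G: "\<And>y. y \<noteq> 0 \<Longrightarrow> G y = - (near_slope \<kappa> (2 * s) y + far_slope \<kappa> (2 * s) y) *\<^sub>R y"
  defines "E \<equiv> 2 powr (real DIM('a) / 2) * exp (8 * \<kappa>\<^sup>2 * s)"
  shows "\<bar>offdiag_integral_diff (\<lambda>x y. (u x - u y) \<bullet> G (x - y)) \<mu> D\<bar>
    \<le> L * ((3 * (real DIM('a))\<^sup>2 + 1) * far_energy \<kappa> (2 * s)
        + 9 * real DIM('a) * 2 powr real DIM('a) * (s * heat (4 * s) (0 :: 'a) / real N + E * near_pairs \<kappa> (8 * s) + 3 * \<Lambda> * s)
        + 2 * E * near_pairs \<kappa> (8 * s) + 24 * \<Lambda> * E * s)"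
proof -
  interpret S: smeared_measure M sgn_X \<kappa> s L u by (rule smeared_measure_M[OF \<kappa> s u])
  have L: "0 \<le> L" by (rule S.L_nonneg)
  have E: "0 \<le> E" by (simp add: E_def)
  have Xne: "X i - X j \<noteq> 0" if "i < N" "j \<in> {..<N} - {i}" for i j
    using X that by (auto dest: inj_onD)
  define K1 where "K1 = (\<lambda>q. - (((u (fst q) - u (snd q)) \<bullet> (fst q - snd q)) * far_slope \<kappa> (2 * s) (fst q - snd q)))"
  define K2 where "K2 = (\<lambda>q. - (((u (fst q) - u (snd q)) \<bullet> (fst q - snd q)) * near_slope \<kappa> (2 * s) (fst q - snd q)))"
  have inner: "\<bar>(u x - u y) \<bullet> (x - y)\<bar> \<le> L * (norm (x - y))\<^sup>2" for x y
    using order.trans[OF Cauchy_Schwarz_ineq2 mult_right_mono[OF S.u_diff_le norm_ge_zero]]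
    by (simp add: power2_eq_square mult.assoc)
  have K2_le: "\<bar>K2 (x, y)\<bar> \<le> L * (2 * E) * near \<kappa> (4 * s) (x - y)" for x y
  proof (cases "x = y")
    case True
    then show ?thesis using L E by (simp add: K2_def near_nonneg)
  next
    case False
    have "\<bar>K2 (x, y)\<bar> \<le> L * (norm (x - y))\<^sup>2 * near_slope \<kappa> (2 * s) (x - y)"
      using mult_right_mono[OF inner near_slope_nonneg] by (simp add: K2_def abs_mult near_slope_nonneg)
    also have "\<dots> = L * ((norm (x - y))\<^sup>2 * near_slope \<kappa> (2 * s) (x - y))" by simp
    also have "\<dots> \<le> L * (2 * 2 powr (real DIM('a) / 2) * exp (\<kappa>\<^sup>2 * (2 * s)) * near \<kappa> (2 * (2 * s)) (x - y))"
      using False by (intro mult_left_mono norm_power2_near_slope_le \<kappa> L) simp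
    also have "\<dots> \<le> L * (2 * 2 powr (real DIM('a) / 2) * exp (8 * \<kappa>\<^sup>2 * s) * near \<kappa> (2 * (2 * s)) (x - y))"
      using s L near_nonneg by (intro mult_left_mono mult_right_mono) auto
    finally show ?thesis by (simp add: E_def mult_ac)
  qed
  obtain B where B: "\<And>y :: 'a. (norm y)\<^sup>2 * \<bar>far_slope \<kappa> (2 * s) y\<bar> \<le> B"
    using inner_far_slope_bounded[OF \<kappa>, of "2 * s"] s by auto
  define B2 where "B2 = L * (2 * E) * (4 * s)"
  have nn: "(\<integral>\<^sup>+z. ennreal (f z) \<partial>lborel) \<le> ennreal B2"
    if f: "\<And>z. f z \<le> L * (2 * E) * near \<kappa> (4 * s) (z - x)" for f and x :: 'a
  proof -
    have "(\<integral>\<^sup>+z. ennreal (f z) \<partial>lborel) \<le> (\<integral>\<^sup>+z. ennreal (L * (2 * E)) * ennreal (near \<kappa> (4 * s) (z - x)) \<partial>lborel)"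
    proof (rule nn_integral_mono)
      fix z
      have "ennreal (f z) \<le> ennreal (L * (2 * E) * near \<kappa> (4 * s) (z - x))" by (intro ennreal_leI f)
      also have "\<dots> = ennreal (L * (2 * E)) * ennreal (near \<kappa> (4 * s) (z - x))"
        by (rule ennreal_mult) (use L E near_nonneg in auto)
      finally show "ennreal (f z) \<le> ennreal (L * (2 * E)) * ennreal (near \<kappa> (4 * s) (z - x))" .
    qed
    also have "\<dots> = ennreal (L * (2 * E)) * (\<integral>\<^sup>+z. ennreal (near \<kappa> (4 * s) (z - x)) \<partial>lborel)"
      by (rule nn_integral_cmult) measurable
    also have "\<dots> \<le> ennreal (L * (2 * E)) * ennreal (4 * s)"
      using s by (intro mult_left_mono nn_integral_near) auto
    also have "\<dots> = ennreal B2" using L E s by (simp add: B2_def flip: ennreal_mult)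
    finally show ?thesis .
  qed
  have "\<bar>offdiag_integral_diff (\<lambda>x y. (u x - u y) \<bullet> G (x - y)) \<mu> D
      - ((\<integral>q. sgn_X (fst q) * sgn_X (snd q) * K1 q \<partial>(M \<Otimes>\<^sub>M M))
        - (\<Sum>i<N. K1 (X i, X i)) / (real N)\<^sup>2
        + (\<Sum>i<N. \<Sum>j\<in>{..<N} - {i}. K2 (X i, X j)) / (real N)\<^sup>2)\<bar> \<le> 3 * (\<Lambda> * B2)"
  proof (rule offdiag_integral_diff_decomposition)
    show "K1 \<in> borel_measurable (borel \<Otimes>\<^sub>M (borel :: 'a measure))" unfolding K1_def by measurable
    show "K2 \<in> borel_measurable (borel \<Otimes>\<^sub>M (borel :: 'a measure))" unfolding K2_def by measurable
    show "0 \<le> B2" using L E s by (simp add: B2_def)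
    show "\<bar>K1 q\<bar> \<le> L * B" for q
    proof -
      have "\<bar>K1 q\<bar> \<le> L * (norm (fst q - snd q))\<^sup>2 * \<bar>far_slope \<kappa> (2 * s) (fst q - snd q)\<bar>"
        using mult_right_mono[OF inner abs_ge_zero] by (simp add: K1_def abs_mult)
      also have "\<dots> = L * ((norm (fst q - snd q))\<^sup>2 * \<bar>far_slope \<kappa> (2 * s) (fst q - snd q)\<bar>)" by simp
      also have "\<dots> \<le> L * B" by (intro mult_left_mono B L)
      finally show ?thesis .
    qed
    show "(u x - u y) \<bullet> G (x - y) = K1 (x, y) + K2 (x, y)" if "x \<noteq> y" for x y
      using that by (simp add: G K1_def K2_def algebra_simps)
    show "(\<integral>\<^sup>+y. ennreal \<bar>K2 (x, y)\<bar> \<partial>lborel) \<le> ennreal B2" for x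
    proof (rule nn)
      show "\<bar>K2 (x, y)\<bar> \<le> L * (2 * E) * near \<kappa> (4 * s) (y - x)" for y
        using K2_le[of x y] by (simp only: near_minus_commute[of _ _ x y])
    qed
    show "(\<integral>\<^sup>+x. ennreal \<bar>K2 (x, y)\<bar> \<partial>lborel) \<le> ennreal B2" for y
      by (rule nn[OF K2_le])
  qed
  moreover have "(\<integral>q. sgn_X (fst q) * sgn_X (snd q) * K1 q \<partial>(M \<Otimes>\<^sub>M M)) = - S.interaction"
    by (simp add: S.interaction_def K1_def)
  \<comment> \<open>The commutator has no self-interaction, as the increment of \<open>u\<close>
    vanishes on the diagonal.\<close>
  moreover have "(\<Sum>i<N. K1 (X i, X i)) / (real N)\<^sup>2 = 0" by (simp add: K1_def)
  moreover have "\<bar>(\<Sum>i<N. \<Sum>j\<in>{..<N} - {i}. K2 (X i, X j)) / (real N)\<^sup>2\<bar> \<le> L * (2 * E) * near_pairs \<kappa> (8 * s)"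
  proof -
    have "\<bar>\<Sum>i<N. \<Sum>j\<in>{..<N} - {i}. K2 (X i, X j)\<bar> \<le> (\<Sum>i<N. \<Sum>j\<in>{..<N} - {i}. L * (2 * E) * near \<kappa> (8 * s) (X i - X j))"
    proof (intro order.trans[OF sum_abs] sum_mono)
      fix i j assume ij: "i \<in> {..<N}" "j \<in> {..<N} - {i}"
      have "\<bar>K2 (X i, X j)\<bar> \<le> L * (2 * E) * near \<kappa> (4 * s) (X i - X j)" by (rule K2_le)
      also have "\<dots> \<le> L * (2 * E) * near \<kappa> (8 * s) (X i - X j)"
        using ij s L E by (intro mult_left_mono near_mono \<kappa> Xne) auto
      finally show "\<bar>K2 (X i, X j)\<bar> \<le> L * (2 * E) * near \<kappa> (8 * s) (X i - X j)" .
    qed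
    also have "\<dots> = L * (2 * E) * (\<Sum>i<N. \<Sum>j\<in>{..<N} - {i}. near \<kappa> (8 * s) (X i - X j))"
      by (simp add: sum_distrib_left)
    finally have "\<bar>\<Sum>i<N. \<Sum>j\<in>{..<N} - {i}. K2 (X i, X j)\<bar> / (real N)\<^sup>2
        \<le> L * (2 * E) * (\<Sum>i<N. \<Sum>j\<in>{..<N} - {i}. near \<kappa> (8 * s) (X i - X j)) / (real N)\<^sup>2"
      by (intro divide_right_mono) auto
    then show ?thesis by (simp add: near_pairs_def)
  qed
  ultimately have comm: "\<bar>offdiag_integral_diff (\<lambda>x y. (u x - u y) \<bullet> G (x - y)) \<mu> D\<bar>
      \<le> \<bar>S.interaction\<bar> + L * (2 * E) * near_pairs \<kappa> (8 * s) + 3 * (\<Lambda> * B2)"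
    by linarith
  have heat: "s * (\<integral>q. heat (4 * s) (fst q - snd q) \<partial>(M \<Otimes>\<^sub>M M))
      \<le> s * heat (4 * s) (0 :: 'a) / real N + E * near_pairs \<kappa> (8 * s) + 3 * \<Lambda> * s"
  proof -
    have "s * (\<integral>q. heat (4 * s) (fst q - snd q) \<partial>(M \<Otimes>\<^sub>M M))
      \<le> s * (heat (4 * s) (0 :: 'a) / real N + (\<Sum>i<N. \<Sum>j\<in>{..<N} - {i}. heat (4 * s) (X i - X j)) / (real N)\<^sup>2 + 3 * \<Lambda>)"
      using s by (intro mult_left_mono heat_energy_le) auto
    moreover have "s * ((\<Sum>i<N. \<Sum>j\<in>{..<N} - {i}. heat (4 * s) (X i - X j)) / (real N)\<^sup>2) \<le> E * near_pairs \<kappa> (8 * s)"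
    proof -
      have "(\<Sum>i<N. \<Sum>j\<in>{..<N} - {i}. s * heat (4 * s) (X i - X j)) \<le> (\<Sum>i<N. \<Sum>j\<in>{..<N} - {i}. E * near \<kappa> (8 * s) (X i - X j))"
      proof (intro sum_mono)
        fix i j assume ij: "i \<in> {..<N}" "j \<in> {..<N} - {i}"
        have "s * heat (4 * s) (X i - X j) \<le> (4 * s) * heat (4 * s) (X i - X j)"
          using s by (intro mult_right_mono) auto
        also have "\<dots> \<le> 2 powr (real DIM('a) / 2) * exp (2 * \<kappa>\<^sup>2 * (4 * s)) * near \<kappa> (2 * (4 * s)) (X i - X j)"
          using s ij by (intro heat_le_near \<kappa> Xne) auto
        finally show "s * heat (4 * s) (X i - X j) \<le> E * near \<kappa> (8 * s) (X i - X j)" by (simp add: E_def mult_ac)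
      qed
      then have "(\<Sum>i<N. \<Sum>j\<in>{..<N} - {i}. s * heat (4 * s) (X i - X j)) / (real N)\<^sup>2
          \<le> (\<Sum>i<N. \<Sum>j\<in>{..<N} - {i}. E * near \<kappa> (8 * s) (X i - X j)) / (real N)\<^sup>2"
        by (intro divide_right_mono) auto
      then show ?thesis by (simp add: near_pairs_def sum_distrib_left)
    qed
    ultimately show ?thesis by (simp add: distrib_left mult_ac)
  qed
  have "\<bar>S.interaction\<bar> \<le> L * ((3 * (real DIM('a))\<^sup>2 + 1) * far_energy \<kappa> (2 * s)
      + 9 * real DIM('a) * 2 powr real DIM('a) * (s * (\<integral>q. heat (4 * s) (fst q - snd q) \<partial>(M \<Otimes>\<^sub>M M))))"
    using S.smeared_commutator_estimate by (simp add: far_energy_def mult.assoc)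
  also have "\<dots> \<le> L * ((3 * (real DIM('a))\<^sup>2 + 1) * far_energy \<kappa> (2 * s)
      + 9 * real DIM('a) * 2 powr real DIM('a) * (s * heat (4 * s) (0 :: 'a) / real N + E * near_pairs \<kappa> (8 * s) + 3 * \<Lambda> * s))"
    by (intro mult_left_mono add_left_mono heat L) auto
  finally show ?thesis using comm by (simp add: B2_def distrib_left mult_ac)
qed

end

section \<open>Data of the theorem and choice of constants\<close>

lemma lipschitz_on_lipschitz_seminorm:
  fixes u :: "'a::metric_space \<Rightarrow> 'b::metric_space"
  assumes "globally_lipschitz u"
  shows "(lipschitz_seminorm u)-lipschitz_on UNIV u"
proof -
  let ?S = "{L. L-lipschitz_on UNIV u}"
  have ne: "?S \<noteq> {}" using assms by (auto simp: globally_lipschitz_def)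
  have nonneg: "0 \<le> L" if "L \<in> ?S" for L using that by (auto intro: lipschitz_on_nonneg)
  show ?thesis
  proof (rule lipschitz_onI)
    show "0 \<le> lipschitz_seminorm u"
      unfolding lipschitz_seminorm_def using ne nonneg by (intro cInf_greatest) auto
    fix x y
    show "dist (u x) (u y) \<le> lipschitz_seminorm u * dist x y"
    proof (cases "x = y")
      case False
      \<comment> \<open>The quotient is a lower bound of all Lipschitz constants, so their infimum
        is itself a Lipschitz constant.\<close>
      have "dist (u x) (u y) / dist x y \<le> Inf ?S"
      proof (rule cInf_greatest[OF ne])
        fix L assume "L \<in> ?S"
        then have "dist (u x) (u y) \<le> L * dist x y" by (auto dest: lipschitz_onD)
        then show "dist (u x) (u y) / dist x y \<le> L" using False by (simp add: divide_le_eq)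
      qed
      then show ?thesis using False by (simp add: lipschitz_seminorm_def divide_le_eq)
    qed simp
  qed
qed

lemma configuration_density_measure:
  assumes \<rho>: "probability_density \<rho>" and \<Lambda>: "Linf_norm \<rho> \<le> ereal \<Lambda>" "0 \<le> \<Lambda>"
    and N: "0 < N" and X: "inj_on X {..<N}"
  shows "configuration (density_measure \<rho>) \<Lambda> N (X :: nat \<Rightarrow> 'a::euclidean_space)"
proof (rule configuration.intro)
  have [measurable]: "\<rho> \<in> borel_measurable borel" and int: "integrable lborel \<rho>" "(\<integral>x. \<rho> x \<partial>lborel) = 1"
    and nonneg: "AE x in lborel. 0 \<le> \<rho> x"
    using \<rho> by (auto simp: probability_density_def has_bochner_integral_iff)
  show "prob_space (density_measure \<rho>)"
  proof (rule prob_spaceI)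
    have "emeasure (density_measure \<rho>) UNIV = (\<integral>\<^sup>+x. ennreal (\<rho> x) \<partial>lborel)" by (simp add: emeasure_density)
    also have "\<dots> = 1" using nn_integral_eq_integral[OF int(1) nonneg] int(2) by simp
    finally show "emeasure (density_measure \<rho>) (space (density_measure \<rho>)) = 1" by simp
  qed
  have le: "AE x in lborel. \<rho> x \<le> \<Lambda>"
    using esssup_AE[of "\<lambda>x. ereal \<bar>\<rho> x\<bar>" lborel]
  proof eventually_elim
    fix x assume "ereal \<bar>\<rho> x\<bar> \<le> esssup lborel (\<lambda>x. ereal \<bar>\<rho> x\<bar>)"
    then have "ereal \<bar>\<rho> x\<bar> \<le> ereal \<Lambda>" using \<Lambda>(1) unfolding Linf_norm_def by (rule order.trans)
    then show "\<rho> x \<le> \<Lambda>" by simp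
  qed
  fix f :: "'a \<Rightarrow> ennreal" assume [measurable]: "f \<in> borel_measurable borel"
  have "(\<integral>\<^sup>+x. f x \<partial>density_measure \<rho>) = (\<integral>\<^sup>+x. ennreal (\<rho> x) * f x \<partial>lborel)"
    by (rule nn_integral_density) measurable
  also have "\<dots> \<le> (\<integral>\<^sup>+x. ennreal \<Lambda> * f x \<partial>lborel)"
    by (rule nn_integral_mono_AE) (use le in \<open>eventually_elim, auto intro!: mult_right_mono ennreal_leI\<close>)
  also have "\<dots> = ennreal \<Lambda> * (\<integral>\<^sup>+x. f x \<partial>lborel)" by (rule nn_integral_cmult) measurable
  finally show "(\<integral>\<^sup>+x. f x \<partial>density_measure \<rho>) \<le> ennreal \<Lambda> * (\<integral>\<^sup>+x. f x \<partial>lborel)" .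
qed (use assms in auto)

lemma powr_le_rate:
  assumes "1 \<le> N" "2 \<le> d"
  shows "real N powr (- 2 / real d) \<le> rate N d"
  using assms by (auto simp: rate_def powr_minus_divide divide_right_mono)

text \<open>The scale is chosen so that its power \<open>- d / 2\<close> equals \<open>N\<close>. In
  dimension at least three this turns the power bound into \<open>N\<close> times the scale. In
  dimension two the logarithm of the cut contributes the logarithm of \<open>N\<close>, and its
  \<kappa>-dependent part cancels against the normalization; the bound on \<kappa> from above is
  needed where the positive part of that logarithm vanishes and nothing is left to cancel.\<close>

lemma far_zero_le_rate:
  assumes d: "2 \<le> DIM('a::euclidean_space)" and \<kappa>: "0 < \<kappa>" "\<kappa> \<le> \<kappa>s" and N: "1 \<le> N" and c: "1 \<le> c"
  shows "far \<kappa> (c * real N powr (- 2 / real DIM('a))) (0 :: 'a) / real N + norm_const \<kappa> DIM('a) / real N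
    \<le> (2 + 2 * max 0 (ln \<kappa>s)) * rate N DIM('a)"
proof -
  let ?d = "real DIM('a)"
  define s where "s = real N powr (- 2 / ?d)"
  have s: "0 < s" using N by (simp add: s_def)
  have m: "0 \<le> max 0 (ln \<kappa>s)" by simp
  show ?thesis
  proof (cases "DIM('a) = 2")
    case False
    then have d3: "3 \<le> DIM('a)" using d by simp
    have "far \<kappa> (c * s) (0 :: 'a) \<le> 2 * (c * s) powr (1 - ?d / 2)"
      using s c by (intro far_zero_le_powr \<kappa> d3) auto
    also have "\<dots> \<le> 2 * s powr (1 - ?d / 2)"
      using s c d3 by (intro mult_left_mono powr_mono2') auto
    also have "s powr (1 - ?d / 2) = real N powr (- 2 / ?d + 1)"
    proof -
      have "(- 2 / ?d) * (1 - ?d / 2) = - 2 / ?d + 1" using d3 by (simp add: field_simps)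
      then show ?thesis unfolding s_def powr_powr by (simp only:)
    qed
    also have "\<dots> = s * real N" using N unfolding powr_add s_def by simp
    finally have "far \<kappa> (c * s) (0 :: 'a) / real N \<le> 2 * s" using N by (simp add: divide_le_eq mult.assoc)
    also have "\<dots> \<le> (2 + 2 * max 0 (ln \<kappa>s)) * s" using s m by (intro mult_right_mono) auto
    finally show ?thesis using False by (simp add: norm_const_def rate_def s_def)
  next
    case True
    have s1: "s = 1 / real N" using N by (simp add: s_def True powr_minus_divide)
    have lnN: "0 \<le> ln (real N)" using N by simp
    have "far \<kappa> (c * s) (0 :: 'a) \<le> (max 0 (- ln (\<kappa>\<^sup>2 * (c * s))) + 1) / (4 * pi)"
      using s c by (intro far_zero_le_ln \<kappa> True) auto
    moreover have "ln (\<kappa>\<^sup>2 * (c * s)) = 2 * ln \<kappa> + ln c - ln (real N)"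
      using \<kappa> c N by (simp add: s1 ln_mult ln_div ln_realpow)
    \<comment> \<open>Written over \<open>4 * pi\<close> to match the two copies of
      \<open>ln \<kappa>\<close> in the logarithm above.\<close>
    moreover have "norm_const \<kappa> DIM('a) = 2 * ln \<kappa> / (4 * pi)" by (simp add: norm_const_def True)
    ultimately have "far \<kappa> (c * s) (0 :: 'a) + norm_const \<kappa> DIM('a)
        \<le> (max 0 (- (2 * ln \<kappa> + ln c - ln (real N))) + 1 + 2 * ln \<kappa>) / (4 * pi)"
      by (simp add: add_divide_distrib)
    also have "\<dots> \<le> (2 * max 0 (ln \<kappa>s) + ln (real N) + 1) / (4 * pi)"
    proof (intro divide_right_mono)
      have "ln \<kappa> \<le> max 0 (ln \<kappa>s)" using \<kappa> by (intro max.coboundedI2) simp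
      moreover have "0 \<le> ln c" using c by simp
      ultimately show "max 0 (- (2 * ln \<kappa> + ln c - ln (real N))) + 1 + 2 * ln \<kappa> \<le> 2 * max 0 (ln \<kappa>s) + ln (real N) + 1"
        using lnN by (simp add: max_def split: if_splits)
    qed simp
    also have "\<dots> \<le> (2 * max 0 (ln \<kappa>s) + ln (real N) + 1) / 1"
      using m lnN pi_ge_two by (intro divide_left_mono) auto
    also have "\<dots> \<le> (2 + 2 * max 0 (ln \<kappa>s)) * (1 + ln (real N))"
      using m lnN by (simp add: algebra_simps)
    finally have "(far \<kappa> (c * s) (0 :: 'a) + norm_const \<kappa> DIM('a)) / real N
        \<le> (2 + 2 * max 0 (ln \<kappa>s)) * (1 + ln (real N)) / real N"
      by (intro divide_right_mono) auto
    moreover have "rate N DIM('a) = (1 + ln (real N)) / real N" by (simp add: rate_def True)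
    ultimately show ?thesis
      by (simp only: add_divide_distrib[symmetric] s_def[symmetric] times_divide_eq_right)
  qed
qed

theorem corollary1p2:
  fixes \<kappa>s :: real
  assumes "CARD('d::finite) \<ge> 2" and "\<kappa>s > 0"
  shows "\<exists>c>0. \<forall>\<Lambda>\<ge>1. \<exists>C\<ge>1.
    \<forall>(N::nat) (\<kappa>::real) (\<rho> :: real ^ 'd \<Rightarrow> real) (X :: nat \<Rightarrow> real ^ 'd) (u :: real ^ 'd \<Rightarrow> real ^ 'd).
      2 \<le> N \<longrightarrow> 0 < \<kappa> \<longrightarrow> \<kappa> \<le> \<kappa>s \<longrightarrow>
      probability_density \<rho> \<longrightarrow> Linf_norm \<rho> \<le> ereal \<Lambda> \<longrightarrow>
      inj_on X {..<N} \<longrightarrow> globally_lipschitz u \<longrightarrow>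
        normalized_energy \<kappa> N X \<rho> + C * rate N CARD('d) \<ge> c * rate N CARD('d) \<and>
        c * rate N CARD('d) > 0 \<and>
        \<bar>commutator_energy (yukawa \<kappa>) N X \<rho> u\<bar>
          \<le> C * lipschitz_seminorm u * (normalized_energy \<kappa> N X \<rho> + C * rate N CARD('d))"
proof (rule exI[of _ 1], intro conjI allI impI)
  fix \<Lambda> :: real
  assume \<Lambda>: "1 \<le> \<Lambda>"
  define d where "d = real CARD('d)"
  define K where "K = 2 + 2 * max 0 (ln \<kappa>s)"
  \<comment> \<open>Bounds the factor \<open>E\<close> of the commutator estimate uniformly, because
    \<kappa> is at most \<open>\<kappa>s\<close> and the scale \<open>s\<close> at most 1.\<close>
  define e where "e = 2 powr (d / 2) * exp (8 * \<kappa>s\<^sup>2)"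
  define A1 where "A1 = 3 * d\<^sup>2 + 1"
  define A2 where "A2 = 9 * d * 2 powr d"
  \<comment> \<open>\<open>K\<close> bounds the normalized late self-interaction and
    \<open>24 * \<Lambda>\<close> is the early error \<open>3 * c * \<Lambda>\<close> at the largest
    window \<open>c = 8\<close>. The summand 1 sets one \<open>rate\<close> aside, which makes
    \<open>c = 1\<close> admissible in the lower bound.\<close>
  define C0 where "C0 = K + 24 * \<Lambda> + 1"
  \<comment> \<open>The total coefficient in the commutator estimate once each of its quantities is
    replaced by the common bound \<open>G\<close>.\<close>
  define C1 where "C1 = A1 + A2 * (1 + e + 3 * \<Lambda>) + 2 * e + 24 * \<Lambda> * e"
  \<comment> \<open>\<open>C\<close> serves both as factor and as additive constant, so it has to
    exceed \<open>C1\<close> as well as \<open>C0\<close>.\<close>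
  define C where "C = C0 + C1"
  have K0: "0 \<le> K" and e0: "0 \<le> e" and A10: "0 \<le> A1" and A20: "0 \<le> A2"
    by (auto simp: K_def e_def A1_def A2_def d_def)
  have C10: "0 \<le> C1"
    unfolding C1_def using A10 A20 e0 \<Lambda> by (intro add_nonneg_nonneg mult_nonneg_nonneg) auto
  have C01: "1 \<le> C0" using K0 \<Lambda> by (simp add: C0_def)
  show "\<exists>C\<ge>1. \<forall>(N::nat) (\<kappa>::real) (\<rho> :: real ^ 'd \<Rightarrow> real) (X :: nat \<Rightarrow> real ^ 'd) (u :: real ^ 'd \<Rightarrow> real ^ 'd).
      2 \<le> N \<longrightarrow> 0 < \<kappa> \<longrightarrow> \<kappa> \<le> \<kappa>s \<longrightarrow>
      probability_density \<rho> \<longrightarrow> Linf_norm \<rho> \<le> ereal \<Lambda> \<longrightarrow>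
      inj_on X {..<N} \<longrightarrow> globally_lipschitz u \<longrightarrow>
        normalized_energy \<kappa> N X \<rho> + C * rate N CARD('d) \<ge> 1 * rate N CARD('d) \<and>
        1 * rate N CARD('d) > 0 \<and>
        \<bar>commutator_energy (yukawa \<kappa>) N X \<rho> u\<bar>
          \<le> C * lipschitz_seminorm u * (normalized_energy \<kappa> N X \<rho> + C * rate N CARD('d))"
  proof (intro exI[of _ C] conjI allI impI)
    show "1 \<le> C" using C01 C10 by (simp add: C_def)
    fix N \<kappa> and \<rho> :: "real ^ 'd \<Rightarrow> real" and X :: "nat \<Rightarrow> real ^ 'd" and u :: "real ^ 'd \<Rightarrow> real ^ 'd"
    assume N: "2 \<le> N" and \<kappa>: "0 < \<kappa>" "\<kappa> \<le> \<kappa>s" and \<rho>: "probability_density \<rho>" "Linf_norm \<rho> \<le> ereal \<Lambda>"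
      and X: "inj_on X {..<N}" and u: "globally_lipschitz u"
    define L where "L = lipschitz_seminorm u"
    have lip: "L-lipschitz_on UNIV u" unfolding L_def by (rule lipschitz_on_lipschitz_seminorm[OF u])
    have L: "0 \<le> L" using lip by (rule lipschitz_on_nonneg)
    interpret configuration "density_measure \<rho>" \<Lambda> N X
      using \<rho> \<Lambda> N X by (intro configuration_density_measure) auto
    define a where "a = rate N CARD('d)"
    define s where "s = real N powr (- 2 / d)"
    have s: "0 < s" using N by (simp add: s_def)
    have s1: "s \<le> 1" using N powr_mono[of "- 2 / d" 0 "real N"] by (simp add: s_def d_def)
    have sa: "s \<le> a" unfolding s_def a_def d_def using N assms(1) by (intro powr_le_rate) auto
    have a: "0 < a" using s sa by simp
    define E where "E = normalized_energy \<kappa> N X \<rho>"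
    define Fm where "Fm = offdiag_integral_diff (\<lambda>x y. yukawa \<kappa> (x - y)) \<mu> (density_measure \<rho>)"
    have E: "E = Fm - norm_const \<kappa> CARD('d) / real N"
      by (simp add: E_def normalized_energy_def modulated_energy_def Fm_def)
    have far: "far \<kappa> (c * s) (0 :: real ^ 'd) / real N + norm_const \<kappa> CARD('d) / real N \<le> K * a" if "1 \<le> c" for c
      using far_zero_le_rate[where 'a="real ^ 'd", of \<kappa> \<kappa>s N c] assms(1) \<kappa> N that
      by (simp add: K_def a_def s_def d_def)
    have low: "far_energy \<kappa> (c * s) + near_pairs \<kappa> (c * s) \<le> E + (K + 3 * c * \<Lambda>) * a" if c: "1 \<le> c" for c
    proof -
      have "far_energy \<kappa> (c * s) + near_pairs \<kappa> (c * s) \<le> Fm + far \<kappa> (c * s) (0 :: real ^ 'd) / real N + 3 * (\<Lambda> * (c * s))"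
        unfolding Fm_def using s c \<kappa> by (intro energy_lower_bound yukawa_eq_near_far) auto
      moreover have "3 * (\<Lambda> * (c * s)) \<le> 3 * c * \<Lambda> * a"
        using mult_left_mono[OF sa, of "3 * c * \<Lambda>"] c \<Lambda> by (simp add: mult_ac)
      ultimately show ?thesis using far[OF c] by (simp add: E distrib_right)
    qed
    \<comment> \<open>The late energy and the early interaction are both nonnegative, so the bound
      on their sum holds for each alone. The value \<open>c = 1\<close> gives positivity, while
      \<open>c = 2\<close> and \<open>c = 8\<close> feed the commutator estimate.\<close>
    define G where "G = E + C0 * a"
    have low': "far_energy \<kappa> (c * s) \<le> G - a" "near_pairs \<kappa> (c * s) \<le> G - a" if c: "1 \<le> c" "c \<le> 8" for c
    proof -
      have "(K + 3 * c * \<Lambda>) * a \<le> (K + 24 * \<Lambda>) * a"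
        using mult_left_mono[OF c(2), of \<Lambda>] \<Lambda> a by (intro mult_right_mono) (auto simp: mult.commute)
      then have "far_energy \<kappa> (c * s) + near_pairs \<kappa> (c * s) \<le> E + (K + 24 * \<Lambda>) * a"
        using low[OF c(1)] by linarith
      also have "\<dots> = G - a" by (simp add: G_def C0_def distrib_right)
      finally have "far_energy \<kappa> (c * s) + near_pairs \<kappa> (c * s) \<le> G - a" .
      then show "far_energy \<kappa> (c * s) \<le> G - a" "near_pairs \<kappa> (c * s) \<le> G - a"
        using near_pairs_nonneg[of \<kappa> "c * s"] far_energy_nonneg[OF \<kappa>(1), of "c * s"] s c by auto
    qed
    have Ga: "a \<le> G" using low'(2)[of 1] near_pairs_nonneg[of \<kappa> "1 * s"] by simp
    have GC: "G \<le> E + C * a" using C10 a by (simp add: G_def C_def distrib_right)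
    show "1 * rate N CARD('d) \<le> normalized_energy \<kappa> N X \<rho> + C * rate N CARD('d)"
      using Ga GC by (simp add: a_def E_def)
    show "0 < 1 * rate N CARD('d)" using a by (simp add: a_def)
    define E' where "E' = 2 powr (d / 2) * exp (8 * \<kappa>\<^sup>2 * s)"
    have E'0: "0 \<le> E'" by (simp add: E'_def)
    have E'e: "E' \<le> e"
    proof -
      have "\<kappa>\<^sup>2 * s \<le> \<kappa>s\<^sup>2 * 1" using \<kappa> s s1 by (intro mult_mono power_mono) auto
      then show ?thesis by (simp add: E'_def e_def)
    qed
    have heat: "s * heat (4 * s) (0 :: real ^ 'd) / real N \<le> a"
    proof -
      have "heat (4 * s) (0 :: real ^ 'd) = (4 * pi * (4 * s)) powr (- d / 2)" by (simp add: heat_def d_def)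
      also have "\<dots> \<le> s powr (- d / 2)" using s pi_ge_two by (intro powr_mono2') (auto simp: d_def)
      \<comment> \<open>At this scale a heat kernel peaks at a height of at most order
        \<open>N\<close>, so the smeared self-interaction of \<open>N\<close> particles of weight
        \<open>1 / N\<close> is of order one before the factor \<open>s\<close>.\<close>
      also have "\<dots> = real N"
        using N assms(1) by (simp add: s_def powr_powr d_def)
      finally have "heat (4 * s) (0 :: real ^ 'd) / real N \<le> 1" using N by simp
      then have "s * (heat (4 * s) (0 :: real ^ 'd) / real N) \<le> s * 1" using s by (intro mult_left_mono) auto
      then show ?thesis using sa by simp
    qed
    have P: "0 \<le> near_pairs \<kappa> (8 * s)" "near_pairs \<kappa> (8 * s) \<le> G"
      using near_pairs_nonneg low'(2)[of 8] a by auto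
    have EP: "E' * near_pairs \<kappa> (8 * s) \<le> e * G" using E'e P E'0 e0 by (intro mult_mono) auto
    have sG: "s \<le> G" using sa Ga by simp
    have grad: "gradient (yukawa \<kappa>) y = - (near_slope \<kappa> (2 * s) y + far_slope \<kappa> (2 * s) y) *\<^sub>R y"
      if "y \<noteq> 0" for y :: "real ^ 'd"
      using \<kappa>(1) that s by (intro gradient_yukawa) auto
    have "\<bar>commutator_energy (yukawa \<kappa>) N X \<rho> u\<bar>
      \<le> L * (A1 * far_energy \<kappa> (2 * s)
        + A2 * (s * heat (4 * s) (0 :: real ^ 'd) / real N + E' * near_pairs \<kappa> (8 * s) + 3 * \<Lambda> * s)
        + 2 * E' * near_pairs \<kappa> (8 * s) + 24 * \<Lambda> * E' * s)"
      using commutator_upper_bound[OF \<kappa>(1) s lip grad]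
      by (simp add: commutator_energy_def A1_def A2_def E'_def d_def)
    also have "\<dots> \<le> L * (A1 * G + A2 * (G + e * G + 3 * \<Lambda> * G) + 2 * (e * G) + 24 * \<Lambda> * (e * G))"
    proof (intro mult_left_mono add_mono L A10 A20)
      show "far_energy \<kappa> (2 * s) \<le> G" using low'(1)[of 2] a by simp
      show "s * heat (4 * s) (0 :: real ^ 'd) / real N \<le> G" using heat Ga by simp
      show "E' * near_pairs \<kappa> (8 * s) \<le> e * G" by (rule EP)
      show "s \<le> G" by (rule sG)
      show "0 \<le> 3 * \<Lambda>" using \<Lambda> by simp
      show "2 * E' * near_pairs \<kappa> (8 * s) \<le> 2 * (e * G)" using EP by simp
      have "E' * s \<le> e * G" using E'e sG s e0 by (intro mult_mono) auto
      then show "24 * \<Lambda> * E' * s \<le> 24 * \<Lambda> * (e * G)"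
        using mult_left_mono[of "E' * s" "e * G" "24 * \<Lambda>"] \<Lambda> by (simp add: mult.assoc)
    qed
    also have "\<dots> = L * (C1 * G)" by (simp add: C1_def algebra_simps)
    also have "\<dots> \<le> L * (C * (E + C * a))"
      using L C10 C01 GC Ga a by (intro mult_left_mono mult_mono) (auto simp: C_def)
    finally show "\<bar>commutator_energy (yukawa \<kappa>) N X \<rho> u\<bar>
        \<le> C * lipschitz_seminorm u * (normalized_energy \<kappa> N X \<rho> + C * rate N CARD('d))"
      by (simp add: E_def L_def a_def mult_ac)
  qed
qed simp

end
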